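(* Let $d\ge 2$. The differential operator $L_{d,A}$ of order $d$, which annihilates the generating function $A_d(z)=\sum_{n\ge0}A_n^{(d)}z^n$, is irreducible over $\mathbb{C}(z)\langle D\rangle$: it cannot be written as $L_{d,A}=AB$ with $A,B\in\mathbb{C}(z)\langle D\rangle$ both of order at least $1$.
   Context: $A_n^{(d)}=\sum_{n_1+\dots+n_d=n}\frac{(2n)!}{(n_1!)^2\cdots(n_d!)^2}$ (sum over nonnegative integers). $\mathbb{C}(z)\langle D\rangle$ is the ring of linear differential operators with rational function coefficients, $D=d/dz$, $Dz=zD+1$. The operator $L_{d,A}$ is the following. In the ring $\mathbb{C}[t]\langle\theta\rangle$ with $\theta=t\,\frac{d}{dt}$ (so $\theta t=t(\theta+1)$), define $P_{d,0}=1$, $P_{d,1}=\theta$, and $P_{d,n+1}=\theta P_{d,n}-n(d-n+1)\,t\,P_{d,n-1}$ for $1\le n\le d$. Let $r=\lfloor\frac{d+1}{2}\rfloor$ and write $P_{d,d+1}=\sum_{m=0}^{r}t^mR_m^B(\theta)$ with polynomials $R_m^B$. Put $R_0^A(\theta)=\theta^{d}$ and $R_k^A(\theta)=2^k\,R_k^B(\theta)\prod_{j=1}^{k}(2\theta+2j-1)\prod_{j=1}^{k-1}(\theta+j)$ for $1\le k\le r$. Then, now with $\theta=zD$, $L_{d,A}$ is defined by $z\,L_{d,A}=\sum_{k=0}^rz^kR_k^A(\theta)$. *)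

theory Defs
  imports Complex_Main "HOL-Computational_Algebra.Computational_Algebra"
    "HOL-Computational_Algebra.Field_as_Ring"
begin

section \<open>Rational functions with their derivation\<close>

type_synonym ratfun = "complex poly fract"

definition rf_deriv :: "ratfun \<Rightarrow> ratfun" where
  "rf_deriv x = (let p = fst (quot_of_fract x); q = snd (quot_of_fract x)
     in Fract (pderiv p * q - p * pderiv q) (q\<^sup>2))"

lemma rf_deriv_Fract:
  assumes "b \<noteq> 0"
  shows "rf_deriv (Fract a b) = Fract (pderiv a * b - a * pderiv b) (b\<^sup>2)"
proof -
  define p q where "p = fst (quot_of_fract (Fract a b))" and "q = snd (quot_of_fract (Fract a b))"
  have q: "q \<noteq> 0"
    by (simp add: q_def)
  have "Fract p q = Fract a b"
    by (simp add: p_def q_def Fract_quot_of_fract)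
  then have e: "p * b = a * q"
    using q assms by (simp add: eq_fract)
  then have "pderiv (p * b) = pderiv (a * q)"
    by simp
  then have e': "p * pderiv b + pderiv p * b = a * pderiv q + pderiv a * q"
    by (simp add: pderiv_mult algebra_simps)
  have "(pderiv p * q - p * pderiv q) * b\<^sup>2 = (pderiv a * b - a * pderiv b) * q\<^sup>2"
    using e e' by algebra
  then show ?thesis
    using q assms by (simp add: rf_deriv_def Let_def eq_fract flip: p_def q_def)
qed

lemma rf_deriv_add: "rf_deriv (x + y) = rf_deriv x + rf_deriv y"
proof -
  obtain a b where x: "x = Fract a b" "b \<noteq> 0" by (cases x)
  obtain c d where y: "y = Fract c d" "d \<noteq> 0" by (cases y)
  show ?thesis
    using x y by (simp add: rf_deriv_Fract eq_fract pderiv_mult pderiv_add power2_eq_square algebra_simps)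
qed

lemma rf_deriv_mult: "rf_deriv (x * y) = x * rf_deriv y + rf_deriv x * y"
proof -
  obtain a b where x: "x = Fract a b" "b \<noteq> 0" by (cases x)
  obtain c d where y: "y = Fract c d" "d \<noteq> 0" by (cases y)
  show ?thesis
    using x y by (simp add: rf_deriv_Fract eq_fract pderiv_mult power2_eq_square algebra_simps)
qed

lemma rf_deriv_0 [simp]: "rf_deriv 0 = 0"
  by (simp add: Zero_fract_def rf_deriv_Fract eq_fract)

lemma rf_deriv_1 [simp]: "rf_deriv 1 = 0"
  by (simp add: One_fract_def Zero_fract_def rf_deriv_Fract eq_fract)

definition rf_var :: ratfun where "rf_var = Fract [:0, 1:] 1"

definition rf_const :: "complex \<Rightarrow> ratfun" where "rf_const c = Fract [:c:] 1"

lemma rf_deriv_var [simp]: "rf_deriv rf_var = 1"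
  by (simp add: rf_var_def rf_deriv_Fract pderiv_pCons One_fract_def eq_fract)

lemma rf_deriv_const [simp]: "rf_deriv (rf_const c) = 0"
  by (simp add: rf_const_def rf_deriv_Fract pderiv_pCons Zero_fract_def)

lemma rf_var_nonzero [simp]: "rf_var \<noteq> 0"
  by (simp add: rf_var_def Zero_fract_def eq_fract)

lemma rf_const_add: "rf_const (a + b) = rf_const a + rf_const b"
  by (simp add: rf_const_def)

lemma rf_const_mult: "rf_const (a * b) = rf_const a * rf_const b"
  by (simp add: rf_const_def mult.commute)

lemma rf_const_0 [simp]: "rf_const 0 = 0"
  by (simp add: rf_const_def Zero_fract_def)

lemma rf_const_1 [simp]: "rf_const 1 = 1"
  by (simp add: rf_const_def One_fract_def one_pCons)


section \<open>The ring of linear differential operators with rational function coefficients\<close>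

text \<open>
  An operator \<open>a\<^sub>0 + a\<^sub>1 D + \<dots> + a\<^sub>n D\<^sup>n\<close> is stored as the polynomial with coefficients
  \<open>a\<^sub>0, \<dots>, a\<^sub>n\<close>; only the multiplication differs from that of polynomials, being
  determined by \<open>D a = a D + a'\<close>. The function \<open>lmult_D\<close> is left multiplication by \<open>D\<close>.
\<close>

definition lmult_D :: "ratfun poly \<Rightarrow> ratfun poly" where
  "lmult_D q = pCons 0 q + map_poly rf_deriv q"

definition ore_mult :: "ratfun poly \<Rightarrow> ratfun poly \<Rightarrow> ratfun poly" where
  "ore_mult p q = (\<Sum>i\<le>degree p. smult (coeff p i) ((lmult_D ^^ i) q))"

lemma lmult_D_add: "lmult_D (p + q) = lmult_D p + lmult_D q"
  by (rule poly_eqI)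
    (simp add: lmult_D_def coeff_map_poly rf_deriv_add coeff_pCons split: nat.split)

lemma lmult_D_0 [simp]: "lmult_D 0 = 0"
  by (simp add: lmult_D_def)

lemma lmult_D_smult: "lmult_D (smult a q) = smult a (lmult_D q) + smult (rf_deriv a) q"
  by (rule poly_eqI)
    (simp add: lmult_D_def coeff_map_poly rf_deriv_mult coeff_pCons algebra_simps split: nat.split)

lemma lmult_D_pow_add: "(lmult_D ^^ i) (p + q) = (lmult_D ^^ i) p + (lmult_D ^^ i) q"
  by (induction i) (simp_all add: lmult_D_add)

lemma lmult_D_pow_0 [simp]: "(lmult_D ^^ i) 0 = 0"
  by (induction i) simp_all

lemma ore_mult_bound:
  assumes "degree p \<le> n"
  shows "ore_mult p q = (\<Sum>i\<le>n. smult (coeff p i) ((lmult_D ^^ i) q))"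
  unfolding ore_mult_def using assms
  by (intro sum.mono_neutral_left) (auto simp: coeff_eq_0)

lemma ore_mult_add_left: "ore_mult (p + q) r = ore_mult p r + ore_mult q r"
proof -
  define n where "n = max (degree p) (degree q)"
  have "degree (p + q) \<le> n" "degree p \<le> n" "degree q \<le> n"
    by (auto simp: n_def degree_add_le)
  then show ?thesis
    by (simp add: ore_mult_bound smult_add_left sum.distrib)
qed

lemma ore_mult_add_right: "ore_mult p (q + r) = ore_mult p q + ore_mult p r"
  by (simp add: ore_mult_def lmult_D_pow_add smult_add_right sum.distrib)

lemma ore_mult_0_left [simp]: "ore_mult 0 q = 0"
  by (simp add: ore_mult_def)

lemma ore_mult_0_right [simp]: "ore_mult p 0 = 0"
  by (simp add: ore_mult_def)

lemma ore_mult_smult_left: "ore_mult (smult a p) q = smult a (ore_mult p q)"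
proof -
  have "ore_mult (smult a p) q
      = (\<Sum>i\<le>degree p. smult (coeff (smult a p) i) ((lmult_D ^^ i) q))"
    by (rule ore_mult_bound) (rule degree_smult_le)
  also have "\<dots> = smult a (ore_mult p q)"
    by (rule poly_eqI) (simp add: ore_mult_def coeff_sum sum_distrib_left mult.assoc)
  finally show ?thesis .
qed

lemma ore_mult_const_left: "ore_mult [:a:] q = smult a q"
  by (simp add: ore_mult_def)

lemma ore_mult_pCons_0_left: "ore_mult (pCons 0 p) q = ore_mult p (lmult_D q)"
proof -
  have "degree (pCons 0 p) \<le> Suc (degree p)"
    by (rule degree_pCons_le)
  then have "ore_mult (pCons 0 p) q
      = (\<Sum>i\<le>Suc (degree p). smult (coeff (pCons 0 p) i) ((lmult_D ^^ i) q))"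
    by (rule ore_mult_bound)
  also have "\<dots> = (\<Sum>i\<le>degree p. smult (coeff p i) ((lmult_D ^^ Suc i) q))"
    by (subst sum.atMost_Suc_shift) simp
  also have "\<dots> = ore_mult p (lmult_D q)"
    by (simp add: ore_mult_def funpow_swap1)
  finally show ?thesis .
qed

lemma pCons_split: "pCons a p = [:a:] + pCons 0 p"
  by simp

lemma ore_mult_pCons_left: "ore_mult (pCons a p) q = smult a q + ore_mult p (lmult_D q)"
  by (subst pCons_split) (simp only: ore_mult_add_left ore_mult_const_left ore_mult_pCons_0_left)

lemma lmult_D_pCons: "lmult_D (pCons a p) = pCons (rf_deriv a) (smult a 1 + lmult_D p)"
  by (rule poly_eqI)
    (simp add: lmult_D_def coeff_map_poly coeff_pCons split: nat.split)

lemma lmult_D_ore_mult: "lmult_D (ore_mult p q) = ore_mult (lmult_D p) q"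
proof (induction p arbitrary: q)
  case 0
  then show ?case by simp
next
  case (pCons a p)
  then show ?case
    by (simp add: ore_mult_pCons_left lmult_D_pCons lmult_D_add lmult_D_smult
        ore_mult_add_left ore_mult_smult_left one_pCons ore_mult_const_left)
qed

lemma ore_mult_assoc: "ore_mult (ore_mult p q) r = ore_mult p (ore_mult q r)"
proof (induction p arbitrary: q)
  case 0
  then show ?case by simp
next
  case (pCons a p)
  then show ?case
    by (simp add: ore_mult_pCons_left ore_mult_add_left ore_mult_smult_left lmult_D_ore_mult)
qed

lemma ore_mult_1_left [simp]: "ore_mult 1 q = q"
  by (simp add: one_pCons ore_mult_const_left)

lemma lmult_D_monom_1: "lmult_D (monom 1 i) = monom 1 (Suc i)"
  by (rule poly_eqI) (auto simp: lmult_D_def coeff_map_poly coeff_pCons split: nat.split)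

lemma ore_mult_1_right [simp]: "ore_mult p 1 = p"
proof -
  have "(lmult_D ^^ i) 1 = monom 1 i" for i
    by (induction i) (simp_all add: lmult_D_monom_1)
  then show ?thesis
    by (simp add: ore_mult_def smult_monom poly_as_sum_of_monoms)
qed

typedef diffop = "UNIV :: ratfun poly set"
  morphisms op_coeffs Diffop ..

setup_lifting type_definition_diffop

instantiation diffop :: ring_1
begin

lift_definition zero_diffop :: diffop is 0 .
lift_definition one_diffop :: diffop is 1 .
lift_definition plus_diffop :: "diffop \<Rightarrow> diffop \<Rightarrow> diffop" is "(+)" .
lift_definition minus_diffop :: "diffop \<Rightarrow> diffop \<Rightarrow> diffop" is "(-)" .
lift_definition uminus_diffop :: "diffop \<Rightarrow> diffop" is uminus .
lift_definition times_diffop :: "diffop \<Rightarrow> diffop \<Rightarrow> diffop" is ore_mult .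

instance
  by standard
    (transfer; simp add: ore_mult_assoc ore_mult_add_left ore_mult_add_right)+

end

text \<open>For the zero operator, which has no order, this gives \<open>0\<close>.\<close>

definition op_order :: "diffop \<Rightarrow> nat" where "op_order P = degree (op_coeffs P)"

definition op_of_rf :: "ratfun \<Rightarrow> diffop" where "op_of_rf a = Diffop [:a:]"

definition op_D :: diffop where "op_D = Diffop [:0, 1:]"

lemma op_coeffs_of_rf: "op_coeffs (op_of_rf a) = [:a:]"
  by (simp add: op_of_rf_def Diffop_inverse)

lemma op_coeffs_D: "op_coeffs op_D = [:0, 1:]"
  by (simp add: op_D_def Diffop_inverse)

definition op_z :: diffop where "op_z = op_of_rf rf_var"

definition op_const :: "complex \<Rightarrow> diffop" where "op_const c = op_of_rf (rf_const c)"

definition op_theta :: diffop where "op_theta = op_z * op_D"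

lemmas op_coeffs_simps =
  zero_diffop.rep_eq one_diffop.rep_eq plus_diffop.rep_eq times_diffop.rep_eq
  op_coeffs_of_rf op_coeffs_D

lemma op_of_rf_0 [simp]: "op_of_rf 0 = 0"
  by (simp add: op_coeffs_simps flip: op_coeffs_inject)

lemma op_of_rf_1 [simp]: "op_of_rf 1 = 1"
  by (simp add: op_coeffs_simps one_pCons flip: op_coeffs_inject)

lemma op_of_rf_add: "op_of_rf (a + b) = op_of_rf a + op_of_rf b"
  by (simp add: op_coeffs_simps flip: op_coeffs_inject)

lemma op_of_rf_mult: "op_of_rf (a * b) = op_of_rf a * op_of_rf b"
  by (simp add: op_coeffs_simps ore_mult_const_left flip: op_coeffs_inject)

lemma op_D_rf: "op_D * op_of_rf a = op_of_rf a * op_D + op_of_rf (rf_deriv a)"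
  by (simp add: op_coeffs_simps ore_mult_pCons_left lmult_D_def map_poly_pCons
      flip: op_coeffs_inject)

lemma op_D_z: "op_D * op_z = op_z * op_D + 1"
  by (simp add: op_z_def op_D_rf)

lemma op_theta_z: "op_theta * op_z = op_z * (op_theta + 1)"
  by (simp add: op_theta_def op_D_z mult.assoc distrib_left)

lemma diffop_eq_sum: "P = (\<Sum>i\<le>op_order P. op_of_rf (coeff (op_coeffs P) i) * op_D ^ i)"
proof -
  have pow: "op_coeffs (op_D ^ i) = monom 1 i" for i
    by (induction i)
      (simp_all add: one_diffop.rep_eq times_diffop.rep_eq op_coeffs_D ore_mult_pCons_left
        lmult_D_monom_1)
  have sum: "op_coeffs (sum f A) = (\<Sum>i\<in>A. op_coeffs (f i))" for f :: "nat \<Rightarrow> diffop" and A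
    by (induction A rule: infinite_finite_induct)
      (simp_all add: zero_diffop.rep_eq plus_diffop.rep_eq)
  have "op_coeffs (\<Sum>i\<le>op_order P. op_of_rf (coeff (op_coeffs P) i) * op_D ^ i) = op_coeffs P"
    by (simp add: sum times_diffop.rep_eq op_coeffs_of_rf pow ore_mult_const_left smult_monom
        op_order_def poly_as_sum_of_monoms)
  then show ?thesis
    by (simp add: op_coeffs_inject)
qed


section \<open>Action on formal Laurent series\<close>

definition poly_fls :: "complex poly \<Rightarrow> complex fls" where
  "poly_fls p = fps_to_fls (fps_of_poly p)"

definition rf_fls :: "ratfun \<Rightarrow> complex fls" where
  "rf_fls x = poly_fls (fst (quot_of_fract x)) / poly_fls (snd (quot_of_fract x))"

lemma poly_fls_simps:
  "poly_fls (p + q) = poly_fls p + poly_fls q"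
  "poly_fls (p - q) = poly_fls p - poly_fls q"
  "poly_fls (p * q) = poly_fls p * poly_fls q"
  "poly_fls (p ^ n) = poly_fls p ^ n"
  "poly_fls (pderiv p) = fls_deriv (poly_fls p)"
  "poly_fls 0 = 0" "poly_fls 1 = 1" "poly_fls [:c:] = fls_const c"
  by (simp_all add: poly_fls_def fps_of_poly_add fps_of_poly_diff fps_of_poly_mult
      fls_times_fps_to_fls fps_of_poly_power fps_to_fls_power fps_of_poly_pderiv
      fls_deriv_fps_to_fls fps_of_poly_const)

lemma poly_fls_eq_0_iff [simp]: "poly_fls p = 0 \<longleftrightarrow> p = 0"
  by (metis fps_of_poly_0 fps_of_poly_eq_iff fps_to_fls_eq_0_iff poly_fls_def)

lemma rf_fls_Fract:
  assumes "b \<noteq> 0"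
  shows "rf_fls (Fract a b) = poly_fls a / poly_fls b"
proof -
  define p q where "p = fst (quot_of_fract (Fract a b))" and "q = snd (quot_of_fract (Fract a b))"
  have q: "q \<noteq> 0"
    by (simp add: q_def)
  have "Fract p q = Fract a b"
    by (simp add: p_def q_def Fract_quot_of_fract)
  then have "p * b = a * q"
    using q assms by (simp add: eq_fract)
  then have "poly_fls p * poly_fls b = poly_fls a * poly_fls q"
    by (simp flip: poly_fls_simps)
  then show ?thesis
    using q assms by (simp add: rf_fls_def frac_eq_eq flip: p_def q_def)
qed

lemma rf_fls_add: "rf_fls (x + y) = rf_fls x + rf_fls y"
proof -
  obtain a b where x: "x = Fract a b" "b \<noteq> 0" by (cases x)
  obtain c d where y: "y = Fract c d" "d \<noteq> 0" by (cases y)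
  show ?thesis
    using x y by (simp add: rf_fls_Fract poly_fls_simps add_frac_eq)
qed

lemma rf_fls_mult: "rf_fls (x * y) = rf_fls x * rf_fls y"
proof -
  obtain a b where x: "x = Fract a b" "b \<noteq> 0" by (cases x)
  obtain c d where y: "y = Fract c d" "d \<noteq> 0" by (cases y)
  show ?thesis
    using x y by (simp add: rf_fls_Fract poly_fls_simps)
qed

lemma rf_fls_0 [simp]: "rf_fls 0 = 0"
  by (simp add: Zero_fract_def rf_fls_Fract poly_fls_simps)

lemma rf_fls_1 [simp]: "rf_fls 1 = 1"
  by (simp add: One_fract_def rf_fls_Fract poly_fls_simps)

lemma rf_fls_const [simp]: "rf_fls (rf_const c) = fls_const c"
  by (simp add: rf_const_def rf_fls_Fract poly_fls_simps)

lemma rf_fls_var [simp]: "rf_fls rf_var = fls_X"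
  by (simp add: rf_var_def rf_fls_Fract poly_fls_simps) (simp add: poly_fls_def)

lemma rf_fls_deriv: "rf_fls (rf_deriv x) = fls_deriv (rf_fls x)"
proof -
  obtain a b where x: "x = Fract a b" "b \<noteq> 0" by (cases x)
  define f where "f = poly_fls a / poly_fls b"
  have a: "poly_fls a = f * poly_fls b"
    using x by (simp add: f_def)
  have "fls_deriv (poly_fls a) = f * fls_deriv (poly_fls b) + fls_deriv f * poly_fls b"
    by (simp add: a)
  then show ?thesis
    using x by (simp add: rf_deriv_Fract rf_fls_Fract poly_fls_simps flip: f_def)
      (simp add: a field_simps power2_eq_square)
qed

definition op_apply :: "diffop \<Rightarrow> complex fls \<Rightarrow> complex fls" where
  "op_apply P f =
    (\<Sum>i\<le>op_order P. rf_fls (coeff (op_coeffs P) i) * (fls_deriv ^^ i) f)"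

lemma op_apply_bound:
  assumes "op_order P \<le> n"
  shows "op_apply P f = (\<Sum>i\<le>n. rf_fls (coeff (op_coeffs P) i) * (fls_deriv ^^ i) f)"
  unfolding op_apply_def using assms
  by (intro sum.mono_neutral_left) (auto simp: coeff_eq_0 op_order_def)

lemma op_apply_add: "op_apply (P + Q) f = op_apply P f + op_apply Q f"
proof -
  define n where "n = max (op_order P) (op_order Q)"
  have "op_order (P + Q) \<le> n" "op_order P \<le> n" "op_order Q \<le> n"
    by (auto simp: n_def op_order_def plus_diffop.rep_eq degree_add_le)
  then show ?thesis
    by (simp add: op_apply_bound plus_diffop.rep_eq rf_fls_add distrib_right sum.distrib)
qed

lemma fls_deriv_pow_add: "(fls_deriv ^^ i) (f + g) = (fls_deriv ^^ i) f + (fls_deriv ^^ i) (g::complex fls)"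
  by (induction i) simp_all

lemma op_apply_add_right: "op_apply P (f + g) = op_apply P f + op_apply P g"
  by (simp add: op_apply_def fls_deriv_pow_add distrib_left sum.distrib)

lemma op_apply_0 [simp]: "op_apply 0 f = 0"
  by (simp add: op_apply_def zero_diffop.rep_eq)

lemma op_apply_1 [simp]: "op_apply 1 f = f"
  by (simp add: op_apply_def one_diffop.rep_eq op_order_def)

lemma op_apply_sum: "op_apply (sum P A) f = (\<Sum>i\<in>A. op_apply (P i) f)"
  by (induction A rule: infinite_finite_induct) (simp_all add: op_apply_add)

lemma op_apply_rf: "op_apply (op_of_rf a) f = rf_fls a * f"
  by (simp add: op_apply_def op_coeffs_of_rf op_order_def)

lemma op_apply_D: "op_apply op_D f = fls_deriv f"
  by (simp add: op_apply_def op_coeffs_D op_order_def)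

lemma op_apply_rf_mult: "op_apply (op_of_rf a * P) f = rf_fls a * op_apply P f"
proof -
  have "op_order (op_of_rf a * P) \<le> op_order P"
    by (simp add: op_order_def times_diffop.rep_eq op_coeffs_of_rf ore_mult_const_left
        degree_smult_le)
  then show ?thesis
    by (subst op_apply_bound, assumption)
      (simp add: times_diffop.rep_eq op_coeffs_of_rf ore_mult_const_left
        rf_fls_mult op_apply_def sum_distrib_left mult.assoc)
qed

lemma fls_deriv_sum': "fls_deriv (sum f A) = (\<Sum>i\<in>A. fls_deriv (f i :: complex fls))"
  by (induction A rule: infinite_finite_induct) simp_all

lemma op_apply_D_mult: "op_apply (op_D * P) f = fls_deriv (op_apply P f)"
proof -
  let ?p = "op_coeffs P" and ?n = "op_order P"
  have c: "op_coeffs (op_D * P) = lmult_D ?p"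
    by (simp add: times_diffop.rep_eq op_coeffs_D ore_mult_pCons_left)
  have "op_order (op_D * P) \<le> Suc ?n"
    unfolding op_order_def c lmult_D_def
    by (intro degree_add_le degree_pCons_le le_SucI map_poly_degree_leq)
  then have "op_apply (op_D * P) f
      = (\<Sum>i\<le>Suc ?n. rf_fls (coeff (pCons 0 ?p) i) * (fls_deriv ^^ i) f)
        + (\<Sum>i\<le>Suc ?n. rf_fls (rf_deriv (coeff ?p i)) * (fls_deriv ^^ i) f)"
    by (simp only: op_apply_bound c lmult_D_def coeff_add rf_fls_add distrib_right sum.distrib
        coeff_map_poly rf_deriv_0)
  also have "(\<Sum>i\<le>Suc ?n. rf_fls (coeff (pCons 0 ?p) i) * (fls_deriv ^^ i) f)
      = (\<Sum>i\<le>?n. rf_fls (coeff ?p i) * (fls_deriv ^^ Suc i) f)"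
    by (subst sum.atMost_Suc_shift) simp
  also have "(\<Sum>i\<le>Suc ?n. rf_fls (rf_deriv (coeff ?p i)) * (fls_deriv ^^ i) f)
      = (\<Sum>i\<le>?n. rf_fls (rf_deriv (coeff ?p i)) * (fls_deriv ^^ i) f)"
    by (simp add: coeff_eq_0 op_order_def)
  finally show ?thesis
    by (simp add: op_apply_def fls_deriv_sum' rf_fls_deriv sum.distrib)
qed

lemma op_apply_mult: "op_apply (P * Q) f = op_apply P (op_apply Q f)"
proof -
  have D: "op_apply (op_D ^ i * Q) f = (fls_deriv ^^ i) (op_apply Q f)" for i
    by (induction i) (simp_all add: op_apply_D_mult mult.assoc)
  have "op_apply (P * Q) f
      = op_apply ((\<Sum>i\<le>op_order P. op_of_rf (coeff (op_coeffs P) i) * op_D ^ i) * Q) f"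
    by (subst (1) diffop_eq_sum) (rule refl)
  also have "\<dots> = op_apply P (op_apply Q f)"
    by (simp add: sum_distrib_right mult.assoc op_apply_sum op_apply_rf_mult D)
      (simp add: op_apply_def)
  finally show ?thesis .
qed


section \<open>The operators and the generating function\<close>

definition op_poly :: "complex poly \<Rightarrow> diffop \<Rightarrow> diffop" where
  "op_poly q P = (\<Sum>i\<le>degree q. op_const (coeff q i) * P ^ i)"

text \<open>
  The ring \<open>\<complex>[t]\<langle>\<theta>\<rangle>\<close> with \<open>\<theta> = t d/dt\<close> is regarded as a subring of the ring of operators
  over \<open>\<complex>(t)\<close>; the variable \<open>t\<close> is \<^const>\<open>op_z\<close>. In the last equation the factor is
  \<open>n (d - n + 1)\<close> for \<open>n = k + 1\<close>, computed in the ring.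
\<close>

fun P_op :: "nat \<Rightarrow> nat \<Rightarrow> diffop" where
  "P_op d 0 = 1"
| "P_op d (Suc 0) = op_theta"
| "P_op d (Suc (Suc k)) =
     op_theta * P_op d (Suc k) - of_nat (Suc k) * (of_nat d - of_nat k) * op_z * P_op d k"

definition R_B :: "nat \<Rightarrow> nat \<Rightarrow> complex poly" where
  "R_B d = (THE R. (\<forall>m > (d + 1) div 2. R m = 0) \<and>
     P_op d (d + 1) = (\<Sum>m\<le>(d + 1) div 2. op_z ^ m * op_poly (R m) op_theta))"

definition R_A :: "nat \<Rightarrow> nat \<Rightarrow> complex poly" where
  "R_A d k = (if k = 0 then [:0, 1:] ^ d
     else 2 ^ k * R_B d k * (\<Prod>j = 1..k. [:2 * of_nat j - 1, 2:]) * (\<Prod>j = 1..k - 1. [:of_nat j, 1:]))"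

definition L_A :: "nat \<Rightarrow> diffop" where
  "L_A d = op_of_rf (inverse rf_var) *
     (\<Sum>k\<le>(d + 1) div 2. op_z ^ k * op_poly (R_A d k) op_theta)"

definition A_num :: "nat \<Rightarrow> nat \<Rightarrow> complex" where
  "A_num d n = (\<Sum>ns | length ns = d \<and> sum_list ns = n.
     fact (2 * n) / prod_list (map (\<lambda>m. (fact m)\<^sup>2) ns))"

definition A_gen :: "nat \<Rightarrow> complex fps" where "A_gen d = Abs_fps (A_num d)"


subsection \<open>The defining conditions hold\<close>

lemma finite_compositions: "finite {ns :: nat list. length ns = d \<and> sum_list ns = n}"
proof (rule finite_subset)
  show "{ns. length ns = d \<and> sum_list ns = n} \<subseteq> {ns. set ns \<subseteq> {..n} \<and> length ns = d}"
    by (auto dest: member_le_sum_list)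
qed (simp add: finite_lists_length_eq)

lemma op_z_L_A: "op_z * L_A d = (\<Sum>k\<le>(d + 1) div 2. op_z ^ k * op_poly (R_A d k) op_theta)"
proof -
  have "op_z * op_of_rf (inverse rf_var) = 1"
    by (simp add: op_z_def flip: op_of_rf_mult)
  then show ?thesis
    by (simp add: L_A_def flip: mult.assoc)
qed

lemma op_const_0 [simp]: "op_const 0 = 0"
  and op_const_1 [simp]: "op_const 1 = 1"
  and op_const_add: "op_const (a + b) = op_const a + op_const b"
  and op_const_mult: "op_const (a * b) = op_const a * op_const b"
  by (simp_all add: op_const_def rf_const_add rf_const_mult op_of_rf_add op_of_rf_mult)

lemma op_const_z: "op_const c * op_z = op_z * op_const c"
  by (simp add: op_const_def op_z_def mult.commute flip: op_of_rf_mult)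

lemma op_const_theta: "op_theta * op_const c = op_const c * op_theta"
proof -
  have "op_D * op_const c = op_const c * op_D"
    by (simp add: op_const_def op_D_rf)
  then show ?thesis
    by (simp add: op_theta_def mult.assoc) (simp add: op_const_z flip: mult.assoc)
qed

lemma op_poly_0 [simp]: "op_poly 0 P = 0"
  by (simp add: op_poly_def)

lemma op_poly_bound:
  assumes "degree q \<le> n"
  shows "op_poly q P = (\<Sum>i\<le>n. op_const (coeff q i) * P ^ i)"
  unfolding op_poly_def using assms
  by (intro sum.mono_neutral_left) (auto simp: coeff_eq_0)

lemma op_poly_add: "op_poly (p + q) P = op_poly p P + op_poly q P"
proof -
  define n where "n = max (degree p) (degree q)"
  have "degree (p + q) \<le> n" "degree p \<le> n" "degree q \<le> n"
    by (auto simp: n_def degree_add_le)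
  then show ?thesis
    by (simp add: op_poly_bound op_const_add distrib_right sum.distrib)
qed

lemma op_poly_sum: "op_poly (sum f A) P = (\<Sum>x\<in>A. op_poly (f x) P)"
  by (induction A rule: infinite_finite_induct) (simp_all add: op_poly_add)

lemma op_poly_smult: "op_poly (smult c q) P = op_const c * op_poly q P"
proof -
  have "op_poly (smult c q) P = (\<Sum>i\<le>degree q. op_const (coeff (smult c q) i) * P ^ i)"
    by (rule op_poly_bound) (rule degree_smult_le)
  then show ?thesis
    by (simp add: op_poly_def op_const_mult sum_distrib_left mult.assoc)
qed

lemma op_poly_diff: "op_poly (p - q) P = op_poly p P - op_poly q P"
  using op_poly_add[of "p - q" q P] by simp

lemma op_poly_theta_times: "op_poly ([:0, 1:] * q) op_theta = op_theta * op_poly q op_theta"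
proof -
  have "op_poly (pCons 0 q) op_theta
      = (\<Sum>i\<le>Suc (degree q). op_const (coeff (pCons 0 q) i) * op_theta ^ i)"
    by (rule op_poly_bound) (rule degree_pCons_le)
  also have "\<dots> = (\<Sum>i\<le>degree q. op_const (coeff q i) * op_theta ^ Suc i)"
    by (subst sum.atMost_Suc_shift) simp
  also have "\<dots> = op_theta * op_poly q op_theta"
    by (simp add: op_poly_def sum_distrib_left op_const_theta flip: mult.assoc)
  finally show ?thesis by simp
qed

lemma op_theta_z_power: "op_theta * op_z ^ m = op_z ^ m * (op_theta + of_nat m)"
proof (induction m)
  case (Suc m)
  have "op_theta * op_z ^ Suc m = op_z * (op_theta * op_z ^ m) + op_z * op_z ^ m"
    by (simp add: op_theta_z distrib_left distrib_right flip: mult.assoc)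
  also have "\<dots> = op_z ^ Suc m * (op_theta + of_nat (Suc m))"
    by (simp add: Suc distrib_left mult.assoc)
  finally show ?case .
qed simp

lemma of_nat_op_const: "of_nat n = op_const (of_nat n)"
  by (induction n) (simp_all add: op_const_add)

lemma op_theta_normal_form:
  "op_theta * (op_z ^ m * op_poly q op_theta)
    = op_z ^ m * op_poly ([:0, 1:] * q + smult (of_nat m) q) op_theta"
proof -
  have "op_theta * (op_z ^ m * op_poly q op_theta)
      = op_z ^ m * (op_theta + of_nat m) * op_poly q op_theta"
    by (simp add: op_theta_z_power flip: mult.assoc)
  then show ?thesis
    by (simp only: op_poly_add op_poly_smult op_poly_theta_times of_nat_op_const
        distrib_left distrib_right mult.assoc)
qed

lemma P_op_normal_form_exists:
  "\<exists>R. (\<forall>m > n div 2. R m = 0) \<and>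
     P_op d n = (\<Sum>m\<le>n div 2. op_z ^ m * op_poly (R m) op_theta)"
proof (induction n rule: induct_nat_012)
  case 0
  show ?case
    by (rule exI[of _ "\<lambda>m. if m = 0 then 1 else 0"]) (simp add: op_poly_def)
next
  case 1
  show ?case
    by (rule exI[of _ "\<lambda>m. if m = 0 then [:0, 1:] else 0"]) (simp add: op_poly_def)
next
  case (ge2 n)
  from ge2(1) obtain R where R0: "\<And>m. m > n div 2 \<Longrightarrow> R m = 0"
    and R: "P_op d n = (\<Sum>m\<le>n div 2. op_z ^ m * op_poly (R m) op_theta)" by blast
  from ge2(2) obtain S where S0: "\<And>m. m > Suc n div 2 \<Longrightarrow> S m = 0"
    and S: "P_op d (Suc n) = (\<Sum>m\<le>Suc n div 2. op_z ^ m * op_poly (S m) op_theta)" by blast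
  let ?N = "Suc (n div 2)"
  define c :: complex where "c = of_nat (Suc n) * (of_nat d - of_nat n)"
  define T where "T m = [:0, 1:] * S m + smult (of_nat m) (S m)
    - (case m of 0 \<Rightarrow> 0 | Suc k \<Rightarrow> smult c (R k))" for m
  have c: "of_nat (Suc n) * (of_nat d - of_nat n) = op_const c"
  proof -
    have "of_nat d - of_nat n = op_const (of_nat d - of_nat n)"
      using op_const_add[of "of_nat d - of_nat n" "of_nat n"]
      by (simp add: of_nat_op_const)
    then show ?thesis
      by (simp only: c_def op_const_mult of_nat_op_const)
  qed
  have "P_op d (Suc n) = (\<Sum>m\<le>?N. op_z ^ m * op_poly (S m) op_theta)"
    unfolding S by (rule sum.mono_neutral_left) (auto simp: S0)
  then have 1: "op_theta * P_op d (Suc n)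
      = (\<Sum>m\<le>?N. op_z ^ m * op_poly ([:0, 1:] * S m + smult (of_nat m) (S m)) op_theta)"
    by (simp only: sum_distrib_left op_theta_normal_form)
  have "op_const c * op_z * P_op d n
      = (\<Sum>m\<le>n div 2. op_z ^ Suc m * op_poly (smult c (R m)) op_theta)"
  proof -
    have comm: "op_const c * op_z ^ k = op_z ^ k * op_const c" for k
      by (induction k) (simp, metis mult.assoc op_const_z power_Suc)
    have "op_const c * op_z * (op_z ^ m * q) = op_z ^ Suc m * (op_const c * q)" for m q
      using comm[of "Suc m"] by (simp flip: mult.assoc)
    then show ?thesis
      by (simp only: R sum_distrib_left op_poly_smult)
  qed
  also have "\<dots> = (\<Sum>m\<le>?N. op_z ^ m *
      op_poly (case m of 0 \<Rightarrow> 0 | Suc k \<Rightarrow> smult c (R k)) op_theta)"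
    by (subst sum.atMost_Suc_shift) simp
  finally have 2: "op_const c * op_z * P_op d n = \<dots>" .
  have "P_op d (Suc (Suc n)) = (\<Sum>m\<le>?N. op_z ^ m * op_poly (T m) op_theta)"
    unfolding P_op.simps c 1 2
    by (simp only: T_def op_poly_diff right_diff_distrib sum_subtractf)
  moreover have "\<forall>m > ?N. T m = 0"
    by (auto simp: T_def R0 S0 split: nat.split)
  ultimately show ?case
    by (intro exI[of _ T]) simp
qed

lemma op_apply_z: "op_apply (op_z * P) f = fls_X * op_apply P f"
  by (simp add: op_z_def op_apply_rf_mult)

lemma op_apply_z_power: "op_apply (op_z ^ m * P) f = fls_X ^ m * op_apply P f"
  by (induction m) (simp_all add: op_apply_z mult.assoc)

lemma op_apply_const: "op_apply (op_const c * P) f = fls_const c * op_apply P f"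
  by (simp add: op_const_def op_apply_rf_mult)

lemma op_apply_theta_X:
  "op_apply op_theta (fls_const c * fls_X ^ n) = fls_const (c * of_nat n) * fls_X ^ n"
proof (cases n)
  case (Suc k)
  have "op_apply op_theta (fls_const c * fls_X ^ n)
      = fls_X * (fls_const c * fls_deriv (fls_X ^ n))"
    by (simp add: op_theta_def op_apply_z op_apply_D)
  also have "\<dots> = fls_const c * of_nat n * (fls_X * fls_X ^ k)"
    by (simp only: fls_deriv_X_power Suc diff_Suc_1 mult_ac)
  finally show ?thesis
    by (simp add: Suc fls_of_nat flip: fls_const_mult_const)
qed (simp add: op_theta_def op_apply_z op_apply_D)

lemma op_apply_theta_power_X: "op_apply (op_theta ^ i) (fls_X ^ n) = fls_const (of_nat n ^ i) * fls_X ^ n"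
proof (induction i)
  case (Suc i)
  show ?case
    using op_apply_theta_X[of "of_nat n ^ i" n] by (simp add: op_apply_mult Suc mult.commute)
qed simp

lemma fls_const_sum: "fls_const (sum f A) = (\<Sum>x\<in>A. fls_const (f x :: complex))"
  by (induction A rule: infinite_finite_induct) (simp_all flip: fls_plus_const)

lemma op_apply_poly_theta_X:
  "op_apply (op_poly q op_theta) (fls_X ^ n) = fls_const (poly q (of_nat n)) * fls_X ^ n"
  by (simp add: op_poly_def op_apply_sum op_apply_const op_apply_theta_power_X poly_altdef
      fls_const_sum sum_distrib_right flip: fls_const_mult_const mult.assoc)

lemma normal_form_unique:
  assumes "(\<Sum>m\<le>r. op_z ^ m * op_poly (R m) op_theta) = (\<Sum>m\<le>r. op_z ^ m * op_poly (S m) op_theta)"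
    and "m \<le> r"
  shows "R m = S m"
proof -
  have "poly (R m) (of_nat n) = poly (S m) (of_nat n)" for n
  proof -
    have nth: "fls_nth (op_apply (\<Sum>m\<le>r. op_z ^ m * op_poly (Q m) op_theta) (fls_X ^ n))
        (int (m + n)) = poly (Q m) (of_nat n)" for Q
    proof -
      have "op_apply (\<Sum>m\<le>r. op_z ^ m * op_poly (Q m) op_theta) (fls_X ^ n)
          = (\<Sum>k\<le>r. fls_const (poly (Q k) (of_nat n)) * fls_X ^ (k + n))"
        by (simp add: op_apply_sum op_apply_z_power op_apply_poly_theta_X power_add mult_ac)
      also have "fls_nth \<dots> (int (m + n)) = (\<Sum>k\<le>r. if k = m then poly (Q k) (of_nat n) else 0)"
        by (unfold fls_nth_sum, intro sum.cong) auto
      finally show ?thesis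
        using assms(2) by simp
    qed
    show ?thesis
      using nth[of R] nth[of S] assms(1) by simp
  qed
  then have sub: "range (of_nat :: nat \<Rightarrow> complex) \<subseteq> {x. poly (R m - S m) x = 0}"
    by auto
  have "infinite (range (of_nat :: nat \<Rightarrow> complex))"
    by (rule range_inj_infinite) (rule inj_of_nat)
  then have "infinite {x. poly (R m - S m) x = 0}"
    using sub finite_subset by metis
  then have "R m - S m = 0"
    by (metis poly_roots_finite)
  then show ?thesis
    by simp
qed

lemma R_B:
  "P_op d (d + 1) = (\<Sum>m\<le>(d + 1) div 2. op_z ^ m * op_poly (R_B d m) op_theta)"
  "m > (d + 1) div 2 \<Longrightarrow> R_B d m = 0"
proof -
  let ?Q = "\<lambda>R. (\<forall>m > (d + 1) div 2. R m = 0) \<and>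
     P_op d (d + 1) = (\<Sum>m\<le>(d + 1) div 2. op_z ^ m * op_poly (R m) op_theta)"
  have "\<exists>!R. ?Q R"
  proof (rule ex_ex1I)
    show "\<exists>R. ?Q R"
      by (rule P_op_normal_form_exists)
  next
    fix R S assume R: "?Q R" and S: "?Q S"
    show "R = S"
    proof
      fix m
      show "R m = S m"
      proof (cases "m \<le> (d + 1) div 2")
        case True
        show ?thesis
          by (rule normal_form_unique[OF _ True]) (use R S in argo)
      qed (use R S in simp)
    qed
  qed
  from theI'[OF this] have "?Q (R_B d)"
    unfolding R_B_def .
  then show "P_op d (d + 1) = (\<Sum>m\<le>(d + 1) div 2. op_z ^ m * op_poly (R_B d m) op_theta)"
    "m > (d + 1) div 2 \<Longrightarrow> R_B d m = 0" by blast+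
qed

end

theory Submission
  imports Defs
begin

text \<open>
  Why \<open>L_A d\<close> is irreducible. At every point of the projective line the local exponents of a right
  factor are among those of the operator (\<open>monic_right_factor\<close>). For a monic right factor
  \<open>D\<^sup>b + f D\<^sup>b\<^sup>-\<^sup>1 + \<dots>\<close> of order \<open>b\<close> this controls \<open>f\<close>: its residue at a finite point is
  \<open>b (b - 1) / 2\<close> minus the sum of the \<open>b\<close> exponents there, and the exponents at infinity
  determine the sum of all residues (\<open>sum_of_residues\<close>; together this is the relation of Fuchs).
  For \<open>0 < b < d\<close> the exponents of \<open>L_A d\<close> do not leave room for that.

  In detail, write \<open>z L_A d = \<Sum>\<^sub>k z\<^sup>k R\<^sub>k(\<theta>)\<close> with \<open>k \<le> r = \<lfloor>(d + 1) / 2\<rfloor>\<close>. Its leading coefficient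
  is \<open>z\<^sup>d Q(z)\<close>, where \<open>Q\<close> has degree \<open>r\<close> and the \<open>r\<close> simple roots \<open>1 / (4 (d - 2 i)\<^sup>2)\<close>,
  \<open>0 \<le> i < r\<close>. The exponents are \<open>0, \<dots>, 0\<close> at the origin because \<open>R\<^sub>0 = \<theta>\<^sup>d\<close>; they are
  \<open>0, \<dots>, d - 2, d/2 - 1\<close> at a root of \<open>Q\<close>, and \<open>0, \<dots>, d - 1\<close> at all other finite points. Hence the
  residue of \<open>f\<close> is \<open>b (b - 1) / 2\<close> at the origin, at most \<open>max 0 (b - d/2)\<close> at a root of \<open>Q\<close>, and
  at most \<open>0\<close> elsewhere. At infinity the factor selects \<open>b\<close> of the \<open>d\<close> roots of \<open>R\<^sub>r\<close>; with \<open>\<sigma>\<close> for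
  their sum, the sum of all residues is \<open>b (b - 1) / 2 - \<sigma>\<close>. Therefore \<open>-\<sigma> \<le> r max 0 (b - d/2)\<close>.
  But all roots of \<open>R\<^sub>r\<close> lie strictly between \<open>-r\<close> and \<open>0\<close> and have sum \<open>-d r / 2\<close>, so \<open>\<sigma> < 0\<close>, and
  the \<open>d - b\<close> roots left over give \<open>\<sigma> < r (d/2 - b)\<close>: a contradiction.

  What has to be known about the \<open>R\<^sub>k\<close> is thus their two top coefficients. The top coefficients of
  the \<open>P\<^sub>d\<^sub>,\<^sub>n\<close> obey the three-term recurrence of the Krawtchouk polynomials, whose roots are known
  (\<open>poly_symbol_krawtchouk\<close>); the next ones have a closed form in terms of them
  (\<open>coeff_theta_coeff_subtop\<close>), and the result is \<open>R\<^sub>k = q\<^sub>k (\<theta>\<^sup>d + (d k / 2) \<theta>\<^sup>d\<^sup>-\<^sup>1 + \<dots>)\<close>, where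
  \<open>Q = \<Sum>\<^sub>k q\<^sub>k z\<^sup>k\<close> (\<open>top_terms_R_A\<close>).

  Why \<open>L_A d\<close> annihilates the generating function. The series \<open>y = \<Sum>\<^sub>n t\<^sup>n / n!\<^sup>2\<close> satisfies
  \<open>\<theta>\<^sup>2 y = t y\<close>, and by induction \<open>P\<^sub>d\<^sub>,\<^sub>k y\<^sup>d = d (d - 1) \<dots> (d - k + 1) y\<^sup>d\<^sup>-\<^sup>k (\<theta> y)\<^sup>k\<close>, which is \<open>0\<close> for
  \<open>k = d + 1\<close>. This is a recurrence for the coefficients \<open>b\<^sub>n\<close> of \<open>y\<^sup>d\<close>; multiplied by \<open>(2 n)! / n\<close>
  it becomes the one that \<open>L_A d\<close> expresses for \<open>(2 n)! b\<^sub>n\<close>.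
\<close>

unbundle fps_syntax

section \<open>Places of the projective line\<close>

text \<open>
  A point of the projective line is described by expanding the variable \<open>z\<close> as a Laurent series
  \<open>w\<close> in a local parameter \<open>u\<close>, namely \<open>w = p + u\<close> at a finite point \<open>p\<close> and \<open>w = 1 / u\<close> at
  infinity. The sign \<open>e\<close> is \<open>1\<close> at the finite points and \<open>-1\<close> at infinity. With it both cases can
  be treated at once: the powers \<open>(z - p)\<^sup>s\<close> respectively \<open>z\<^sup>s\<close>, which \<open>D\<close> lowers by one step, are
  \<open>u\<^sup>e\<^sup>s\<close>.
\<close>

definition ev_poly :: "complex fls \<Rightarrow> complex poly \<Rightarrow> complex fls" where
  "ev_poly w p = poly (map_poly fls_const p) w"

lemma ev_poly_pCons [simp]: "ev_poly w (pCons a p) = fls_const a + w * ev_poly w p"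
  by (simp add: ev_poly_def map_poly_pCons)

lemma ev_poly_0 [simp]: "ev_poly w 0 = 0"
  and ev_poly_1 [simp]: "ev_poly w 1 = 1"
  by (simp_all add: ev_poly_def)

lemma ev_poly_add: "ev_poly w (p + q) = ev_poly w p + ev_poly w q"
  by (induction p q rule: poly_induct2) (simp_all add: algebra_simps flip: fls_plus_const)

lemma ev_poly_smult: "ev_poly w (smult c p) = fls_const c * ev_poly w p"
  by (induction p) (simp_all add: algebra_simps flip: fls_const_mult_const)

lemma ev_poly_diff: "ev_poly w (p - q) = ev_poly w p - ev_poly w q"
  using ev_poly_add[of w "p - q" q] by simp

lemma ev_poly_mult: "ev_poly w (p * q) = ev_poly w p * ev_poly w q"
  by (induction p) (simp_all add: ev_poly_add ev_poly_smult algebra_simps)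

lemma ev_poly_power: "ev_poly w (p ^ n) = ev_poly w p ^ n"
  by (induction n) (simp_all add: ev_poly_mult)

definition ev_rf :: "complex fls \<Rightarrow> ratfun \<Rightarrow> complex fls" where
  "ev_rf w x = ev_poly w (fst (quot_of_fract x)) / ev_poly w (snd (quot_of_fract x))"

text \<open>
  This is \<open>d/dz\<close> in terms of the local parameter: \<open>d/du\<close> for \<open>e = 1\<close> and \<open>-u\<^sup>2 d/du\<close> for \<open>e = -1\<close>.
\<close>

definition loc_deriv :: "int \<Rightarrow> complex fls \<Rightarrow> complex fls" where
  "loc_deriv e f = fls_const (of_int e) * fls_X_intpow (1 - e) * fls_deriv f"

lemma loc_deriv_nth: "loc_deriv e f $$ n = of_int (e * (n + e)) * f $$ (n + e)"
  unfolding loc_deriv_def mult.assoc fls_X_intpow_times_conv_shift(1) by simp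

lemma loc_deriv_add: "loc_deriv e (f + g) = loc_deriv e f + loc_deriv e g"
  by (simp add: loc_deriv_def algebra_simps)

lemma loc_deriv_mult: "loc_deriv e (f * g) = f * loc_deriv e g + loc_deriv e f * g"
  by (simp add: loc_deriv_def algebra_simps)

lemma loc_deriv_const [simp]: "loc_deriv e (fls_const c) = 0"
  by (simp add: loc_deriv_def)

lemma loc_deriv_0 [simp]: "loc_deriv e 0 = 0"
  by (simp add: loc_deriv_def)

lemma loc_deriv_sum: "loc_deriv e (sum f A) = (\<Sum>i\<in>A. loc_deriv e (f i))"
  by (induction A rule: infinite_finite_induct) (simp_all add: loc_deriv_add)

lemma loc_deriv_pow_add:
  "(loc_deriv e ^^ i) (f + g) = (loc_deriv e ^^ i) f + (loc_deriv e ^^ i) g"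
  by (induction i) (simp_all add: loc_deriv_add)

definition loc_act :: "complex fls \<Rightarrow> int \<Rightarrow> diffop \<Rightarrow> complex fls \<Rightarrow> complex fls" where
  "loc_act w e P f =
    (\<Sum>i\<le>op_order P. ev_rf w (coeff (op_coeffs P) i) * (loc_deriv e ^^ i) f)"

text \<open>
  The polynomial \<open>s (s - 1) \<dots> (s - i + 1)\<close>, by which \<open>D\<^sup>i\<close> acts on a power with exponent \<open>s\<close>.
\<close>

definition falling :: "nat \<Rightarrow> complex poly" where
  "falling i = (\<Prod>j<i. [:- of_nat j, 1:])"

text \<open>
  Applying \<open>P\<close> to the power \<open>u\<^sup>e\<^sup>s\<close> gives \<open>\<Sum>\<^sub>N indicial w e N P (s) u\<^sup>N\<^sup>+\<^sup>e\<^sup>s\<close>. For the least \<open>N\<close> with a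
  nonzero coefficient this is the indicial polynomial in the usual sense, and its roots are the
  local exponents of \<open>P\<close> (at infinity: their negatives). Keeping all \<open>N\<close> avoids fixing a
  normalisation of \<open>P\<close>.
\<close>

definition indicial :: "complex fls \<Rightarrow> int \<Rightarrow> int \<Rightarrow> diffop \<Rightarrow> complex poly" where
  "indicial w e N P =
    (\<Sum>i\<le>op_order P. smult (ev_rf w (coeff (op_coeffs P) i) $$ (N + e * int i)) (falling i))"

lemma falling_Suc: "falling (Suc i) = falling i * [:- of_nat i, 1:]"
  by (simp add: falling_def mult.commute)

lemma falling_0 [simp]: "falling 0 = 1"
  by (simp add: falling_def)

lemma degree_falling [simp]: "degree (falling i) = i"
  and lead_coeff_falling [simp]: "coeff (falling i) i = 1"
proof -
  have "degree (falling i) = i \<and> lead_coeff (falling i) = 1"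
  proof (induction i)
    case (Suc i)
    then have "falling i \<noteq> 0"
      by auto
    with Suc show ?case
      unfolding falling_Suc lead_coeff_mult by (subst degree_mult_eq) auto
  qed simp
  then show "degree (falling i) = i" "coeff (falling i) i = 1"
    by auto
qed

lemma falling_nonzero [simp]: "falling i \<noteq> 0"
  by (metis coeff_0 lead_coeff_falling zero_neq_one)

text \<open>
  The falling factorials have pairwise different degrees. Hence an indicial polynomial vanishes
  only if each of the Laurent coefficients that enter it does.
\<close>

lemma falling_independent:
  assumes "(\<Sum>i\<le>n. smult (c i) (falling i)) = 0" and "i \<le> n"
  shows "c i = 0"
  using assms
proof (induction n)
  case (Suc n)
  have "coeff (\<Sum>i\<le>n. smult (c i) (falling i)) (Suc n) = 0"
    by (simp add: coeff_sum coeff_eq_0)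
  with arg_cong[OF Suc.prems(1), of "\<lambda>p. coeff p (Suc n)"] have "c (Suc n) = 0"
    by (simp del: sum.cong)
  with Suc show ?case
    by (cases "i = Suc n") auto
qed simp

lemma fls_mult_nth_eq_0:
  fixes f g :: "complex fls"
  assumes "\<And>k. k < m \<Longrightarrow> f $$ k = 0" "\<And>k. k < n \<Longrightarrow> g $$ k = 0" "k < m + n"
  shows "(f * g) $$ k = 0"
proof (cases "f = 0 \<or> g = 0")
  case False
  then have "m \<le> fls_subdegree f" "n \<le> fls_subdegree g"
    using assms by (auto intro: fls_subdegree_geI)
  with \<open>k < m + n\<close> show ?thesis
    by (intro fls_times_nth_eq0) simp
qed auto

lemma poly_eq_if_eq_on_nat:
  fixes p q :: "complex poly"
  assumes "\<And>n. poly p (of_nat n) = poly q (of_nat n)"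
  shows "p = q"
proof -
  have "infinite (range (of_nat :: nat \<Rightarrow> complex))"
    by (rule range_inj_infinite) (rule inj_of_nat)
  moreover have "range (of_nat :: nat \<Rightarrow> complex) \<subseteq> {x. poly (p - q) x = 0}"
    using assms by auto
  ultimately have "p - q = 0"
    by (metis finite_subset poly_roots_finite)
  then show ?thesis by simp
qed

locale place =
  fixes w :: "complex fls" and e :: int
  assumes sign: "e = 1 \<or> e = -1" and loc_deriv_coord: "loc_deriv e w = 1"
begin

lemma loc_deriv_ev_poly: "loc_deriv e (ev_poly w p) = ev_poly w (pderiv p)"
  by (induction p)
    (simp_all add: loc_deriv_add loc_deriv_mult loc_deriv_coord pderiv_pCons ev_poly_add add.commute)

text \<open>
  Since \<open>w\<close> has derivative \<open>1\<close>, it is transcendental over the constants: an algebraic relation for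
  \<open>w\<close> can be differentiated until it becomes a nonzero constant.
\<close>

lemma ev_poly_eq_0_iff [simp]: "ev_poly w p = 0 \<longleftrightarrow> p = 0"
proof
  show "p = 0" if "ev_poly w p = 0"
    using that
  proof (induction "degree p" arbitrary: p)
    case 0
    then obtain a where "p = [:a:]"
      by (metis degree_eq_zeroE)
    with 0 show ?case
      using arg_cong[of "ev_poly w p" 0 "\<lambda>f. f $$ 0"] by simp
  next
    case (Suc n)
    have "pderiv p = 0"
      by (rule Suc.hyps(1)) (use Suc in \<open>simp_all add: degree_pderiv flip: loc_deriv_ev_poly\<close>)
    then have "degree p = 0"
      by (simp add: pderiv_eq_0_iff)
    with Suc show ?case by simp
  qed
qed simp

lemma ev_rf_Fract:
  assumes "b \<noteq> 0"
  shows "ev_rf w (Fract a b) = ev_poly w a / ev_poly w b"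
proof -
  define p q where "p = fst (quot_of_fract (Fract a b))" and "q = snd (quot_of_fract (Fract a b))"
  have q: "q \<noteq> 0"
    by (simp add: q_def)
  have "Fract p q = Fract a b"
    by (simp add: p_def q_def Fract_quot_of_fract)
  then have "p * b = a * q"
    using q assms by (simp add: eq_fract)
  then have "ev_poly w p * ev_poly w b = ev_poly w a * ev_poly w q"
    by (simp flip: ev_poly_mult)
  then show ?thesis
    using q assms by (simp add: ev_rf_def frac_eq_eq flip: p_def q_def)
qed

lemma ev_rf_add: "ev_rf w (x + y) = ev_rf w x + ev_rf w y"
proof -
  obtain a b where x: "x = Fract a b" "b \<noteq> 0" by (cases x)
  obtain c d where y: "y = Fract c d" "d \<noteq> 0" by (cases y)
  show ?thesis
    using x y by (simp add: ev_rf_Fract ev_poly_add ev_poly_mult add_frac_eq)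
qed

lemma ev_rf_mult: "ev_rf w (x * y) = ev_rf w x * ev_rf w y"
proof -
  obtain a b where x: "x = Fract a b" "b \<noteq> 0" by (cases x)
  obtain c d where y: "y = Fract c d" "d \<noteq> 0" by (cases y)
  show ?thesis
    using x y by (simp add: ev_rf_Fract ev_poly_mult)
qed

lemma ev_rf_poly: "ev_rf w (Fract p 1) = ev_poly w p"
  by (simp add: ev_rf_Fract)

lemma ev_rf_0 [simp]: "ev_rf w 0 = 0"
  and ev_rf_1 [simp]: "ev_rf w 1 = 1"
  and ev_rf_const [simp]: "ev_rf w (rf_const c) = fls_const c"
  and ev_rf_var [simp]: "ev_rf w rf_var = w"
  by (simp_all add: Zero_fract_def One_fract_def rf_const_def rf_var_def ev_rf_Fract)

lemma ev_rf_diff: "ev_rf w (x - y) = ev_rf w x - ev_rf w y"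
  using ev_rf_add[of "x - y" y] by simp

lemma ev_rf_sum: "ev_rf w (sum f A) = (\<Sum>i\<in>A. ev_rf w (f i))"
  by (induction A rule: infinite_finite_induct) (simp_all add: ev_rf_add)

lemma ev_rf_eq_0_iff [simp]: "ev_rf w x = 0 \<longleftrightarrow> x = 0"
proof (cases x)
  case (Fract a b)
  then show ?thesis
    by (simp add: ev_rf_Fract Zero_fract_def eq_fract)
qed

lemma ev_rf_deriv: "ev_rf w (rf_deriv x) = loc_deriv e (ev_rf w x)"
proof -
  obtain a b where x: "x = Fract a b" "b \<noteq> 0" by (cases x)
  define f where "f = ev_poly w a / ev_poly w b"
  have a: "ev_poly w a = f * ev_poly w b"
    using x by (simp add: f_def)
  have "loc_deriv e (ev_poly w a) = f * loc_deriv e (ev_poly w b) + loc_deriv e f * ev_poly w b"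
    by (simp add: a loc_deriv_mult)
  then show ?thesis
    using x by (simp add: rf_deriv_Fract ev_rf_Fract ev_poly_diff ev_poly_mult ev_poly_power
        loc_deriv_ev_poly[symmetric] flip: f_def)
      (simp add: a field_simps power2_eq_square)
qed

lemma loc_act_bound:
  assumes "op_order P \<le> n"
  shows "loc_act w e P f = (\<Sum>i\<le>n. ev_rf w (coeff (op_coeffs P) i) * (loc_deriv e ^^ i) f)"
  unfolding loc_act_def using assms
  by (intro sum.mono_neutral_left) (auto simp: coeff_eq_0 op_order_def)

lemma loc_act_add: "loc_act w e (P + Q) f = loc_act w e P f + loc_act w e Q f"
proof -
  define n where "n = max (op_order P) (op_order Q)"
  have "op_order (P + Q) \<le> n" "op_order P \<le> n" "op_order Q \<le> n"
    by (auto simp: n_def op_order_def plus_diffop.rep_eq degree_add_le)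
  then show ?thesis
    by (simp add: loc_act_bound plus_diffop.rep_eq ev_rf_add distrib_right sum.distrib)
qed

lemma loc_act_add_right: "loc_act w e P (f + g) = loc_act w e P f + loc_act w e P g"
  by (simp add: loc_act_def loc_deriv_pow_add distrib_left sum.distrib)

lemma loc_act_0 [simp]: "loc_act w e 0 f = 0"
  by (simp add: loc_act_def zero_diffop.rep_eq)

lemma loc_act_sum: "loc_act w e (sum P A) f = (\<Sum>i\<in>A. loc_act w e (P i) f)"
  by (induction A rule: infinite_finite_induct) (simp_all add: loc_act_add)

lemma loc_act_rf_mult: "loc_act w e (op_of_rf a * P) f = ev_rf w a * loc_act w e P f"
proof -
  have "op_order (op_of_rf a * P) \<le> op_order P"
    by (simp add: op_order_def times_diffop.rep_eq op_coeffs_of_rf ore_mult_const_left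
        degree_smult_le)
  then show ?thesis
    by (subst loc_act_bound, assumption)
      (simp add: times_diffop.rep_eq op_coeffs_of_rf ore_mult_const_left
        ev_rf_mult loc_act_def sum_distrib_left mult.assoc)
qed

lemma loc_act_D_mult: "loc_act w e (op_D * P) f = loc_deriv e (loc_act w e P f)"
proof -
  let ?p = "op_coeffs P" and ?n = "op_order P"
  have c: "op_coeffs (op_D * P) = lmult_D ?p"
    by (simp add: times_diffop.rep_eq op_coeffs_D ore_mult_pCons_left)
  have "op_order (op_D * P) \<le> Suc ?n"
    unfolding op_order_def c lmult_D_def
    by (intro degree_add_le degree_pCons_le le_SucI map_poly_degree_leq)
  then have "loc_act w e (op_D * P) f
      = (\<Sum>i\<le>Suc ?n. ev_rf w (coeff (pCons 0 ?p) i) * (loc_deriv e ^^ i) f)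
        + (\<Sum>i\<le>Suc ?n. ev_rf w (rf_deriv (coeff ?p i)) * (loc_deriv e ^^ i) f)"
    by (simp only: loc_act_bound c lmult_D_def coeff_add ev_rf_add distrib_right sum.distrib
        coeff_map_poly rf_deriv_0)
  also have "(\<Sum>i\<le>Suc ?n. ev_rf w (coeff (pCons 0 ?p) i) * (loc_deriv e ^^ i) f)
      = (\<Sum>i\<le>?n. ev_rf w (coeff ?p i) * (loc_deriv e ^^ Suc i) f)"
    by (subst sum.atMost_Suc_shift) simp
  also have "(\<Sum>i\<le>Suc ?n. ev_rf w (rf_deriv (coeff ?p i)) * (loc_deriv e ^^ i) f)
      = (\<Sum>i\<le>?n. ev_rf w (rf_deriv (coeff ?p i)) * (loc_deriv e ^^ i) f)"
    by (simp add: coeff_eq_0 op_order_def)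
  finally show ?thesis
    by (simp add: loc_act_def loc_deriv_sum loc_deriv_mult ev_rf_deriv sum.distrib)
qed

lemma loc_act_mult: "loc_act w e (P * Q) f = loc_act w e P (loc_act w e Q f)"
proof -
  have D: "loc_act w e (op_D ^ i * Q) f = (loc_deriv e ^^ i) (loc_act w e Q f)" for i
    by (induction i) (simp_all add: loc_act_D_mult mult.assoc)
  have "loc_act w e (P * Q) f
      = loc_act w e ((\<Sum>i\<le>op_order P. op_of_rf (coeff (op_coeffs P) i) * op_D ^ i) * Q) f"
    by (subst (1) diffop_eq_sum) (rule refl)
  also have "\<dots> = loc_act w e P (loc_act w e Q f)"
    by (simp add: sum_distrib_right mult.assoc loc_act_sum loc_act_rf_mult D)
      (simp add: loc_act_def)
  finally show ?thesis .
qed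

section \<open>Indicial polynomials of products\<close>

lemma loc_deriv_monomial:
  "loc_deriv e (fls_const c * fls_X_intpow (e * s))
    = fls_const (c * of_int s) * fls_X_intpow (e * (s - 1))"
  by (rule fls_eqI) (use sign in \<open>auto simp: loc_deriv_nth\<close>)

lemma loc_deriv_pow_monomial:
  "(loc_deriv e ^^ i) (fls_const c * fls_X_intpow (e * s))
    = fls_const (c * poly (falling i) (of_int s)) * fls_X_intpow (e * (s - int i))"
proof (induction i)
  case (Suc i)
  then have "(loc_deriv e ^^ Suc i) (fls_const c * fls_X_intpow (e * s))
      = loc_deriv e (fls_const (c * poly (falling i) (of_int s)) * fls_X_intpow (e * (s - int i)))"
    by simp
  also have "\<dots> = fls_const (c * poly (falling (Suc i)) (of_int s)) * fls_X_intpow (e * (s - int (Suc i)))"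
    by (simp only: loc_deriv_monomial) (simp add: falling_Suc algebra_simps)
  finally show ?case .
qed simp

lemma loc_act_monomial_nth:
  "loc_act w e P (fls_const c * fls_X_intpow (e * s)) $$ (N + e * s)
    = c * poly (indicial w e N P) (of_int s)"
proof -
  have "(ev_rf w (coeff (op_coeffs P) i) * (loc_deriv e ^^ i) (fls_const c * fls_X_intpow (e * s)))
      $$ (N + e * s)
      = c * poly (smult (ev_rf w (coeff (op_coeffs P) i) $$ (N + e * int i)) (falling i)) (of_int s)"
    for i
  proof -
    define a where "a = ev_rf w (coeff (op_coeffs P) i)"
    have "a * (loc_deriv e ^^ i) (fls_const c * fls_X_intpow (e * s))
        = fls_const (c * poly (falling i) (of_int s)) * (fls_X_intpow (e * (s - int i)) * a)"
      by (simp only: loc_deriv_pow_monomial mult_ac)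
    also have "\<dots> = fls_const (c * poly (falling i) (of_int s)) * fls_shift (- (e * (s - int i))) a"
      by (simp only: fls_X_intpow_times_conv_shift)
    finally show ?thesis
      by (simp add: algebra_simps flip: a_def)
  qed
  then show ?thesis
    unfolding loc_act_def indicial_def
    by (simp add: fls_nth_sum poly_sum sum_distrib_left)
qed

lemma coeff_nth_if_indicial_eq_0:
  assumes "indicial w e N P = 0"
  shows "ev_rf w (coeff (op_coeffs P) i) $$ (N + e * int i) = 0"
proof (cases "i \<le> op_order P")
  case True
  show ?thesis
    using falling_independent[OF assms[unfolded indicial_def] True] .
qed (simp add: op_order_def coeff_eq_0)

lemma loc_deriv_pow_below:
  assumes "\<And>k. k < n \<Longrightarrow> g $$ k = 0" and "k < n - e * int i"
  shows "(loc_deriv e ^^ i) g $$ k = 0"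
  using assms(2)
proof (induction i arbitrary: k)
  case (Suc i)
  then show ?case
    by (simp add: loc_deriv_nth algebra_simps)
qed (use assms(1) in simp)

text \<open>
  An operator without indicial polynomials below \<open>N\<close> raises the order of vanishing by at least
  \<open>N\<close>. This is what makes only the lowest term of \<open>B u\<^sup>e\<^sup>s\<close> matter in \<open>indicial_mult\<close>.
\<close>

lemma loc_act_below:
  assumes P: "\<And>k. k < N \<Longrightarrow> indicial w e k P = 0" and g: "\<And>k. k < n \<Longrightarrow> g $$ k = 0"
    and "k < N + n"
  shows "loc_act w e P g $$ k = 0"
proof -
  have "(ev_rf w (coeff (op_coeffs P) i) * (loc_deriv e ^^ i) g) $$ k = 0" for i
  proof (rule fls_mult_nth_eq_0)
    show "ev_rf w (coeff (op_coeffs P) i) $$ l = 0" if "l < N + e * int i" for l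
      using coeff_nth_if_indicial_eq_0[OF P, of "l - e * int i" i] that by simp
    show "(loc_deriv e ^^ i) g $$ l = 0" if "l < n - e * int i" for l
      using loc_deriv_pow_below g that by blast
  qed (use \<open>k < N + n\<close> in simp)
  then show ?thesis
    by (simp add: loc_act_def fls_nth_sum)
qed

lemma least_indicial:
  assumes "P \<noteq> 0"
  obtains N where "indicial w e N P \<noteq> 0" "\<And>k. k < N \<Longrightarrow> indicial w e k P = 0"
proof -
  let ?c = "\<lambda>i. ev_rf w (coeff (op_coeffs P) i)"
  define I where "I = {i. i \<le> op_order P \<and> coeff (op_coeffs P) i \<noteq> 0}"
  define v where "v i = fls_subdegree (?c i) - e * int i" for i
  have "op_coeffs P \<noteq> 0"
    using assms by (metis op_coeffs_inject zero_diffop.rep_eq)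
  then have "op_order P \<in> I"
    by (simp add: I_def op_order_def)
  then have I: "finite I" "I \<noteq> {}"
    by (auto simp: I_def)
  have "indicial w e k P = 0" if "k < Min (v ` I)" for k
  proof -
    have "?c i $$ (k + e * int i) = 0" for i
    proof (cases "i \<in> I")
      case True
      then have "k < v i"
        using that I by simp
      then show ?thesis
        by (simp add: v_def)
    qed (auto simp: I_def op_order_def coeff_eq_0 not_le)
    then show ?thesis
      by (simp add: indicial_def)
  qed
  moreover have "indicial w e (Min (v ` I)) P \<noteq> 0"
  proof
    assume ind: "indicial w e (Min (v ` I)) P = 0"
    have "Min (v ` I) \<in> v ` I"
      using I by (intro Min_in) auto
    then obtain i where i: "i \<in> I" "Min (v ` I) = v i"
      by auto
    then have "?c i $$ fls_subdegree (?c i) = 0"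
      using coeff_nth_if_indicial_eq_0[OF ind, of i] by (simp add: v_def)
    moreover have "?c i \<noteq> 0"
      using i by (simp add: I_def)
    ultimately show False
      by (simp add: nth_fls_subdegree_zero_iff)
  qed
  ultimately show thesis
    using that by blast
qed

text \<open>
  The lowest term of \<open>B u\<^sup>e\<^sup>s\<close> is a multiple of \<open>u\<^sup>N\<^sup>B\<^sup>+\<^sup>e\<^sup>s\<close>, again a power of the same kind with
  exponent \<open>s + e NB\<close> because \<open>e\<^sup>2 = 1\<close>. So the indicial polynomial of a left factor enters with
  its argument shifted, while that of the right factor divides the indicial polynomial of the
  product.
\<close>

lemma indicial_mult:
  assumes A: "\<And>k. k < NA \<Longrightarrow> indicial w e k A = 0" and B: "\<And>k. k < NB \<Longrightarrow> indicial w e k B = 0"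
  shows "indicial w e (NA + NB) (A * B)
      = pcompose (indicial w e NA A) [:of_int (e * NB), 1:] * indicial w e NB B" (is "?l = ?r")
    and "k < NA + NB \<Longrightarrow> indicial w e k (A * B) = 0"
proof -
  have ee: "e * (e * x) = x" for x
    using sign by auto
  have mon: "loc_act w e P (fls_X_intpow (e * s)) $$ (N + e * s) = poly (indicial w e N P) (of_int s)"
    for P s N using loc_act_monomial_nth[of P 1] by simp
  have B0: "loc_act w e B (fls_X_intpow (e * s)) $$ k = 0" if "k < NB + e * s" for s k
    using mon[of B s "k - e * s"] B[of "k - e * s"] that by simp
  show "?l = ?r"
  proof (rule poly_eq_if_eq_on_nat)
    fix n
    define s where "s = int n"
    define c where "c = poly (indicial w e NB B) (of_int s)"
    define m where "m = fls_const c * fls_X_intpow (e * (s + e * NB))"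
    define g where "g = loc_act w e B (fls_X_intpow (e * s)) - m"
    have exp: "e * (s + e * NB) = NB + e * s"
      by (simp add: distrib_left ee)
    have g0: "g $$ k = 0" if "k < NB + e * s + 1" for k
      using that B0[of k s] mon[of B s NB]
      by (cases "k = NB + e * s") (auto simp: g_def m_def exp c_def fls_X_intpow_times_conv_shift)
    have "loc_act w e (A * B) (fls_X_intpow (e * s)) = loc_act w e A (m + g)"
      by (simp add: loc_act_mult g_def)
    then have "loc_act w e (A * B) (fls_X_intpow (e * s)) $$ (NA + NB + e * s)
        = loc_act w e A m $$ (NA + e * (s + e * NB)) + loc_act w e A g $$ (NA + NB + e * s)"
      by (simp only: loc_act_add_right fls_plus_nth exp add.assoc)
    also have "loc_act w e A g $$ (NA + NB + e * s) = 0"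
      by (rule loc_act_below[where n = "NB + e * s + 1", OF A g0]) auto
    finally have "poly ?l (of_int s) = c * poly (indicial w e NA A) (of_int (s + e * NB))"
      by (simp add: mon[of "A * B" s "NA + NB"] m_def loc_act_monomial_nth)
    then show "poly ?l (of_nat n) = poly ?r (of_nat n)"
      by (simp add: poly_pcompose c_def s_def algebra_simps)
  qed
  show "indicial w e k (A * B) = 0" if "k < NA + NB" for k
  proof (rule poly_eq_if_eq_on_nat)
    fix n
    have "loc_act w e A (loc_act w e B (fls_X_intpow (e * int n))) $$ (k + e * int n) = 0"
      by (rule loc_act_below[OF A B0]) (use that in auto)
    with mon[of "A * B" "int n" k] show "poly (indicial w e k (A * B)) (of_nat n) = poly 0 (of_nat n)"
      by (simp add: loc_act_mult)
  qed
qed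

lemma degree_indicial_le: "degree (indicial w e N P) \<le> op_order P"
  unfolding indicial_def by (rule degree_sum_le) (auto intro: order.trans[OF degree_smult_le])

end

section \<open>Monic polynomials and the sums of their roots\<close>

text \<open>
  By Vieta this is the sum of the roots of a monic polynomial, counted with multiplicities. In the
  reversed polynomial the coefficient after the leading one has index \<open>1\<close> in every degree,
  constants included, and reversal is multiplicative.
\<close>

definition root_sum :: "complex poly \<Rightarrow> complex" where
  "root_sum q = - coeff (reflect_poly q) 1"

lemma root_sum_eq: "degree q = Suc n \<Longrightarrow> root_sum q = - coeff q n"
  by (simp add: root_sum_def coeff_reflect_poly)

lemma root_sum_mult:
  assumes "lead_coeff p = 1" "lead_coeff q = 1"
  shows "root_sum (p * q) = root_sum p + root_sum q"
  using assms by (simp add: root_sum_def reflect_poly_mult coeff_mult)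

lemma root_sum_1 [simp]: "root_sum 1 = 0"
  by (simp add: root_sum_def)

lemma root_sum_linear [simp]: "root_sum [:- a, 1:] = a"
  by (simp add: root_sum_eq)

lemma lead_coeff_prod_linear [simp]: "lead_coeff (\<Prod>j\<in>J. [:- c j, 1:]) = (1 :: complex)"
  by (simp add: lead_coeff_prod)

lemma root_sum_prod_linear: "root_sum (\<Prod>j\<in>J. [:- c j, 1:]) = (\<Sum>j\<in>J. c j)"
proof (induction J rule: infinite_finite_induct)
  case (insert j J)
  then show ?case
    by (simp del: mult_pCons_left add: root_sum_mult)
qed simp_all

lemma degree_prod_linear [simp]: "degree (\<Prod>j\<in>J. [:- c j, 1:] :: complex poly) = card J"
  by (subst degree_prod_eq_sum_degree) auto

lemma dvd_linear_mult_cases: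
  assumes "q dvd [:- a, 1:] * p"
  obtains "q dvd p" | q' where "q = [:- a, 1 :: complex:] * q'" "q' dvd p"
proof (cases "poly q a = 0")
  case True
  then obtain q' where q: "q = [:- a, 1:] * q'"
    by (auto simp: poly_eq_0_iff_dvd)
  then have "q' dvd p"
    using assms by (simp del: mult_pCons_left)
  with q show thesis
    using that by blast
next
  case False
  obtain s where s: "[:- a, 1:] * p = q * s"
    using assms by blast
  then have "poly q a * poly s a = 0"
    by (metis poly_mult mult_eq_0_iff poly_eq_0_iff_dvd dvd_triv_left)
  then obtain s' where "s = [:- a, 1:] * s'"
    using False by (auto simp: poly_eq_0_iff_dvd)
  then have "[:- a, 1:] * p = [:- a, 1:] * (q * s')"
    using s by (simp del: mult_pCons_left add: mult.left_commute)
  then have "p = q * s'"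
    by (simp del: mult_pCons_left)
  then show thesis
    using that by simp
qed

text \<open>
  For distinct \<open>c j\<close> this says that the roots of a divisor form a subset. The index set keeps
  track of the choice also when some of the \<open>c j\<close> coincide.
\<close>

lemma monic_dvd_prod_linear:
  assumes "finite J" "lead_coeff q = 1" "q dvd (\<Prod>j\<in>J. [:- c j, 1 :: complex:])"
  obtains J' where "J' \<subseteq> J" "q = (\<Prod>j\<in>J'. [:- c j, 1:])"
proof -
  have "\<exists>J'\<subseteq>J. q = (\<Prod>j\<in>J'. [:- c j, 1:])"
    using assms
  proof (induction J arbitrary: q rule: finite_induct)
    case empty
    then have "q dvd 1" "q \<noteq> 0"
      by auto
    then have "degree q = 0"
      by (simp add: is_unit_iff_degree)
    then have "q = [:lead_coeff q:]"
      by (metis degree_eq_zeroE lead_coeff_pCons(2) coeff_pCons_0 degree_pCons_0)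
    with empty show ?case
      by (simp add: one_pCons)
  next
    case (insert j J)
    then have "q dvd [:- c j, 1:] * (\<Prod>j\<in>J. [:- c j, 1:])"
      by (simp del: mult_pCons_left)
    then show ?case
    proof (cases rule: dvd_linear_mult_cases)
      case 1
      with insert show ?thesis by blast
    next
      case (2 q')
      have "lead_coeff q' = 1"
        using insert.prems(1) unfolding 2(1) lead_coeff_mult by simp
      then obtain J' where "J' \<subseteq> J" "q' = (\<Prod>j\<in>J'. [:- c j, 1:])"
        using insert.IH 2(2) by blast
      moreover from this have "j \<notin> J'" "finite J'"
        using insert.hyps by (auto intro: finite_subset)
      ultimately show ?thesis
        using 2(1) by (intro exI[of _ "insert j J'"]) (auto simp del: mult_pCons_left)
    qed
  qed
  then show thesis
    using that by blast
qed

text \<open>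
  Distinct exponents in the natural numbers sum to at least \<open>0 + 1 + \<dots> + (b - 1)\<close>; this is why
  ordinary and apparent singular points contribute residues \<open>\<le> 0\<close>.
\<close>

lemma sum_distinct_nat_ge:
  assumes "finite J"
  shows "of_nat (card J) * (of_nat (card J) - 1) / 2 \<le> (\<Sum>j\<in>J. real j)"
  using assms
proof (induction J rule: finite_linorder_max_induct)
  case (insert b J)
  then have "card J \<le> card {..<b}"
    by (intro card_mono) auto
  then have "real (card J) \<le> real b"
    by simp
  moreover have "b \<notin> J"
    using insert.hyps by auto
  ultimately show ?case
    using insert by (simp add: field_simps)
qed simp

lemma root_sum_falling: "root_sum (falling n) = of_nat n * (of_nat n - 1) / 2"
proof -
  have "(\<Sum>j<n. of_nat j) = (of_nat n * (of_nat n - 1) / 2 :: complex)"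
    by (induction n) (simp_all add: field_simps)
  then show ?thesis
    by (simp add: falling_def root_sum_prod_linear)
qed

lemma root_sum_bounds:
  assumes "lead_coeff q = 1" "degree q > 0" "\<And>z. poly q z = 0 \<Longrightarrow> l < Re z \<and> Re z < u"
  shows "real (degree q) * l < Re (root_sum q)" "Re (root_sum q) < real (degree q) * u"
proof -
  have "real (degree q) * l < Re (root_sum q) \<and> Re (root_sum q) < real (degree q) * u"
    using assms
  proof (induction "degree q" arbitrary: q)
    case (Suc n)
    have "\<not> constant (poly q)"
      using Suc.prems by (simp add: constant_degree)
    then obtain a where a: "poly q a = 0"
      using fundamental_theorem_of_algebra by blast
    then obtain q' where q: "q = [:- a, 1:] * q'"
      by (auto simp: poly_eq_0_iff_dvd)
    have lc: "lead_coeff q' = 1"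
      using Suc.prems(1) unfolding q lead_coeff_mult by simp
    then have "q' \<noteq> 0"
      by auto
    then have deg: "degree q = Suc (degree q')"
      unfolding q by (subst degree_mult_eq) auto
    have rs: "root_sum q = a + root_sum q'"
      unfolding q using lc by (subst root_sum_mult) auto
    have ab: "l < Re a" "Re a < u"
      using Suc.prems(3)[OF a] by auto
    show ?case
    proof (cases "degree q' = 0")
      case True
      then have "root_sum q' = 0"
        by (simp add: root_sum_def coeff_reflect_poly)
      with True ab deg rs show ?thesis
        by simp
    next
      case False
      have "real (degree q') * l < Re (root_sum q') \<and> Re (root_sum q') < real (degree q') * u"
        by (rule Suc.hyps(1)) (use Suc deg lc False q in auto)
      with ab deg rs show ?thesis
        by (simp add: algebra_simps)
    qed
  qed simp
  then show "real (degree q) * l < Re (root_sum q)" "Re (root_sum q) < real (degree q) * u"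
    by auto
qed

section \<open>Local exponents of a right factor\<close>

context place
begin

text \<open>
  If the indicial polynomial of \<open>M\<close> has full degree (a regular singularity), then so do those of
  both factors, because degrees add up and none can exceed the order. For a monic \<open>B\<close> of order \<open>b\<close>
  full degree fixes the index of the lowest indicial polynomial as \<open>-e b\<close>, and the sum of its
  roots then determines one coefficient in the expansion of the coefficient of \<open>D\<^sup>b\<^sup>-\<^sup>1\<close> in \<open>B\<close>: the
  residue at a finite point, and the coefficient of \<open>1/z\<close> at infinity.
\<close>

lemma monic_right_factor:
  fixes A B M :: diffop and b :: nat
  assumes M: "M = A * B" and order: "op_order A + b = op_order M" "op_order B = b"
    and monic: "coeff (op_coeffs B) b = 1"
    and below: "\<forall>k<N. indicial w e k M = 0" and nonzero: "indicial w e N M \<noteq> 0"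
    and regular: "degree (indicial w e N M) = op_order M"
  defines "q \<equiv> indicial w e (- (e * int b)) B"
  shows "q dvd indicial w e N M" "degree q = b" "lead_coeff q = 1"
    and "b = Suc b' \<Longrightarrow> ev_rf w (coeff (op_coeffs B) b') $$ (- e) = of_nat b * (of_nat b - 1) / 2 - root_sum q"
    and "b = Suc b' \<Longrightarrow> k < - e \<Longrightarrow> ev_rf w (coeff (op_coeffs B) b') $$ k = 0"
proof -
  have "B \<noteq> 0"
    using monic by (auto simp: zero_diffop.rep_eq)
  then obtain NB where NB: "indicial w e NB B \<noteq> 0" "\<And>k. k < NB \<Longrightarrow> indicial w e k B = 0"
    using least_indicial by blast
  have "A \<noteq> 0"
    using nonzero by (auto simp: M indicial_def zero_diffop.rep_eq)
  then obtain NA where NA: "indicial w e NA A \<noteq> 0" "\<And>k. k < NA \<Longrightarrow> indicial w e k A = 0"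
    using least_indicial by blast
  define p where "p = pcompose (indicial w e NA A) [:of_int (e * NB), 1:]"
  have "p \<noteq> 0"
    using NA(1) by (simp add: p_def pcompose_eq_0_iff)
  have prod: "indicial w e (NA + NB) M = p * indicial w e NB B"
    using indicial_mult(1)[OF NA(2) NB(2)] by (simp add: M p_def)
  have N: "NA + NB = N"
  proof (rule linorder_cases)
    assume "NA + NB < N"
    then show ?thesis
      using below prod \<open>p \<noteq> 0\<close> NB(1) by simp
  next
    assume "N < NA + NB"
    then show ?thesis
      using indicial_mult(2)[of NA A NB B N] NA(2) NB(2) nonzero M by simp
  qed
  \<comment> \<open>Neither degree can exceed the order of its factor, so both are equal to it.\<close>
  have "degree p + degree (indicial w e NB B) = op_order M"
    using prod N regular \<open>p \<noteq> 0\<close> NB(1) by (simp add: degree_mult_eq)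
  moreover have "degree p \<le> op_order A"
    by (simp add: p_def degree_pcompose degree_indicial_le)
  moreover have "degree (indicial w e NB B) \<le> b"
    using degree_indicial_le[of NB B] order(2) by simp
  ultimately have deg: "degree (indicial w e NB B) = b"
    using order(1) by simp
  have ind: "indicial w e K B = smult (1 $$ (K + e * int b)) (falling b)
      + (\<Sum>i<b. smult (ev_rf w (coeff (op_coeffs B) i) $$ (K + e * int i)) (falling i))" for K
    by (simp add: indicial_def order(2) monic flip: lessThan_Suc_atMost)
  have low: "coeff (\<Sum>i<n. smult (c i) (falling i)) m = 0" if "n \<le> m" for c n m
    using that by (simp add: coeff_sum coeff_eq_0)
  have "coeff (indicial w e NB B) b \<noteq> 0"
    using deg NB(1) by auto
  then have "NB + e * int b = 0"
    by (simp add: ind low split: if_splits)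
  then have "NB = - (e * int b)"
    by simp
  then have q: "indicial w e NB B = q"
    by (simp add: q_def)
  show "q dvd indicial w e N M"
    using prod N q by simp
  show degq: "degree q = b"
    using deg q by simp
  then show "lead_coeff q = 1"
    by (simp add: q_def ind low)
  show "ev_rf w (coeff (op_coeffs B) b') $$ (- e) = of_nat b * (of_nat b - 1) / 2 - root_sum q"
    if "b = Suc b'"
  proof -
    have "coeff (falling b) b' = - (of_nat b * (of_nat b - 1) / 2)"
      using root_sum_falling[of b] root_sum_eq[of "falling b" b'] that
      by (metis add.inverse_inverse degree_falling)
    moreover have "coeff q b' = coeff (falling b) b' + ev_rf w (coeff (op_coeffs B) b') $$ (- e)"
      using low[of b' b'] by (simp add: q_def ind that algebra_simps)
    ultimately show ?thesis
      using root_sum_eq[of q b'] degq that by (simp add: algebra_simps)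
  qed
  show "ev_rf w (coeff (op_coeffs B) b') $$ k = 0" if "b = Suc b'" "k < - e"
  proof -
    have "k - e * int b' < NB"
      using that \<open>NB = - (e * int b)\<close> by (simp add: algebra_simps)
    from coeff_nth_if_indicial_eq_0[OF NB(2)[OF this], of b'] show ?thesis
      by simp
  qed
qed

end

section \<open>Residues of rational functions\<close>

abbreviation coord :: "complex \<Rightarrow> complex fls" where
  "coord p \<equiv> fls_const p + fls_X"

interpretation fin: place "coord p" 1 for p
  by standard (auto intro!: fls_eqI simp: loc_deriv_nth simp del: of_int_add)

interpretation inf: place fls_X_inv "- 1"
  by standard (auto intro!: fls_eqI simp: loc_deriv_nth)

lemma ev_poly_finite_below: "k < 0 \<Longrightarrow> ev_poly (coord p) a $$ k = 0"
  by (induction a arbitrary: k) (simp_all add: distrib_right fls_X_times_conv_shift)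

lemma ev_poly_finite_0: "ev_poly (coord p) a $$ 0 = poly a p"
  by (induction a) (simp_all add: distrib_right fls_X_times_conv_shift ev_poly_finite_below)

lemma ev_poly_finite_1: "ev_poly (coord p) a $$ 1 = poly (pderiv a) p"
  using fin.loc_deriv_ev_poly[of p a] ev_poly_finite_0[of p "pderiv a"] loc_deriv_nth[of 1 "ev_poly (coord p) a" 0]
  by simp

lemma ev_poly_infinity: "ev_poly fls_X_inv a $$ k = (if k \<le> 0 then coeff a (nat (- k)) else 0)"
proof (induction a arbitrary: k)
  case (pCons c a)
  have "nat (- k) = Suc (nat (- 1 - k))" if "k < 0"
    using that by simp
  then show ?case
    by (auto simp: fls_X_inv_times_conv_shift pCons algebra_simps)
qed simp

lemma regular_outside_denominator:
  assumes "poly m p \<noteq> 0" "k < 0"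
  shows "ev_rf (coord p) (Fract n m) $$ k = 0"
proof -
  have m: "m \<noteq> 0"
    using assms by auto
  have "fls_subdegree (ev_poly (coord p) m) = 0"
    by (rule fls_subdegree_eqI) (use assms in \<open>simp_all add: ev_poly_finite_0 ev_poly_finite_below\<close>)
  then have "fls_subdegree (inverse (ev_poly (coord p) m)) = 0"
    by simp
  then have "(ev_poly (coord p) n * inverse (ev_poly (coord p) m)) $$ k = 0"
    by (intro fls_mult_nth_eq_0[where m = 0 and n = 0]) (use assms(2) in \<open>auto simp: ev_poly_finite_below\<close>)
  then show ?thesis
    using m by (simp add: fin.ev_rf_Fract divide_inverse)
qed

text \<open>
  A denominator in lowest terms without roots is constant, and a polynomial that vanishes at
  infinity is \<open>0\<close>.
\<close>

lemma rational_function_without_poles_eq_0: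
  assumes fin: "\<And>p k. k < 0 \<Longrightarrow> ev_rf (coord p) g $$ k = 0"
    and inf: "\<And>k. k < 1 \<Longrightarrow> ev_rf fls_X_inv g $$ k = 0"
  shows "g = 0"
proof -
  define n m where "n = fst (quot_of_fract g)" and "m = snd (quot_of_fract g)"
  have g: "g = Fract n m" and m: "m \<noteq> 0" and co: "coprime n m"
    by (simp_all add: n_def m_def Fract_quot_of_fract coprime_quot_of_fract)
  have "poly m p \<noteq> 0" for p
  proof
    assume p: "poly m p = 0"
    have "(ev_poly (coord p) m * ev_rf (coord p) g) $$ 0 = 0"
    proof (rule fls_mult_nth_eq_0[where m = 1 and n = 0])
      show "ev_poly (coord p) m $$ k = 0" if "k < 1" for k
        using that p by (cases "k = 0") (auto simp: ev_poly_finite_0 ev_poly_finite_below)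
    qed (use fin in auto)
    then have "poly n p = 0"
      using m by (simp add: g fin.ev_rf_Fract ev_poly_finite_0)
    with p have "[:- p, 1:] dvd n" "[:- p, 1:] dvd m"
      by (auto simp: poly_eq_0_iff_dvd)
    then have "is_unit [:- p, 1:]"
      using co by (meson coprime_common_divisor)
    then show False
      by (simp add: is_unit_iff_degree)
  qed
  then have "constant (poly m)"
    using fundamental_theorem_of_algebra by blast
  then obtain c where c: "m = [:c:]"
    using constant_degree degree_eq_zeroE by metis
  have "n = 0"
  proof (rule poly_eqI)
    fix i
    have "ev_poly fls_X_inv n = fls_const c * ev_rf fls_X_inv g"
      using m by (simp add: g inf.ev_rf_Fract c)
    then have "ev_poly fls_X_inv n $$ (- int i) = 0"
      using inf[of "- int i"] by simp
    then show "coeff n i = coeff 0 i"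
      by (simp add: ev_poly_infinity)
  qed
  then show ?thesis
    using m by (simp add: g Zero_fract_def eq_fract)
qed

text \<open>
  Subtracting the principal parts \<open>\<rho> c / (z - c)\<close> leaves a function without poles that vanishes at
  infinity. So \<open>f\<close> is the sum of its principal parts, each of which has the expansion
  \<open>\<rho> c / z + \<dots>\<close> at infinity.
\<close>

lemma sum_of_residues:
  assumes fin: "\<And>p k. k < - 1 \<Longrightarrow> ev_rf (coord p) f $$ k = 0"
    and inf: "\<And>k. k < 1 \<Longrightarrow> ev_rf fls_X_inv f $$ k = 0"
    and F: "finite F" "\<And>p. p \<notin> F \<Longrightarrow> ev_rf (coord p) f $$ (- 1) = 0"
  shows "(\<Sum>p\<in>F. ev_rf (coord p) f $$ (- 1)) = ev_rf fls_X_inv f $$ 1"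
proof -
  define h where "h c = Fract 1 [:- c, 1:]" for c :: complex
  define \<rho> where "\<rho> p = ev_rf (coord p) f $$ (- 1)" for p
  define g where "g = f - (\<Sum>c\<in>F. rf_const (\<rho> c) * h c)"
  have h_fin: "ev_rf (coord p) (h c) $$ k = (if p = c \<and> k = - 1 then 1 else 0)" if "k < 0" for p c k
  proof (cases "p = c")
    case True
    have "ev_rf (coord c) (h c) = 1 / fls_X"
      by (simp add: h_def fin.ev_rf_Fract)
    also have "\<dots> = fls_X_inv"
      by (simp add: divide_inverse fls_inverse_X)
    finally show ?thesis
      using True by simp
  next
    case False
    then show ?thesis
      using regular_outside_denominator[of "[:- c, 1:]" p k 1] that by (simp add: h_def)
  qed
  have h_inf: "ev_rf fls_X_inv (h c) $$ k = (if k = 1 then 1 else 0)" if "k \<le> 1" for c k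
  proof -
    define z where "z = ev_rf fls_X_inv (h c)"
    define y where "y = fls_X_inv - fls_const c"
    have sub: "fls_subdegree y = - 1"
      by (rule fls_subdegree_eqI) (auto simp: y_def)
    then have "y \<noteq> 0"
      by auto
    have z: "z = inverse y"
      by (simp add: z_def h_def inf.ev_rf_Fract y_def divide_inverse)
    have "fls_subdegree z = 1"
      using sub by (simp add: z)
    then have z0: "z $$ k = 0" if "k < 1" for k
      using that by simp
    have "fls_X_inv * z - fls_const c * z = 1"
      using \<open>y \<noteq> 0\<close> z by (simp add: y_def flip: left_diff_distrib)
    from arg_cong[OF this, of "\<lambda>f. f $$ 0"] have "z $$ 1 = 1"
      by (simp add: fls_X_inv_times_conv_shift z0)
    with z0 that show ?thesis
      by (cases "k = 1") (auto simp: z_def)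
  qed
  have "g = 0"
  proof (rule rational_function_without_poles_eq_0)
    fix p :: complex and k :: int assume k: "k < 0"
    have "ev_rf (coord p) g $$ k
        = ev_rf (coord p) f $$ k - (\<Sum>c\<in>F. if p = c \<and> k = - 1 then \<rho> c else 0)"
      by (simp add: g_def fin.ev_rf_diff fin.ev_rf_sum fin.ev_rf_mult fls_nth_sum h_fin[OF k]
          if_distrib cong: if_cong)
    also have "\<dots> = 0"
    proof (cases "k = - 1")
      case True
      then show ?thesis
        using F by (auto simp: \<rho>_def)
    next
      case False
      then have "k < - 1"
        using k by simp
      with False show ?thesis
        using fin by simp
    qed
    finally show "ev_rf (coord p) g $$ k = 0" .
  next
    fix k :: int assume k: "k < 1"
    then show "ev_rf fls_X_inv g $$ k = 0"
      by (simp add: g_def inf.ev_rf_diff inf.ev_rf_sum inf.ev_rf_mult fls_nth_sum h_inf inf)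
  qed
  then have "f = (\<Sum>c\<in>F. rf_const (\<rho> c) * h c)"
    by (simp add: g_def)
  then have "ev_rf fls_X_inv f $$ 1 = (\<Sum>c\<in>F. \<rho> c)"
    by (simp add: inf.ev_rf_sum inf.ev_rf_mult fls_nth_sum h_inf)
  then show ?thesis
    by (simp add: \<rho>_def)
qed

section \<open>Normal form of the symmetric power recursion\<close>

text \<open>
  The coefficients in \<open>P_op d n = \<Sum>\<^sub>m z\<^sup>m theta_coeff d n m (\<theta>)\<close>: moving \<open>\<theta>\<close> past \<open>z\<^sup>m\<close> turns it into
  \<open>\<theta> + m\<close>, and the recursion of \<^const>\<open>P_op\<close> becomes the one below.
\<close>

fun theta_coeff :: "nat \<Rightarrow> nat \<Rightarrow> nat \<Rightarrow> complex poly" where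
  "theta_coeff d 0 m = (if m = 0 then 1 else 0)"
| "theta_coeff d (Suc 0) m = (if m = 0 then [:0, 1:] else 0)"
| "theta_coeff d (Suc (Suc n)) m = [:of_nat m, 1:] * theta_coeff d (Suc n) m
     - (case m of 0 \<Rightarrow> 0 | Suc k \<Rightarrow> smult (of_nat (Suc n) * (of_nat d - of_nat n)) (theta_coeff d n k))"

text \<open>
  The top coefficients \<open>\<alpha>\<^sub>n\<^sub>,\<^sub>m\<close> of \<open>theta_coeff d n m\<close>, which belongs to \<open>\<theta>\<^sup>n\<^sup>-\<^sup>2\<^sup>m\<close>, collected in the
  generating polynomial \<open>\<Sum>\<^sub>m \<alpha>\<^sub>n\<^sub>,\<^sub>m y\<^sup>m\<close>. It is obtained from \<^const>\<open>P_op\<close> by letting all variables commute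
  and putting \<open>\<theta> = 1\<close>, \<open>t = y\<close>.
\<close>

fun symbol :: "nat \<Rightarrow> nat \<Rightarrow> complex poly" where
  "symbol d 0 = 1"
| "symbol d (Suc 0) = 1"
| "symbol d (Suc (Suc n)) =
     symbol d (Suc n) - smult (of_nat (Suc n) * (of_nat d - of_nat n)) (pCons 0 (symbol d n))"

lemma P_op_theta_coeff:
  "n div 2 \<le> K \<Longrightarrow> P_op d n = (\<Sum>m\<le>K. op_z ^ m * op_poly (theta_coeff d n m) op_theta)"
proof (induction n arbitrary: K rule: induct_nat_012)
  case 0
  have "(\<Sum>m\<le>K. op_z ^ m * op_poly (theta_coeff d 0 m) op_theta) = (\<Sum>m\<le>K. if m = 0 then 1 else 0)"
    by (rule sum.cong) (auto simp: op_poly_def)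
  then show ?case by simp
next
  case 1
  have "(\<Sum>m\<le>K. op_z ^ m * op_poly (theta_coeff d (Suc 0) m) op_theta)
      = (\<Sum>m\<le>K. if m = 0 then op_theta else 0)"
    by (rule sum.cong) (auto simp: op_poly_def)
  then show ?case by simp
next
  case (ge2 n)
  define c :: complex where "c = of_nat (Suc n) * (of_nat d - of_nat n)"
  obtain K' where K: "K = Suc K'"
    using ge2.prems by (cases K) auto
  have c: "of_nat (Suc n) * (of_nat d - of_nat n) = op_const c"
  proof -
    have "of_nat d - of_nat n = op_const (of_nat d - of_nat n)"
      using op_const_add[of "of_nat d - of_nat n" "of_nat n"] by (simp add: of_nat_op_const)
    then show ?thesis
      by (simp only: c_def op_const_mult of_nat_op_const)
  qed
  have theta: "op_theta * P_op d (Suc n)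
      = (\<Sum>m\<le>K. op_z ^ m * op_poly ([:of_nat m, 1:] * theta_coeff d (Suc n) m) op_theta)"
  proof -
    have "[:0, 1:] * q + smult (of_nat m) q = [:of_nat m, 1:] * q" for m and q :: "complex poly"
      by simp
    moreover have "P_op d (Suc n) = (\<Sum>m\<le>K. op_z ^ m * op_poly (theta_coeff d (Suc n) m) op_theta)"
      using ge2.prems by (intro ge2.IH(2)) linarith
    ultimately show ?thesis
      by (simp only: sum_distrib_left op_theta_normal_form)
  qed
  have "op_const c * op_z * (op_z ^ m * q) = op_z ^ Suc m * (op_const c * q)" for m q
  proof -
    have "op_const c * op_z ^ k = op_z ^ k * op_const c" for k
      by (induction k) (simp, metis mult.assoc op_const_z power_Suc)
    from this[of "Suc m"] show ?thesis
      by (simp flip: mult.assoc)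
  qed
  moreover have "P_op d n = (\<Sum>m\<le>K'. op_z ^ m * op_poly (theta_coeff d n m) op_theta)"
    using ge2.prems K by (intro ge2.IH(1)) linarith
  ultimately have "op_const c * op_z * P_op d n
      = (\<Sum>m\<le>K'. op_z ^ Suc m * op_poly (smult c (theta_coeff d n m)) op_theta)"
    by (simp only: sum_distrib_left op_poly_smult)
  also have "\<dots> = (\<Sum>m\<le>K. op_z ^ m *
      op_poly (case m of 0 \<Rightarrow> 0 | Suc k \<Rightarrow> smult c (theta_coeff d n k)) op_theta)"
    unfolding K by (subst sum.atMost_Suc_shift) simp
  finally show ?case
    unfolding P_op.simps theta_coeff.simps c theta c_def[symmetric]
    by (simp only: op_poly_diff right_diff_distrib sum_subtractf)
qed

lemma R_B_eq: "m \<le> (d + 1) div 2 \<Longrightarrow> R_B d m = theta_coeff d (d + 1) m"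
  by (rule normal_form_unique[OF trans[OF R_B(1)[symmetric] P_op_theta_coeff]]) auto

lemma coeff_theta_coeff_eq_0: "n < i + 2 * m \<Longrightarrow> coeff (theta_coeff d n m) i = 0"
proof (induction d n m arbitrary: i rule: theta_coeff.induct)
  case (2 d m)
  then show ?case by (auto simp: coeff_pCons split: nat.splits)
next
  case (3 d n m)
  then show ?case by (auto simp: coeff_pCons split: nat.splits)
qed auto

lemma coeff_symbol_eq_0: "n < 2 * m \<Longrightarrow> coeff (symbol d n) m = 0"
  by (induction d n arbitrary: m rule: symbol.induct) (auto simp: coeff_pCons split: nat.splits)

lemma coeff_theta_coeff_top: "i + 2 * m = n \<Longrightarrow> coeff (theta_coeff d n m) i = coeff (symbol d n) m"
proof (induction d n m arbitrary: i rule: theta_coeff.induct)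
  case (3 d n m)
  then show ?case
    by (auto simp: coeff_pCons coeff_theta_coeff_eq_0 coeff_symbol_eq_0 split: nat.splits)
next
  case (2 d m)
  then have "i = 1" "m = 0"
    by presburger+
  then show ?case by simp
qed auto

text \<open>
  The coefficients \<open>\<beta>\<^sub>n\<^sub>,\<^sub>m\<close> below the top ones satisfy the recurrence of the \<open>\<alpha>\<^sub>n\<^sub>,\<^sub>m\<close> with the
  inhomogeneity \<open>m \<alpha>\<^sub>n\<^sub>,\<^sub>m\<close>. With \<open>p\<^sub>n(x) = \<Sum>\<^sub>m \<alpha>\<^sub>n\<^sub>,\<^sub>m x\<^sup>n\<^sup>-\<^sup>2\<^sup>m\<close> it is solved by
  \<open>\<Sum>\<^sub>m \<beta>\<^sub>n\<^sub>,\<^sub>m x\<^sup>n\<^sup>-\<^sup>2\<^sup>m\<^sup>-\<^sup>1 = (d p\<^sub>n' - n (d - n + 1) p\<^sub>n\<^sub>-\<^sub>1 - x p\<^sub>n'') / 4\<close>. The lemma is this identity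
  coefficient by coefficient. The point is that the middle term disappears at \<open>n = d + 1\<close>, so that
  the \<open>\<beta>\<close> there are explicit multiples of the \<open>\<alpha>\<close>.
\<close>

lemma coeff_theta_coeff_subtop:
  "Suc i + 2 * m = n \<Longrightarrow> 4 * coeff (theta_coeff d n m) i
    = of_nat (Suc i) * (of_nat d - of_nat i) * coeff (symbol d n) m
      - of_nat n * (of_nat d + 1 - of_nat n) * coeff (symbol d (n - 1)) m"
proof (induction d n m arbitrary: i rule: theta_coeff.induct)
  case (2 d m)
  then show ?case by simp
next
  case (3 d n m)
  define c :: complex where "c = of_nat (Suc n) * (of_nat d - of_nat n)"
  define h where "h k = coeff (symbol d k) m" for k
  define h' where "h' k = (case m of 0 \<Rightarrow> 0 | Suc l \<Rightarrow> coeff (symbol d k) l)" for k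
  \<comment> \<open>Only \<open>n + 1 = i + 2 m\<close> ties the indices together; the final step is a polynomial identity modulo it.\<close>
  have idx: "of_nat n = of_nat i + 2 * of_nat m - (1 :: complex)"
    using arg_cong[OF "3.prems", of "of_nat :: nat \<Rightarrow> complex"] by simp
  have top: "coeff (theta_coeff d (Suc n) m) i = h (Suc n)"
    using "3.prems" by (simp add: coeff_theta_coeff_top h_def)
  have left: "4 * coeff (pCons 0 (theta_coeff d (Suc n) m)) i
      = of_nat i * (of_nat d - of_nat i + 1) * h (Suc n) - c * h n"
  proof (cases i)
    case 0
    then have "h n = 0"
      using "3.prems" by (simp add: h_def coeff_symbol_eq_0)
    with 0 show ?thesis by simp
  next
    case (Suc j)
    show ?thesis
      using "3.IH"(1)[of j] "3.prems" Suc by (simp add: h_def c_def algebra_simps)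
  qed
  have right: "4 * coeff (case m of 0 \<Rightarrow> 0 | Suc k \<Rightarrow> smult c (theta_coeff d n k)) i
      = c * (of_nat (Suc i) * (of_nat d - of_nat i) * h' n
        - of_nat n * (of_nat d + 1 - of_nat n) * h' (n - 1))"
  proof (cases m)
    case (Suc k)
    show ?thesis
      using "3.IH"(2)[of k i] "3.prems" Suc by (simp add: h'_def)
  qed (simp add: h'_def)
  have rec: "h (Suc n) = h n - of_nat n * (of_nat d + 1 - of_nat n) * h' (n - 1)"
    by (cases n) (simp_all add: h_def h'_def coeff_pCons split: nat.split)
  have rec2: "h (Suc (Suc n)) = h (Suc n) - c * h' n"
    by (simp add: h_def h'_def c_def coeff_pCons split: nat.split)
  have "4 * coeff (theta_coeff d (Suc (Suc n)) m) i
      = 4 * of_nat m * h (Suc n) + (of_nat i * (of_nat d - of_nat i + 1) * h (Suc n) - c * h n)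
        - c * (of_nat (Suc i) * (of_nat d - of_nat i) * h' n
          - of_nat n * (of_nat d + 1 - of_nat n) * h' (n - 1))"
    unfolding theta_coeff.simps left[symmetric] right[symmetric] c_def[symmetric]
    by (simp add: top algebra_simps)
  also have "\<dots> = (4 * of_nat m + of_nat i * (of_nat d - of_nat i + 1) - c) * h (Suc n)
      - c * (of_nat (Suc i) * (of_nat d - of_nat i) * h' n)"
    unfolding rec by (simp add: algebra_simps)
  also have "\<dots> = of_nat (Suc i) * (of_nat d - of_nat i) * h (Suc (Suc n))
      - of_nat (Suc (Suc n)) * (of_nat d + 1 - of_nat (Suc (Suc n))) * h (Suc n)"
    unfolding rec2 c_def by (simp add: idx algebra_simps)
  finally show ?case
    by (simp add: h_def)
qed simp

text \<open>
  The factors \<open>n (d - n + 1)\<close> are positive for \<open>1 \<le> n \<le> d\<close>, so all contributions to a coefficient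
  have the same sign and none can cancel.
\<close>

lemma coeff_symbol_sign:
  assumes "n \<le> d + 1"
  shows "\<exists>x\<ge>0. (2 * m \<le> n \<longrightarrow> x > 0) \<and> coeff (symbol d n) m = (- 1) ^ m * of_real x"
  using assms
proof (induction d n arbitrary: m rule: symbol.induct)
  case (3 d n)
  obtain x where x: "x \<ge> 0" "2 * m \<le> Suc n \<longrightarrow> x > 0"
    "coeff (symbol d (Suc n)) m = (- 1) ^ m * of_real x"
    using "3.IH"(1)[of m] "3.prems" by auto
  show ?case
  proof (cases m)
    case 0
    with x show ?thesis by auto
  next
    case (Suc k)
    obtain y where y: "y \<ge> 0" "2 * k \<le> n \<longrightarrow> y > 0"
      "coeff (symbol d n) k = (- 1) ^ k * of_real y"
      using "3.IH"(2)[of k] "3.prems" by auto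
    have c: "real (Suc n) * (real d - real n) > 0"
      using "3.prems" by simp
    have "coeff (symbol d (Suc (Suc n))) m
        = (- 1) ^ m * of_real (x + real (Suc n) * (real d - real n) * y)"
      using x y Suc by (simp add: algebra_simps)
    moreover have "0 \<le> x + real (Suc n) * (real d - real n) * y"
      using x y c by simp
    moreover have "2 * m \<le> Suc (Suc n) \<longrightarrow> 0 < x + real (Suc n) * (real d - real n) * y"
      using x(1) y(2) c Suc by (auto intro!: add_nonneg_pos)
    ultimately show ?thesis by blast
  qed
qed (auto simp: coeff_pCons split: nat.splits intro: exI[of _ 0] exI[of _ 1])

lemma coeff_symbol_nonzero: "n \<le> d + 1 \<Longrightarrow> 2 * m \<le> n \<Longrightarrow> coeff (symbol d n) m \<noteq> 0"
  using coeff_symbol_sign[of n d m] by auto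

section \<open>Roots of the leading polynomial\<close>

lemma mult_pderiv_power: "p * pderiv (p ^ n) = smult (of_nat n) (p ^ n * pderiv p)"
  for p :: "complex poly"
  by (cases n) (simp, simp only: pderiv_power_Suc, simp add: mult_ac del: of_nat_Suc)

text \<open>
  The recurrence expresses the differential equation \<open>(1 - u\<^sup>2) G' = (x - d u) G\<close> of
  \<open>G = (1 + u)\<^sup>d\<^sup>-\<^sup>i (1 - u)\<^sup>i\<close>.
\<close>

lemma krawtchouk_recurrence:
  fixes d i :: nat
  assumes "i \<le> d"
  defines "G \<equiv> [:1, 1:] ^ (d - i) * [:1, - 1 :: complex:] ^ i"
  defines "x \<equiv> of_nat d - 2 * of_nat i :: complex"
  shows "coeff G 0 = 1" "coeff G 1 = x"
    and "of_nat (n + 2) * coeff G (n + 2) = x * coeff G (n + 1) - (of_nat d - of_nat n) * coeff G n"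
proof -
  define a b :: "complex poly" where "a = [:1, 1:]" and "b = [:1, - 1:]"
  have "a * b * pderiv G = b ^ i * b * (a * pderiv (a ^ (d - i))) + a ^ (d - i) * a * (b * pderiv (b ^ i))"
    by (simp add: G_def pderiv_mult algebra_simps flip: a_def b_def)
  also have "\<dots> = (smult (of_nat (d - i)) (b * pderiv a) + smult (of_nat i) (a * pderiv b)) * G"
    by (simp add: mult_pderiv_power G_def algebra_simps flip: a_def b_def)
  also have "smult (of_nat (d - i)) (b * pderiv a) + smult (of_nat i) (a * pderiv b) = [:x, - of_nat d:]"
    using assms(1) by (simp add: a_def b_def x_def pderiv_pCons of_nat_diff)
  also have "a * b = [:1, 0, - 1:]"
    by (simp add: a_def b_def)
  finally have ode: "[:1, 0, - 1:] * pderiv G = [:x, - of_nat d:] * G" .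
  show G0: "coeff G 0 = 1"
    by (simp add: G_def coeff_mult_0 coeff_0_power)
  show "coeff G 1 = x"
    using arg_cong[OF ode, of "\<lambda>p. coeff p 0"] by (simp add: coeff_pderiv G0)
  show "of_nat (n + 2) * coeff G (n + 2) = x * coeff G (n + 1) - (of_nat d - of_nat n) * coeff G n"
    using arg_cong[OF ode, of "\<lambda>p. coeff p (Suc n)"]
    by (cases n) (simp_all add: coeff_pderiv algebra_simps)
qed

text \<open>
  With the factor \<open>n!\<close> the recurrence of the coefficients of \<open>(1 + u)\<^sup>d\<^sup>-\<^sup>i (1 - u)\<^sup>i\<close> is the one that
  defines \<^const>\<open>symbol\<close>. The product has degree \<open>d\<close> in \<open>u\<close>, so at \<open>n = d + 1\<close> the right-hand side
  vanishes and \<open>1 / x\<^sup>2\<close> is a root.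
\<close>

lemma poly_symbol_krawtchouk:
  fixes d i :: nat
  assumes "i \<le> d" and x: "x = of_nat d - 2 * of_nat i" "x \<noteq> (0 :: complex)"
  shows "x ^ n * poly (symbol d n) (1 / x ^ 2)
    = fact n * coeff ([:1, 1:] ^ (d - i) * [:1, - 1:] ^ i) n"
proof (induction n rule: induct_nat_012)
  case (ge2 n)
  define g where "g n = coeff ([:1, 1:] ^ (d - i) * [:1, - 1 :: complex:] ^ i) n" for n
  define h where "h n = poly (symbol d n) (1 / x ^ 2)" for n
  have g: "of_nat (n + 2) * g (n + 2) = x * g (n + 1) - (of_nat d - of_nat n) * g n"
    using krawtchouk_recurrence(3)[OF assms(1), of n] by (simp add: g_def x(1))
  have "x ^ Suc (Suc n) * h (Suc (Suc n))
      = x * (x ^ Suc n * h (Suc n)) - of_nat (Suc n) * (of_nat d - of_nat n) * (x ^ n * h n)"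
    using x(2) by (simp add: h_def field_simps power2_eq_square)
  also have "\<dots> = fact (Suc n) * (x * g (n + 1) - (of_nat d - of_nat n) * g n)"
    using ge2.IH unfolding h_def[symmetric] g_def[symmetric]
    by (simp only:) (simp add: algebra_simps)
  also have "\<dots> = fact (Suc (Suc n)) * g (Suc (Suc n))"
    unfolding g[symmetric] by (simp add: algebra_simps)
  finally show ?case
    by (simp only: h_def g_def)
qed (use krawtchouk_recurrence[OF assms(1)] x in simp_all)

text \<open>
  The polynomial \<open>Q\<close> for which \<open>z\<^sup>d Q(z)\<close> is the leading coefficient of \<open>z L_A d\<close>. Passing from
  \<^const>\<open>R_B\<close> to \<^const>\<open>R_A\<close> multiplies the \<open>k\<close>-th top coefficient by \<open>2\<^sup>k\<close> twice: once explicitly, and once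
  from the factors \<open>2 \<theta> + 2 j - 1\<close>.
\<close>

definition lead_poly :: "nat \<Rightarrow> complex poly" where
  "lead_poly d = pcompose (symbol d (d + 1)) [:0, 4:]"

lemma coeff_pcompose_monom_linear: "coeff (pcompose p [:0, c:]) k = c ^ k * coeff p k"
  for p :: "complex poly"
  by (induction p arbitrary: k) (auto simp: pcompose_pCons coeff_pCons split: nat.splits)

lemma coeff_lead_poly: "coeff (lead_poly d) k = 4 ^ k * coeff (symbol d (d + 1)) k"
  by (simp add: lead_poly_def coeff_pcompose_monom_linear)

lemma degree_lead_poly: "degree (lead_poly d) \<le> (d + 1) div 2"
  by (rule degree_le) (auto simp: coeff_lead_poly intro!: coeff_symbol_eq_0)

lemma poly_lead_poly_0: "poly (lead_poly d) 0 = 1"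
proof -
  have "coeff (symbol d n) 0 = 1" for n
    by (induction d n rule: symbol.induct) simp_all
  then show ?thesis
    using coeff_lead_poly[of d 0] by (simp add: poly_0_coeff_0)
qed

lemma lead_poly_nonzero [simp]: "lead_poly d \<noteq> 0"
  using poly_lead_poly_0[of d] by auto

lemma card_roots_lead_poly: "(d + 1) div 2 \<le> card {z. poly (lead_poly d) z = 0}"
proof -
  define f :: "nat \<Rightarrow> complex" where "f i = 1 / (4 * (of_nat d - 2 * of_nat i) ^ 2)" for i
  have f_real: "f i = of_real (1 / (4 * (real d - 2 * real i) ^ 2))" for i
    by (simp add: f_def)
  have "inj_on f {..<(d + 1) div 2}"
  proof (rule inj_onI)
    fix i j assume "i \<in> {..<(d + 1) div 2}" "j \<in> {..<(d + 1) div 2}" and eq: "f i = f j"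
    then have pos: "real d - 2 * real i > 0" "real d - 2 * real j > 0"
      by auto
    from eq have "1 / (4 * (real d - 2 * real i) ^ 2) = 1 / (4 * (real d - 2 * real j) ^ 2)"
      unfolding f_real of_real_eq_iff .
    then have "(real d - 2 * real i) ^ 2 = (real d - 2 * real j) ^ 2"
      by simp
    then have "real d - 2 * real i = real d - 2 * real j"
      by (rule power2_eq_imp_eq) (use pos in simp_all)
    then show "i = j" by simp
  qed
  then have "(d + 1) div 2 = card (f ` {..<(d + 1) div 2})"
    by (simp add: card_image)
  also have "\<dots> \<le> card {z. poly (lead_poly d) z = 0}"
  proof (rule card_mono)
    show "finite {z. poly (lead_poly d) z = 0}"
      by (simp add: poly_roots_finite)
    show "f ` {..<(d + 1) div 2} \<subseteq> {z. poly (lead_poly d) z = 0}"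
    proof safe
      fix i assume i: "i < (d + 1) div 2"
      define x :: complex where "x = of_nat d - 2 * of_nat i"
      have "x = of_real (real d - 2 * real i)"
        by (simp add: x_def)
      moreover have "real d - 2 * real i \<noteq> 0"
        using i by simp
      ultimately have x: "x \<noteq> 0"
        by (metis of_real_eq_0_iff)
      have "degree ([:1, 1:] ^ (d - i) * [:1, - 1:] ^ i :: complex poly) \<le> (d - i) + i"
        by (intro order.trans[OF degree_mult_le] add_mono order.trans[OF degree_power_le]) auto
      then have "coeff ([:1, 1:] ^ (d - i) * [:1, - 1:] ^ i :: complex poly) (d + 1) = 0"
        using i by (intro coeff_eq_0) auto
      then have "x ^ (d + 1) * poly (symbol d (d + 1)) (1 / x ^ 2) = 0"
        using poly_symbol_krawtchouk[of i d x "d + 1"] i x by (simp add: x_def)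
      then show "poly (lead_poly d) (f i) = 0"
        using x by (simp add: lead_poly_def poly_pcompose f_def flip: x_def)
    qed
  qed
  finally show ?thesis .
qed

lemma simple_root_if_enough_roots:
  fixes p :: "complex poly"
  assumes "p \<noteq> 0" "degree p \<le> card {z. poly p z = 0}" "poly p a = 0"
  shows "poly (pderiv p) a \<noteq> 0"
proof
  assume d: "poly (pderiv p) a = 0"
  obtain q where q: "p = [:- a, 1:] * q"
    using assms(3) by (auto simp: poly_eq_0_iff_dvd)
  then have "q \<noteq> 0"
    using assms(1) by auto
  have "poly q a = 0"
    using d by (simp add: q pderiv_mult pderiv_pCons del: mult_pCons_left)
  then have "{z. poly p z = 0} \<subseteq> {z. poly q z = 0}"
    by (auto simp: q)
  then have "card {z. poly p z = 0} \<le> card {z. poly q z = 0}"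
    using \<open>q \<noteq> 0\<close> by (intro card_mono) (simp_all add: poly_roots_finite)
  also have "\<dots> \<le> degree q"
    using \<open>q \<noteq> 0\<close> by (rule card_poly_roots_bound)
  also have "\<dots> < degree p"
    unfolding q using \<open>q \<noteq> 0\<close> by (subst degree_mult_eq) auto
  finally show False
    using assms(2) by simp
qed

lemma simple_root_lead_poly: "poly (lead_poly d) a = 0 \<Longrightarrow> poly (pderiv (lead_poly d)) a \<noteq> 0"
  using card_roots_lead_poly[of d] degree_lead_poly[of d] by (intro simple_root_if_enough_roots) auto

lemma card_roots_lead_poly_le: "card {z. poly (lead_poly d) z = 0} \<le> (d + 1) div 2"
  using card_poly_roots_bound[of "lead_poly d"] degree_lead_poly[of d] by simp

section \<open>The two top coefficients of the operator polynomials\<close>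

text \<open>
  A polynomial of the form \<open>a (x\<^sup>n + s x\<^sup>n\<^sup>-\<^sup>1 + \<dots>)\<close>. Here \<open>s\<close> is relative to \<open>a\<close> because in this form
  it is additive under multiplication, each factor \<open>u x + v\<close> adding \<open>v / u\<close>. For \<open>n = 0\<close> the
  convention \<open>s = 0\<close> keeps it so.
\<close>

definition top_terms :: "nat \<Rightarrow> complex poly \<Rightarrow> complex \<Rightarrow> complex \<Rightarrow> bool" where
  "top_terms n p a s \<longleftrightarrow> degree p \<le> n \<and> coeff p n = a \<and>
    (case n of 0 \<Rightarrow> s = 0 | Suc k \<Rightarrow> coeff p k = a * s)"

lemma top_terms_mult_linear:
  assumes "top_terms n p a s" "u \<noteq> 0"
  shows "top_terms (Suc n) (p * [:v, u:]) (a * u) (s + v / u)"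
proof -
  have "degree (p * [:v, u:]) \<le> Suc n"
    using assms(1) degree_mult_le[of p "[:v, u:]"] assms(2) by (simp add: top_terms_def)
  moreover have z: "coeff p (Suc n) = 0"
    using assms(1) by (auto simp: top_terms_def intro: coeff_eq_0)
  moreover have "coeff (p * [:v, u:]) (Suc n) = a * u"
    using assms(1) z by (simp add: top_terms_def)
  moreover have "coeff (p * [:v, u:]) n = a * u * (s + v / u)"
    using assms by (cases n) (simp_all add: top_terms_def distrib_left)
  ultimately show ?thesis
    by (simp add: top_terms_def)
qed

lemma top_terms_mult_half_integers:
  assumes "top_terms n p a s"
  shows "top_terms (n + k) (p * (\<Prod>j = 1..k. [:2 * of_nat j - 1, 2:])) (a * 2 ^ k) (s + of_nat k ^ 2 / 2)"
proof (induction k)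
  case (Suc k)
  have prod: "p * (\<Prod>j = 1..Suc k. [:2 * of_nat j - 1, 2:])
      = p * (\<Prod>j = 1..k. [:2 * of_nat j - 1, 2:]) * [:2 * of_nat (Suc k) - 1, 2:]"
    by (subst prod.nat_ivl_Suc') (simp, simp only: mult_ac)
  from top_terms_mult_linear[OF Suc.IH, of 2 "2 * of_nat (Suc k) - 1"]
  have "top_terms (Suc (n + k)) (p * (\<Prod>j = 1..Suc k. [:2 * of_nat j - 1, 2:])) (a * 2 ^ Suc k)
      (s + of_nat k ^ 2 / 2 + (2 * of_nat (Suc k) - 1) / 2)"
    unfolding prod by (simp only: power_Suc2 mult.assoc zero_neq_numeral[symmetric] not_False_eq_True)
  also have "s + of_nat k ^ 2 / 2 + (2 * of_nat (Suc k) - 1) / 2 = s + of_nat (Suc k) ^ 2 / 2"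
  proof -
    have "x ^ 2 / 2 + (2 * (1 + x) - 1) / 2 = (1 + x) ^ 2 / 2" for x :: complex
      by (simp add: power2_eq_square algebra_simps add_divide_distrib diff_divide_distrib)
    from this[of "of_nat k"] show ?thesis
      by (simp only: of_nat_Suc add.assoc)
  qed
  finally show ?case
    by (simp only: add_Suc_right)
qed (use assms in simp)

lemma top_terms_mult_integers:
  assumes "top_terms n p a s"
  shows "top_terms (n + k) (p * (\<Prod>j = 1..k. [:of_nat j, 1:])) a (s + of_nat k * (of_nat k + 1) / 2)"
proof (induction k)
  case (Suc k)
  have prod: "p * (\<Prod>j = 1..Suc k. [:of_nat j, 1:]) = p * (\<Prod>j = 1..k. [:of_nat j, 1:]) * [:of_nat (Suc k), 1:]"
    by (subst prod.nat_ivl_Suc') (simp, simp only: mult_ac)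
  from top_terms_mult_linear[OF Suc.IH, of 1 "of_nat (Suc k)"]
  have "top_terms (Suc (n + k)) (p * (\<Prod>j = 1..Suc k. [:of_nat j, 1:])) a
      (s + of_nat k * (of_nat k + 1) / 2 + of_nat (Suc k))"
    unfolding prod by (simp only: div_by_1 mult_1_right one_neq_zero not_False_eq_True simp_thms)
  also have "s + of_nat k * (of_nat k + 1) / 2 + of_nat (Suc k)
      = s + of_nat (Suc k) * (of_nat (Suc k) + 1) / (2 :: complex)"
    by (simp add: algebra_simps add_divide_distrib)
  finally show ?case
    by (simp only: add_Suc_right)
qed (use assms in simp)

lemma top_terms_theta_coeff:
  assumes "i + 2 * k = d + 1"
  shows "top_terms i (theta_coeff d (d + 1) k) (coeff (symbol d (d + 1)) k) (of_nat k * of_nat i / 2)"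
proof -
  have "degree (theta_coeff d (d + 1) k) \<le> i"
    by (rule degree_le) (use assms in \<open>auto intro!: coeff_theta_coeff_eq_0\<close>)
  moreover have "coeff (theta_coeff d (d + 1) k) i = coeff (symbol d (d + 1)) k"
    by (rule coeff_theta_coeff_top) (rule assms)
  moreover have "coeff (theta_coeff d (d + 1) k) j = coeff (symbol d (d + 1)) k * (of_nat k * of_nat i / 2)"
    if "i = Suc j" for j
  proof -
    have "of_nat d - of_nat j = (2 * of_nat k :: complex)"
      using arg_cong[OF assms, of "of_nat :: nat \<Rightarrow> complex"] that by (simp add: algebra_simps)
    then have "4 * coeff (theta_coeff d (d + 1) k) j
        = 4 * (coeff (symbol d (d + 1)) k * (of_nat k * of_nat i / 2))"
      using coeff_theta_coeff_subtop[of j k "d + 1" d] assms that by simp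
    then show ?thesis
      by (subst (asm) mult_cancel_left) simp
  qed
  ultimately show ?thesis
    by (auto simp: top_terms_def split: nat.splits)
qed

text \<open>
  With \<open>i = d + 1 - 2 k\<close> the three groups of factors of \<open>R_A d k\<close> contribute \<open>k i / 2\<close>, \<open>k\<^sup>2 / 2\<close>
  and \<open>k (k - 1) / 2\<close> to \<open>s\<close>, in total \<open>d k / 2\<close>.
\<close>

lemma top_terms_R_A:
  assumes "k \<le> (d + 1) div 2" "d > 0"
  shows "top_terms d (R_A d k) (coeff (lead_poly d) k) (of_nat d * of_nat k / 2)"
proof (cases k)
  case 0
  have "coeff ([:0, 1:] ^ d :: complex poly) i = (if i = d then 1 else 0)" for i
    by (simp flip: monom_altdef[of 1, simplified])
  moreover have "coeff (lead_poly d) 0 = 1"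
    using poly_lead_poly_0[of d] by (simp add: poly_0_coeff_0)
  moreover have "degree ([:0, 1:] ^ d :: complex poly) \<le> d"
    using degree_power_le[of "[:0, 1:] :: complex poly" d] by simp
  ultimately show ?thesis
    using 0 \<open>d > 0\<close> by (auto simp: top_terms_def R_A_def split: nat.split)
next
  case (Suc l)
  define i where "i = d + 1 - 2 * k"
  define T where "T = theta_coeff d (d + 1) k"
  have i: "i + 2 * k = d + 1"
    using assms(1) by (simp add: i_def)
  have d: "i + k + l = d"
    using i Suc by simp
  have "top_terms (i + k + l) (T * (\<Prod>j = 1..k. [:2 * of_nat j - 1, 2:]) * (\<Prod>j = 1..l. [:of_nat j, 1:]))
      (coeff (symbol d (d + 1)) k * 2 ^ k)
      (of_nat k * of_nat i / 2 + of_nat k ^ 2 / 2 + of_nat l * (of_nat l + 1) / 2)"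
    unfolding T_def
    by (intro top_terms_mult_integers top_terms_mult_half_integers top_terms_theta_coeff i)
  also have "of_nat k * of_nat i / 2 + of_nat k ^ 2 / 2 + of_nat l * (of_nat l + 1) / 2
      = (of_nat d * of_nat k / 2 :: complex)"
    by (simp add: Suc power2_eq_square algebra_simps add_divide_distrib flip: d)
  finally have "top_terms d (T * (\<Prod>j = 1..k. [:2 * of_nat j - 1, 2:]) * (\<Prod>j = 1..l. [:of_nat j, 1:]))
      (coeff (symbol d (d + 1)) k * 2 ^ k) (of_nat d * of_nat k / 2)"
    by (simp only: d)
  then have "top_terms d (smult (2 ^ k) (T * (\<Prod>j = 1..k. [:2 * of_nat j - 1, 2:]) * (\<Prod>j = 1..l. [:of_nat j, 1:])))
      (2 ^ k * (coeff (symbol d (d + 1)) k * 2 ^ k)) (of_nat d * of_nat k / 2)"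
    by (auto simp: top_terms_def intro: order.trans[OF degree_smult_le] split: nat.splits)
  moreover have "smult (2 ^ k) (T * (\<Prod>j = 1..k. [:2 * of_nat j - 1, 2:]) * (\<Prod>j = 1..l. [:of_nat j, 1:])) = R_A d k"
    using assms(1) Suc
    by (simp add: R_A_def R_B_eq T_def mult.assoc numeral_poly poly_const_pow
        mult.commute[of 2 "2 ^ l :: complex"])
  moreover have "2 ^ k * (coeff (symbol d (d + 1)) k * 2 ^ k) = coeff (lead_poly d) k"
    by (simp add: coeff_lead_poly flip: power_mult_distrib)
  ultimately show ?thesis by simp
qed

text \<open>
  For odd \<open>d\<close> the factor \<open>R_B d r\<close> is a constant. For even \<open>d\<close> it is linear, and its root \<open>-r/2\<close>
  is known from its two top coefficients. The other factors have roots \<open>-(2 j - 1) / 2\<close> with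
  \<open>j \<le> r\<close> and \<open>-j\<close> with \<open>j < r\<close>.
\<close>

lemma roots_R_A_top:
  assumes "d > 0" "r = (d + 1) div 2" "poly (R_A d r) z = 0"
  shows "- real r < Re z \<and> Re z < 0"
proof -
  have r: "r > 0" using assms by simp
  have "poly (2 ^ r) z \<noteq> (0 :: complex)"
    by simp
  then consider "poly (theta_coeff d (d + 1) r) z = 0"
    | j where "j \<in> {1..r}" "2 * of_nat j - 1 + z * 2 = 0"
    | j where "j \<in> {1..r - 1}" "of_nat j + z = 0"
    using assms r by (auto simp: R_A_def R_B_eq poly_prod)
  then show ?thesis
  proof cases
    case 1
    define a where "a = coeff (symbol d (d + 1)) r"
    have a: "a \<noteq> 0"
      unfolding a_def by (rule coeff_symbol_nonzero) (use assms in auto)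
    \<comment> \<open>The degree of \<open>R_B d r\<close> is \<open>d + 1 - 2 r\<close>, that is, \<open>0\<close> for odd and \<open>1\<close> for even \<open>d\<close>.\<close>
    consider "0 + 2 * r = d + 1" | "Suc 0 + 2 * r = d + 1"
      using assms(2) by linarith
    then show ?thesis
    proof cases
      case 1
      from top_terms_theta_coeff[OF this] have "theta_coeff d (d + 1) r = [:a:]"
        by (auto simp: top_terms_def a_def elim: degree_eq_zeroE)
      with \<open>poly (theta_coeff d (d + 1) r) z = 0\<close> a show ?thesis by simp
    next
      case 2
      from top_terms_theta_coeff[OF this]
      have "theta_coeff d (d + 1) r = [:a * (of_nat r / 2), a:]"
        by (intro poly_eqI) (auto simp: top_terms_def a_def coeff_pCons coeff_eq_0 split: nat.splits)
      with \<open>poly (theta_coeff d (d + 1) r) z = 0\<close> have "a * (of_nat r / 2 + z) = 0"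
        by (simp add: distrib_left mult.commute)
      with a have "Re (of_nat r / 2 + z) = 0"
        by simp
      then have "Re z = - real r / 2"
        by simp
      then show ?thesis using r by simp
    qed
  next
    case (2 j)
    have "Re (2 * of_nat j - 1 + z * 2) = 0"
      unfolding 2(2) by simp
    then have "2 * real j - 1 + Re z * 2 = 0"
      by simp
    with 2(1) show ?thesis by simp
  next
    case (3 j)
    have "Re (of_nat j + z) = 0"
      unfolding 3(2) by simp
    then have "real j + Re z = 0"
      by simp
    with 3(1) show ?thesis by auto
  qed
qed

section \<open>Coefficients and exponents of the operator\<close>

lemma rf_var_mult_deriv_monomial:
  "rf_var * rf_deriv (rf_const c * rf_var ^ i) = rf_const (of_nat i * c) * rf_var ^ i"
proof (induction i)
  case (Suc i)
  have "rf_var * rf_deriv (rf_const c * rf_var ^ Suc i)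
      = rf_var * (rf_var * rf_deriv (rf_const c * rf_var ^ i)) + rf_const c * rf_var ^ Suc i"
    using rf_deriv_mult[of rf_var "rf_const c * rf_var ^ i"] by (simp add: algebra_simps)
  then show ?case
    by (simp add: Suc algebra_simps rf_const_add rf_const_mult)
qed simp

lemma coeff_op_theta_mult:
  "coeff (op_coeffs (op_theta * P)) i = rf_var *
    ((case i of 0 \<Rightarrow> 0 | Suc j \<Rightarrow> coeff (op_coeffs P) j) + rf_deriv (coeff (op_coeffs P) i))"
proof -
  have "op_coeffs (op_D * P) = lmult_D (op_coeffs P)"
    by (simp add: times_diffop.rep_eq op_coeffs_D ore_mult_pCons_left)
  then have "op_coeffs (op_theta * P) = smult rf_var (lmult_D (op_coeffs P))"
    by (simp add: op_theta_def op_z_def mult.assoc times_diffop.rep_eq[of "op_of_rf rf_var"]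
        op_coeffs_of_rf ore_mult_const_left)
  then show ?thesis
    by (simp add: lmult_D_def coeff_map_poly coeff_pCons)
qed

text \<open>
  A polynomial in \<open>\<theta>\<close> is \<open>\<Sum>\<^sub>i g i z\<^sup>i D\<^sup>i\<close>. The correction term in the second coefficient is that of
  \<open>\<theta>\<^sup>N = z\<^sup>N D\<^sup>N + N (N - 1) / 2 z\<^sup>N\<^sup>-\<^sup>1 D\<^sup>N\<^sup>-\<^sup>1 + \<dots>\<close>.
\<close>

lemma op_coeffs_op_poly_theta:
  "\<exists>g. (\<forall>i. coeff (op_coeffs (op_poly q op_theta)) i = rf_const (g i) * rf_var ^ i) \<and>
    (\<forall>N\<ge>degree q. (\<forall>i>N. g i = 0) \<and> g N = coeff q N \<and>
      (\<forall>n. N = Suc n \<longrightarrow> g n = coeff q n + of_nat (n * Suc n) / 2 * coeff q N))"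
proof (induction q)
  case 0
  show ?case
    by (rule exI[of _ "\<lambda>_. 0"]) (simp add: zero_diffop.rep_eq)
next
  case (pCons c p)
  then obtain g where g: "\<And>i. coeff (op_coeffs (op_poly p op_theta)) i = rf_const (g i) * rf_var ^ i"
    and top: "\<And>N. degree p \<le> N \<Longrightarrow> (\<forall>i>N. g i = 0) \<and> g N = coeff p N \<and>
      (\<forall>n. N = Suc n \<longrightarrow> g n = coeff p n + of_nat (n * Suc n) / 2 * coeff p N)"
    by blast
  define h where "h i = (case i of 0 \<Rightarrow> c | Suc j \<Rightarrow> g j) + of_nat i * g i" for i
  have "op_poly (pCons c p) op_theta = op_const c + op_theta * op_poly p op_theta"
  proof -
    have "pCons c p = [:c:] + [:0, 1:] * p"
      by simp
    then have "op_poly (pCons c p) op_theta = op_poly [:c:] op_theta + op_theta * op_poly p op_theta"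
      by (simp only: op_poly_add op_poly_theta_times)
    then show ?thesis
      by (simp add: op_poly_def)
  qed
  then have "coeff (op_coeffs (op_poly (pCons c p) op_theta)) i = rf_const (h i) * rf_var ^ i" for i
    unfolding h_def
    by (simp add: plus_diffop.rep_eq op_const_def op_coeffs_of_rf coeff_op_theta_mult g distrib_left
        rf_var_mult_deriv_monomial coeff_pCons rf_const_add algebra_simps split: nat.split)
  moreover have "(\<forall>i>N. h i = 0) \<and> h N = coeff (pCons c p) N \<and>
      (\<forall>n. N = Suc n \<longrightarrow> h n = coeff (pCons c p) n + of_nat (n * Suc n) / 2 * coeff (pCons c p) N)"
    if N: "degree (pCons c p) \<le> N" for N
  proof (cases N)
    case 0
    with N have "p = 0"
      by (simp split: if_splits)
    then have "g i = 0" for i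
      using top[of 0] by (cases i) auto
    with 0 show ?thesis
      by (auto simp: h_def split: nat.split)
  next
    case (Suc n)
    have n: "degree p \<le> n"
      using N Suc by (cases "p = 0") auto
    have low: "g i = 0" if "i > n" for i
      using top[OF n] that by blast
    have "h i = 0" if "i > N" for i
      using that Suc low by (auto simp: h_def split: nat.split)
    moreover have "h N = coeff (pCons c p) N"
      using top[OF n] low Suc by (simp add: h_def)
    moreover have "h n = coeff (pCons c p) n + of_nat (n * Suc n) / 2 * coeff (pCons c p) N"
    proof (cases n)
      case 0
      then show ?thesis by (simp add: h_def)
    next
      case (Suc m)
      have "g m = coeff p m + of_nat (m * Suc m) / 2 * coeff p n" "g n = coeff p n"
        using top[OF n] Suc by auto
      then show ?thesis
        using Suc \<open>N = Suc n\<close> by (simp add: h_def algebra_simps add_divide_distrib)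
    qed
    ultimately show ?thesis
      using Suc by auto
  qed
  ultimately show ?case by blast
qed

text \<open>
  The operator \<open>z L_A d\<close>, which has polynomial coefficients and the same right factors up to
  units.
\<close>

definition L_poly :: "nat \<Rightarrow> diffop" where
  "L_poly d = (\<Sum>k\<le>(d + 1) div 2. op_z ^ k * op_poly (R_A d k) op_theta)"

lemma op_coeffs_sum: "op_coeffs (sum f A) = (\<Sum>i\<in>A. op_coeffs (f i))"
  by (induction A rule: infinite_finite_induct) (simp_all add: zero_diffop.rep_eq plus_diffop.rep_eq)

lemma op_coeffs_rf_mult: "op_coeffs (op_of_rf a * P) = smult a (op_coeffs P)"
  by (simp add: times_diffop.rep_eq op_coeffs_of_rf ore_mult_const_left)

lemma op_coeffs_z_power_mult: "op_coeffs (op_z ^ k * P) = smult (rf_var ^ k) (op_coeffs P)"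
  by (induction k) (simp_all add: op_z_def op_coeffs_rf_mult mult.assoc)

lemma rf_monomial_eq_Fract: "rf_const c * rf_var ^ i = Fract (monom c i) 1"
proof (induction i)
  case (Suc i)
  have "rf_const c * rf_var ^ Suc i = rf_var * Fract (monom c i) 1"
    by (simp add: mult.left_commute flip: Suc)
  then show ?case
    by (simp add: rf_var_def monom_Suc)
qed (simp add: rf_const_def monom_0)

lemma Fract_sum: "(\<Sum>x\<in>A. Fract (f x) 1) = Fract (sum f A) (1 :: complex poly)"
  by (induction A rule: infinite_finite_induct) (simp_all add: Zero_fract_def)

text \<open>
  At a root of \<open>Q\<close> the two top coefficients of the operator are tied together by \<open>s = d k / 2\<close> in
  \<open>top_terms_R_A\<close>: the sum \<open>\<Sum>\<^sub>k k q\<^sub>k z\<^sup>k\<close> is \<open>z Q'(z)\<close>, and the multiples of \<open>Q(z)\<close> drop out. This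
  relation decides the exponent \<open>d/2 - 1\<close> there.
\<close>

lemma L_poly_coeffs:
  assumes d: "d = Suc n"
  obtains m where "\<And>i. coeff (op_coeffs (L_poly d)) i = Fract (m i) 1" "\<And>i. i > d \<Longrightarrow> m i = 0"
    "m d = monom 1 d * lead_poly d"
    "\<And>p. poly (lead_poly d) p = 0 \<Longrightarrow> poly (m n) p = of_nat d / 2 * p ^ d * poly (pderiv (lead_poly d)) p"
proof -
  let ?r = "(d + 1) div 2"
  obtain g where g: "\<And>k i. coeff (op_coeffs (op_poly (R_A d k) op_theta)) i = rf_const (g k i) * rf_var ^ i"
    and g_top: "\<And>k N. degree (R_A d k) \<le> N \<Longrightarrow> (\<forall>i>N. g k i = 0) \<and> g k N = coeff (R_A d k) N \<and>
      (\<forall>n. N = Suc n \<longrightarrow> g k n = coeff (R_A d k) n + of_nat (n * Suc n) / 2 * coeff (R_A d k) N)"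
  proof -
    have "\<exists>g. \<forall>k. (\<forall>i. coeff (op_coeffs (op_poly (R_A d k) op_theta)) i = rf_const (g k i) * rf_var ^ i) \<and>
      (\<forall>N\<ge>degree (R_A d k). (\<forall>i>N. g k i = 0) \<and> g k N = coeff (R_A d k) N \<and>
        (\<forall>n. N = Suc n \<longrightarrow> g k n = coeff (R_A d k) n + of_nat (n * Suc n) / 2 * coeff (R_A d k) N))"
      by (intro choice allI op_coeffs_op_poly_theta)
    then show thesis
      using that by blast
  qed
  define m where "m i = (\<Sum>k\<le>?r. monom (g k i) (i + k))" for i
  have coeffs: "coeff (op_coeffs (L_poly d)) i = Fract (m i) 1" for i
  proof -
    have "coeff (op_coeffs (L_poly d)) i = (\<Sum>k\<le>?r. rf_const (g k i) * rf_var ^ (i + k))"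
      by (simp add: L_poly_def op_coeffs_sum coeff_sum op_coeffs_z_power_mult g power_add mult_ac)
    then show ?thesis
      by (simp only: rf_monomial_eq_Fract Fract_sum m_def)
  qed
  have tt: "top_terms d (R_A d k) (coeff (lead_poly d) k) (of_nat d * of_nat k / 2)" if "k \<le> ?r" for k
    by (rule top_terms_R_A) (use that d in simp_all)
  have lead: "lead_poly d = (\<Sum>k\<le>?r. monom (coeff (lead_poly d) k) k)"
    by (rule poly_as_sum_of_monoms'[OF degree_lead_poly, symmetric])
  have "m i = 0" if "i > d" for i
    using g_top[of _ d] tt that by (simp add: m_def top_terms_def)
  moreover have "m d = monom 1 d * lead_poly d"
  proof -
    have "m d = (\<Sum>k\<le>?r. monom 1 d * monom (coeff (lead_poly d) k) k)"
      unfolding m_def by (rule sum.cong) (use g_top[of _ d] tt in \<open>auto simp: top_terms_def mult_monom\<close>)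
    also have "\<dots> = monom 1 d * (\<Sum>k\<le>?r. monom (coeff (lead_poly d) k) k)"
      by (simp only: sum_distrib_left)
    also have "\<dots> = monom 1 d * lead_poly d"
      by (simp only: lead[symmetric])
    finally show ?thesis .
  qed
  moreover have "poly (m n) p = of_nat d / 2 * p ^ d * poly (pderiv (lead_poly d)) p"
    if "poly (lead_poly d) p = 0" for p
  proof -
    let ?c = "coeff (lead_poly d)"
    have "g k n = ?c k * (of_nat d * of_nat k / 2) + of_nat (n * Suc n) / 2 * ?c k" if "k \<le> ?r" for k
      using g_top[of k d] tt[OF that] d by (simp add: top_terms_def)
    then have "poly (m n) p = (\<Sum>k\<le>?r. (?c k * (of_nat d * of_nat k / 2)
        + of_nat (n * Suc n) / 2 * ?c k) * p ^ (n + k))"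
      by (simp add: m_def poly_sum poly_monom)
    also have "\<dots> = of_nat d / 2 * p ^ n * (\<Sum>k\<le>?r. of_nat k * ?c k * p ^ k)
        + of_nat (n * Suc n) / 2 * p ^ n * (\<Sum>k\<le>?r. ?c k * p ^ k)"
      unfolding sum_distrib_left sum.distrib[symmetric]
      by (rule sum.cong) (simp_all add: power_add algebra_simps)
    also have "(\<Sum>k\<le>?r. ?c k * p ^ k) = 0"
      using that arg_cong[OF lead, of "\<lambda>q. poly q p"] by (simp add: poly_sum poly_monom)
    also have "(\<Sum>k\<le>?r. of_nat k * ?c k * p ^ k) = p * poly (pderiv (lead_poly d)) p"
    proof -
      have "pCons 0 (pderiv (lead_poly d)) = (\<Sum>k\<le>?r. monom (of_nat k * ?c k) k)"
      proof (rule poly_eqI)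
        fix i
        have "?c i = 0" if "i > ?r"
          using that degree_lead_poly[of d] by (intro coeff_eq_0) simp
        then have "of_nat i * ?c i = coeff (\<Sum>k\<le>?r. monom (of_nat k * ?c k) k) i"
          by (auto simp: coeff_sum)
        moreover have "coeff (pCons 0 (pderiv (lead_poly d))) i = of_nat i * ?c i"
          by (cases i) (simp_all add: coeff_pderiv)
        ultimately show "coeff (pCons 0 (pderiv (lead_poly d))) i
            = coeff (\<Sum>k\<le>?r. monom (of_nat k * ?c k) k) i"
          by simp
      qed
      from arg_cong[OF this, of "\<lambda>q. poly q p"] show ?thesis
        by (simp add: poly_sum poly_monom)
    qed
    finally show ?thesis
      by (simp add: d mult_ac)
  qed
  ultimately show thesis
    using that coeffs by blast
qed

lemma op_order_L_poly:
  assumes "d > 0"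
  shows "op_order (L_poly d) = d"
proof -
  obtain n where d: "d = Suc n"
    using assms by (cases d) auto
  obtain m where m: "\<And>i. coeff (op_coeffs (L_poly d)) i = Fract (m i) 1" "\<And>i. i > d \<Longrightarrow> m i = 0"
    "m d = monom 1 d * lead_poly d"
    using L_poly_coeffs[OF d] by metis
  show ?thesis
    unfolding op_order_def
  proof (rule antisym)
    show "degree (op_coeffs (L_poly d)) \<le> d"
      by (rule degree_le) (simp add: m Zero_fract_def)
    have "coeff (op_coeffs (L_poly d)) d \<noteq> 0"
      by (simp add: m Zero_fract_def eq_fract)
    then show "d \<le> degree (op_coeffs (L_poly d))"
      by (rule le_degree)
  qed
qed

lemma op_z_L_A_eq: "op_z * L_A d = L_poly d"
  by (simp add: op_z_L_A L_poly_def)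

lemma op_order_rf_mult: "a \<noteq> 0 \<Longrightarrow> op_order (op_of_rf a * P) = op_order P"
  by (simp add: op_order_def op_coeffs_rf_mult)

lemma op_order_L_A: "d > 0 \<Longrightarrow> op_order (L_A d) = d"
  using op_order_rf_mult[of rf_var "L_A d"] op_order_L_poly[of d] op_z_L_A_eq[of d]
  by (simp add: op_z_def)

context place
begin

text \<open>
  At the origin and at infinity the local parameter is a power of \<open>z\<close>, so \<open>\<theta>\<close> multiplies \<open>z\<^sup>s\<close> by
  \<open>s\<close> and the indicial polynomials are the \<open>R_A d k\<close> themselves.
\<close>

lemma indicial_L_poly_monomial:
  assumes w: "w = fls_X_intpow e"
  shows "indicial w e N (L_poly d) = (\<Sum>k\<le>(d + 1) div 2. if N = e * int k then R_A d k else 0)"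
proof (rule poly_eq_if_eq_on_nat)
  fix n
  have mono: "fls_const a * fls_X_intpow i * (fls_const b * fls_X_intpow j)
      = fls_const (a * b) * fls_X_intpow (i + j)" for a b :: complex and i j
    by (simp only: fls_X_intpow_times_fls_X_intpow[symmetric] fls_const_mult_const[symmetric] mult_ac)
  have theta: "loc_act w e op_theta (fls_const c * fls_X_intpow (e * int n))
      = fls_const (c * of_nat n) * fls_X_intpow (e * int n)" for c
  proof -
    have "loc_act w e op_D f = loc_deriv e f" for f
      using loc_act_D_mult[of 1 f] by (simp add: loc_act_def one_diffop.rep_eq op_order_def)
    then have "loc_act w e op_theta (fls_const c * fls_X_intpow (e * int n))
        = w * (fls_const (c * of_int (int n)) * fls_X_intpow (e * (int n - 1)))"
      by (simp only: op_theta_def op_z_def loc_act_rf_mult loc_deriv_monomial ev_rf_var)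
    also have "\<dots> = fls_const (c * of_nat n) * fls_X_intpow (e * int n)"
      using mono[of 1 e "c * of_nat n" "e * (int n - 1)"] unfolding w by (simp add: algebra_simps)
    finally show ?thesis .
  qed
  have theta_power: "loc_act w e (op_theta ^ i) (fls_X_intpow (e * int n))
      = fls_const (of_nat n ^ i) * fls_X_intpow (e * int n)" for i
  proof (induction i)
    case 0
    show ?case
      by (simp add: loc_act_def one_diffop.rep_eq op_order_def)
  next
    case (Suc i)
    then show ?case
      using theta[of "of_nat n ^ i"] by (simp add: loc_act_mult mult.commute)
  qed
  have op_poly: "loc_act w e (op_poly q op_theta) (fls_X_intpow (e * int n))
      = fls_const (poly q (of_nat n)) * fls_X_intpow (e * int n)" for q
  proof -
    have "loc_act w e (op_poly q op_theta) (fls_X_intpow (e * int n))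
        = (\<Sum>i\<le>degree q. fls_const (coeff q i) * (fls_const (of_nat n ^ i) * fls_X_intpow (e * int n)))"
      by (simp only: op_poly_def loc_act_sum op_const_def loc_act_rf_mult ev_rf_const theta_power)
    also have "\<dots> = fls_const (poly q (of_nat n)) * fls_X_intpow (e * int n)"
      by (simp only: poly_altdef fls_const_sum sum_distrib_right fls_const_mult_const[symmetric] mult.assoc)
    finally show ?thesis .
  qed
  have z_power: "loc_act w e (op_z ^ k * P) f = fls_X_intpow (e * int k) * loc_act w e P f" for k P f
  proof (induction k)
    case (Suc k)
    have "loc_act w e (op_z ^ Suc k * P) f = w * (fls_X_intpow (e * int k) * loc_act w e P f)"
      using Suc by (simp add: op_z_def loc_act_rf_mult mult.assoc)
    also have "\<dots> = fls_X_intpow (e * int (Suc k)) * loc_act w e P f"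
      by (simp only: w mult.assoc[symmetric] fls_X_intpow_times_fls_X_intpow) (simp add: algebra_simps)
    finally show ?case .
  qed simp
  have "loc_act w e (L_poly d) (fls_X_intpow (e * int n))
      = (\<Sum>k\<le>(d + 1) div 2. fls_const (poly (R_A d k) (of_nat n)) * fls_X_intpow (e * int k + e * int n))"
    unfolding L_poly_def loc_act_sum z_power op_poly
  proof (rule sum.cong)
    fix k
    show "fls_X_intpow (e * int k) * (fls_const (poly (R_A d k) (of_nat n)) * fls_X_intpow (e * int n))
      = fls_const (poly (R_A d k) (of_nat n)) * fls_X_intpow (e * int k + e * int n)"
      using mono[of 1 "e * int k" "poly (R_A d k) (of_nat n)" "e * int n"] by simp
  qed simp
  then have "loc_act w e (L_poly d) (fls_X_intpow (e * int n)) $$ (N + e * int n)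
      = (\<Sum>k\<le>(d + 1) div 2. if N = e * int k then poly (R_A d k) (of_nat n) else 0)"
    by (simp add: fls_nth_sum) (auto intro!: sum.cong simp: algebra_simps)
  then show "poly (indicial w e N (L_poly d)) (of_nat n)
      = poly (\<Sum>k\<le>(d + 1) div 2. if N = e * int k then R_A d k else 0) (of_nat n)"
    using loc_act_monomial_nth[of "L_poly d" 1 "int n" N]
    by (simp add: poly_sum if_distrib[of "\<lambda>q. poly q _"] cong: if_cong)
qed

end

text \<open>
  The polynomial \<open>s\<^sup>d\<close> is written as a product of linear factors to fit \<open>monic_dvd_prod_linear\<close>.
\<close>

lemma indicial_L_poly_at_0:
  assumes "d > 0"
  shows "k < 0 \<Longrightarrow> indicial (coord 0) 1 k (L_poly d) = 0"
    and "indicial (coord 0) 1 0 (L_poly d) = (\<Prod>j<d. [:- 0, 1:])"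
proof -
  have c: "coord 0 = fls_X_intpow 1"
    by (simp add: fls_X_conv_shift_1)
  show "indicial (coord 0) 1 k (L_poly d) = 0" if "k < 0"
    unfolding fin.indicial_L_poly_monomial[OF c] using that by simp
  show "indicial (coord 0) 1 0 (L_poly d) = (\<Prod>j<d. [:- 0, 1:])"
    unfolding fin.indicial_L_poly_monomial[OF c] by (simp add: R_A_def)
qed

lemma indicial_L_poly_at_infinity:
  defines "r d \<equiv> (d + 1) div 2"
  shows "k < - int (r d) \<Longrightarrow> indicial fls_X_inv (- 1) k (L_poly d) = 0"
    and "indicial fls_X_inv (- 1) (- int (r d)) (L_poly d) = R_A d (r d)"
proof -
  have c: "fls_X_inv = fls_X_intpow (- 1)"
    by (simp add: fls_X_inv_conv_shift_1)
  show "indicial fls_X_inv (- 1) k (L_poly d) = 0" if "k < - int (r d)"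
    unfolding inf.indicial_L_poly_monomial[OF c] using that by (auto simp: r_def intro!: sum.neutral)
  show "indicial fls_X_inv (- 1) (- int (r d)) (L_poly d) = R_A d (r d)"
    unfolding inf.indicial_L_poly_monomial[OF c] by (simp add: r_def)
qed

text \<open>
  At a simple root of \<open>Q\<close> the coefficients of \<open>D\<^sup>d\<close> and \<open>D\<^sup>d\<^sup>-\<^sup>1\<close> both enter the indicial polynomial,
  at any other point \<open>p \<noteq> 0\<close> only the first one does.
\<close>

lemma indicial_L_poly_finite:
  assumes d: "d = Suc n" and p: "p \<noteq> 0"
  shows "k < - int d \<Longrightarrow> indicial (coord p) 1 k (L_poly d) = 0"
    and "indicial (coord p) 1 (- int d) (L_poly d) = smult (p ^ d * poly (lead_poly d) p) (falling d)"
    and "poly (lead_poly d) p = 0 \<Longrightarrow> indicial (coord p) 1 (- int n) (L_poly d)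
      = smult (p ^ d * poly (pderiv (lead_poly d)) p) ([:- (of_nat d / 2 - 1), 1:] * falling n)"
proof -
  obtain m where m: "\<And>i. coeff (op_coeffs (L_poly d)) i = Fract (m i) 1"
    "m d = monom 1 d * lead_poly d"
    "\<And>p. poly (lead_poly d) p = 0 \<Longrightarrow> poly (m n) p = of_nat d / 2 * p ^ d * poly (pderiv (lead_poly d)) p"
    using L_poly_coeffs[OF d] by metis
  have ind: "indicial (coord p) 1 k (L_poly d)
      = (\<Sum>i\<le>d. smult (ev_poly (coord p) (m i) $$ (k + int i)) (falling i))" for k
  proof -
    have "op_order (L_poly d) = d"
      using op_order_L_poly[of d] d by simp
    then show ?thesis
      by (simp only: indicial_def m(1) fin.ev_rf_poly) simp
  qed
  show "indicial (coord p) 1 k (L_poly d) = 0" if "k < - int d"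
    unfolding ind using that by (intro sum.neutral) (auto simp: ev_poly_finite_below)
  show "indicial (coord p) 1 (- int d) (L_poly d) = smult (p ^ d * poly (lead_poly d) p) (falling d)"
  proof -
    have "indicial (coord p) 1 (- int d) (L_poly d)
        = (\<Sum>i\<le>d. if i = d then smult (poly (m d) p) (falling d) else 0)"
      unfolding ind by (rule sum.cong) (auto simp: ev_poly_finite_below ev_poly_finite_0)
    then show ?thesis
      by (simp add: m(2) poly_monom)
  qed
  show "indicial (coord p) 1 (- int n) (L_poly d)
      = smult (p ^ d * poly (pderiv (lead_poly d)) p) ([:- (of_nat d / 2 - 1), 1:] * falling n)"
    if root: "poly (lead_poly d) p = 0"
  proof -
    define \<kappa> where "\<kappa> = p ^ d * poly (pderiv (lead_poly d)) p"
    have "indicial (coord p) 1 (- int n) (L_poly d)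
        = (\<Sum>i<n. smult (ev_poly (coord p) (m i) $$ (- int n + int i)) (falling i))
          + smult (poly (m n) p) (falling n) + smult (poly (pderiv (m d)) p) (falling d)"
      unfolding ind unfolding d by (simp add: ev_poly_finite_0 ev_poly_finite_1 flip: lessThan_Suc_atMost)
    also have "(\<Sum>i<n. smult (ev_poly (coord p) (m i) $$ (- int n + int i)) (falling i)) = 0"
      by (rule sum.neutral) (auto simp: ev_poly_finite_below)
    also have "poly (pderiv (m d)) p = \<kappa>"
      using root by (simp add: m(2) pderiv_mult poly_monom \<kappa>_def)
    also have "poly (m n) p = of_nat d / 2 * \<kappa>"
      using m(3)[OF root] by (simp add: \<kappa>_def)
    also have "smult \<kappa> (falling d) = smult \<kappa> (falling n * [:- of_nat n, 1:])"
      by (simp only: d falling_Suc)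
    finally have "indicial (coord p) 1 (- int n) (L_poly d)
        = smult (of_nat d / 2 * \<kappa>) (falling n) + smult \<kappa> (falling n * [:- of_nat n, 1:])"
      by simp
    also have "smult (of_nat d / 2 * \<kappa>) (falling n) = smult \<kappa> (falling n * [:of_nat d / 2:])"
      by (simp add: mult.commute)
    also have "smult \<kappa> (falling n * [:of_nat d / 2:]) + smult \<kappa> (falling n * [:- of_nat n, 1:])
        = smult \<kappa> (falling n * ([:of_nat d / 2:] + [:- of_nat n, 1:]))"
      by (simp only: smult_add_right distrib_left)
    also have "[:of_nat d / 2:] + [:- of_nat n, 1:] = [:- (of_nat d / 2 - 1), 1 :: complex:]"
      by (simp add: d field_simps)
    finally show ?thesis
      by (simp only: \<kappa>_def mult.commute[of "falling n"])
  qed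
qed

section \<open>Irreducibility\<close>

lemma lmult_D_pow_coeff:
  "coeff ((lmult_D ^^ i) q) (degree q + i) = lead_coeff q"
  "degree q + i < j \<Longrightarrow> coeff ((lmult_D ^^ i) q) j = 0"
proof (induction i arbitrary: j)
  case (Suc i)
  { case 1
    show ?case
      using Suc.IH(1) Suc.IH(2)[of "Suc (degree q + i)"] by (simp add: lmult_D_def coeff_map_poly)
  next
    case 2
    then obtain k where "j = Suc k"
      by (cases j) auto
    with 2 show ?case
      using Suc.IH(2)[of k] Suc.IH(2)[of j] by (simp add: lmult_D_def coeff_map_poly) }
qed (simp_all add: coeff_eq_0)

lemma op_order_mult:
  assumes "A \<noteq> 0" "B \<noteq> 0"
  shows "op_order (A * B) = op_order A + op_order B"
proof -
  define p q where "p = op_coeffs A" and "q = op_coeffs B"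
  have pq: "p \<noteq> 0" "q \<noteq> 0"
    using assms by (metis op_coeffs_inject zero_diffop.rep_eq p_def, metis op_coeffs_inject zero_diffop.rep_eq q_def)
  have "coeff (ore_mult p q) (degree p + degree q)
      = (\<Sum>i\<le>degree p. if i = degree p then lead_coeff p * lead_coeff q else 0)"
    unfolding ore_mult_def coeff_sum
  proof (rule sum.cong)
    fix i assume "i \<in> {..degree p}"
    then show "coeff (smult (coeff p i) ((lmult_D ^^ i) q)) (degree p + degree q)
        = (if i = degree p then lead_coeff p * lead_coeff q else 0)"
      using lmult_D_pow_coeff[where i = i and q = q] by (auto simp: add.commute)
  qed simp
  then have "coeff (ore_mult p q) (degree p + degree q) \<noteq> 0"
    using pq by simp
  moreover have "coeff (ore_mult p q) j = 0" if "degree p + degree q < j" for j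
    unfolding ore_mult_def coeff_sum
    by (rule sum.neutral) (use that lmult_D_pow_coeff(2)[where q = q and j = j] in auto)
  ultimately have "degree (ore_mult p q) = degree p + degree q"
    by (intro antisym degree_le le_degree) auto
  then show ?thesis
    by (simp add: op_order_def times_diffop.rep_eq p_def q_def)
qed

lemma root_sum_monic_dvd_falling:
  assumes "lead_coeff q = 1" "q dvd falling n"
  shows "real (degree q) * (real (degree q) - 1) / 2 \<le> Re (root_sum q)"
proof -
  obtain J where "J \<subseteq> {..<n}" and q: "q = (\<Prod>j\<in>J. [:- of_nat j, 1:])"
    using monic_dvd_prod_linear[OF finite_lessThan assms(1) assms(2)[unfolded falling_def]] by blast
  then have "finite J"
    by (auto intro: finite_subset)
  from sum_distinct_nat_ge[OF this] show ?thesis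
    unfolding q root_sum_prod_linear degree_prod_linear by simp
qed

lemma degree_R_A_top:
  assumes "d > 0"
  shows "degree (R_A d ((d + 1) div 2)) = d"
proof -
  let ?r = "(d + 1) div 2"
  have "coeff (R_A d ?r) d = coeff (lead_poly d) ?r"
    using top_terms_R_A[of ?r d] assms by (simp add: top_terms_def)
  also have "\<dots> \<noteq> 0"
    by (simp add: coeff_lead_poly coeff_symbol_nonzero)
  finally have "d \<le> degree (R_A d ?r)"
    by (rule le_degree)
  moreover have "degree (R_A d ?r) \<le> d"
    using top_terms_R_A[of ?r d] assms by (simp add: top_terms_def)
  ultimately show ?thesis by simp
qed

text \<open>
  The second bound comes from the complementary factor: its \<open>d - degree q\<close> roots exceed \<open>-r\<close>, and
  all roots together have sum \<open>-d r / 2\<close>.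
\<close>

lemma root_sum_factor_R_A_top:
  assumes d: "d > 0" and q: "lead_coeff q = 1" "q dvd R_A d ((d + 1) div 2)" "0 < degree q" "degree q < d"
  defines "r \<equiv> real ((d + 1) div 2)"
  shows "Re (root_sum q) < 0" "Re (root_sum q) < r * (real d / 2 - real (degree q))"
proof -
  define R where "R = R_A d ((d + 1) div 2)"
  obtain n where n: "d = Suc n"
    using d by (cases d) auto
  have roots: "- r < Re z \<and> Re z < 0" if "poly R z = 0" for z
    using roots_R_A_top[OF d refl] that by (simp add: R_def r_def)
  obtain s where s: "R = q * s"
    using q(2) by (auto simp: R_def)
  have "R \<noteq> 0"
    using degree_R_A_top[OF d] d by (auto simp: R_def)
  then have "s \<noteq> 0" "q \<noteq> 0"
    using s by auto
  define s' where "s' = smult (inverse (lead_coeff s)) s"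
  have s': "lead_coeff s' = 1" "s' \<noteq> 0" "degree s' = degree s"
    using \<open>s \<noteq> 0\<close> by (simp_all add: s'_def)
  have R: "R = smult (lead_coeff s) (q * s')"
    using \<open>s \<noteq> 0\<close> by (simp add: s s'_def)
  have deg: "degree q + degree s = d"
    using degree_R_A_top[OF d, folded R_def] \<open>s \<noteq> 0\<close> \<open>q \<noteq> 0\<close> by (simp add: s degree_mult_eq)
  have "degree (q * s') = Suc n"
    using deg s' \<open>q \<noteq> 0\<close> n by (simp add: degree_mult_eq)
  moreover have "lead_coeff (q * s') = 1"
    unfolding lead_coeff_mult using q(1) s'(1) by simp
  moreover have "coeff R n = coeff R d * (of_nat d * of_nat ((d + 1) div 2) / 2)"
    using top_terms_R_A[of "(d + 1) div 2" d] n by (simp add: top_terms_def R_def)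
  ultimately have "root_sum (q * s') = - (of_nat d * of_nat ((d + 1) div 2) / 2)"
    using \<open>s \<noteq> 0\<close> n by (simp add: root_sum_eq R)
  then have "root_sum q + root_sum s' = - of_real (real d * r / 2)"
    using q(1) s'(1) by (simp add: root_sum_mult r_def)
  then have sum: "Re (root_sum q) + Re (root_sum s') = - (real d * r / 2)"
    by (metis Re_complex_of_real plus_complex.sel(1) uminus_complex.sel(1))
  show "Re (root_sum q) < 0"
    using root_sum_bounds(2)[OF q(1,3), of "- r" 0] roots s by simp
  have "real (degree s') * - r < Re (root_sum s')"
  proof (rule root_sum_bounds(1)[where u = 0])
    show "- r < Re z \<and> Re z < 0" if "poly s' z = 0" for z
      by (rule roots, subst R) (use that in simp)
  qed (use s' deg q(4) in auto)
  moreover have "real (degree s') = real d - real (degree q)"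
    using s'(3) deg by linarith
  ultimately show "Re (root_sum q) < r * (real d / 2 - real (degree q))"
    using sum by (simp add: algebra_simps)
qed

text \<open>
  The residue is \<open>b (b - 1) / 2\<close> minus the sum of the chosen exponents. If the exponents are
  distinct natural numbers it is at most \<open>0\<close>. At a root of \<open>Q\<close> the exponent \<open>d/2 - 1\<close> may be among
  them; with the other \<open>b - 1\<close> exponents as small as possible it leads to the bound \<open>b - d/2\<close>.
\<close>

lemma subleading_coeff_finite:
  assumes M: "L_poly d = A * B" and order: "op_order A + b = d" "op_order B = b"
    and monic: "coeff (op_coeffs B) b = 1" and b: "b = Suc b'"
  defines "f \<equiv> coeff (op_coeffs B) b'"
  shows "k < - 1 \<Longrightarrow> ev_rf (coord p) f $$ k = 0"
    and "ev_rf (coord 0) f $$ (- 1) = of_real (real b * (real b - 1) / 2)"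
    and "p \<noteq> 0 \<Longrightarrow> poly (lead_poly d) p \<noteq> 0 \<Longrightarrow> Re (ev_rf (coord p) f $$ (- 1)) \<le> 0"
    and "poly (lead_poly d) p = 0 \<Longrightarrow> Re (ev_rf (coord p) f $$ (- 1)) \<le> max 0 (real b - real d / 2)"
proof -
  obtain n where d: "d = Suc n"
    using order(1) b by (cases d) auto
  have d0: "d > 0"
    using d by simp
  have order': "op_order A + b = op_order (L_poly d)"
    by (simp add: order op_order_L_poly d0)
  define q where "q p = indicial (coord p) 1 (- (1 * int b)) B" for p
  have tri: "of_nat b * (of_nat b - 1) / 2 = (of_real (real b * (real b - 1) / 2) :: complex)"
    by simp
  have factor: "q p dvd indicial (coord p) 1 N (L_poly d) \<and> degree (q p) = b \<and> lead_coeff (q p) = 1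
      \<and> ev_rf (coord p) f $$ (- 1) = of_real (real b * (real b - 1) / 2) - root_sum (q p)
      \<and> (\<forall>k < - 1. ev_rf (coord p) f $$ k = 0)"
    if "\<forall>k<N. indicial (coord p) 1 k (L_poly d) = 0"
      "indicial (coord p) 1 N (L_poly d) \<noteq> 0" "degree (indicial (coord p) 1 N (L_poly d)) = d" for p N
  proof -
    have "degree (indicial (coord p) 1 N (L_poly d)) = op_order (L_poly d)"
      using that(3) by (simp only: op_order_L_poly[OF d0])
    note facts = fin.monic_right_factor[OF M order' order(2) monic that(1,2) this, folded q_def]
    show ?thesis
      using facts(1-3) facts(4)[OF b] facts(5)[OF b] by (simp only: f_def tri) blast
  qed
  have at0: "q 0 dvd (\<Prod>j<d. [:- 0, 1:])" "lead_coeff (q 0) = 1"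
      "ev_rf (coord 0) f $$ (- 1) = of_real (real b * (real b - 1) / 2) - root_sum (q 0)"
      "\<forall>k < - 1. ev_rf (coord 0) f $$ k = 0"
  proof -
    have deg: "degree (\<Prod>j<d. [:- 0, 1 :: complex:]) = d" "(\<Prod>j<d. [:- 0, 1 :: complex:]) \<noteq> 0"
      using degree_prod_linear[of "\<lambda>_. 0" "{..<d}"] by (simp_all only: card_lessThan) simp
    show "q 0 dvd (\<Prod>j<d. [:- 0, 1:])" "lead_coeff (q 0) = 1"
      "ev_rf (coord 0) f $$ (- 1) = of_real (real b * (real b - 1) / 2) - root_sum (q 0)"
      "\<forall>k < - 1. ev_rf (coord 0) f $$ k = 0"
      using factor[of 0 0] indicial_L_poly_at_0[OF d0] deg by metis+
  qed
  have ordinary: "q p dvd falling d \<and> degree (q p) = b \<and> lead_coeff (q p) = 1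
      \<and> ev_rf (coord p) f $$ (- 1) = of_real (real b * (real b - 1) / 2) - root_sum (q p)
      \<and> (\<forall>k < - 1. ev_rf (coord p) f $$ k = 0)"
    if p: "p \<noteq> 0" "poly (lead_poly d) p \<noteq> 0" for p
    using factor[of "- int d" p] indicial_L_poly_finite(1,2)[OF d p(1)] p by (auto simp: dvd_smult_iff)
  have singular: "q p dvd [:- (of_nat d / 2 - 1), 1:] * falling n \<and> degree (q p) = b \<and> lead_coeff (q p) = 1
      \<and> ev_rf (coord p) f $$ (- 1) = of_real (real b * (real b - 1) / 2) - root_sum (q p)
      \<and> (\<forall>k < - 1. ev_rf (coord p) f $$ k = 0)"
    if p: "poly (lead_poly d) p = 0" for p
  proof -
    have p0: "p \<noteq> 0"
      using p poly_lead_poly_0[of d] by auto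
    define \<kappa> where "\<kappa> = p ^ d * poly (pderiv (lead_poly d)) p"
    have \<kappa>: "\<kappa> \<noteq> 0"
      using p0 simple_root_lead_poly[OF p] by (simp add: \<kappa>_def)
    define E where "E = [:- (of_nat d / 2 - 1), 1 :: complex:] * falling n"
    have E: "E \<noteq> 0" "degree E = d"
      unfolding E_def by (simp_all only: mult_eq_0_iff degree_mult_eq) (simp_all add: degree_mult_eq d del: mult_pCons_left)
    have ind: "indicial (coord p) 1 (- int n) (L_poly d) = smult \<kappa> E"
      using indicial_L_poly_finite(3)[OF d p0 p] by (simp only: \<kappa>_def E_def)
    have "\<forall>k < - int n. indicial (coord p) 1 k (L_poly d) = 0"
    proof (intro allI impI)
      fix k assume k: "k < - int n"
      show "indicial (coord p) 1 k (L_poly d) = 0"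
      proof (cases "k = - int d")
        case True
        then show ?thesis
          using indicial_L_poly_finite(2)[OF d p0] p by simp
      next
        case False
        then have "k < - int d"
          using k d by simp
        then show ?thesis
          by (rule indicial_L_poly_finite(1)[OF d p0])
      qed
    qed
    from factor[OF this] show ?thesis
      unfolding ind E_def[symmetric] using \<kappa> E by (auto simp: dvd_smult_iff)
  qed
  show "ev_rf (coord p) f $$ k = 0" if "k < - 1"
  proof (cases "poly (lead_poly d) p = 0")
    case True
    with singular that show ?thesis by blast
  next
    case False
    with ordinary at0(4) that show ?thesis
      by (cases "p = 0") blast+
  qed
  show "ev_rf (coord 0) f $$ (- 1) = of_real (real b * (real b - 1) / 2)"
  proof -
    obtain J :: "nat set" where "q 0 = (\<Prod>j\<in>J. [:- 0, 1:])"
      by (rule monic_dvd_prod_linear[where c = "\<lambda>_. 0", OF finite_lessThan at0(2,1)]) blast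
    then have "root_sum (q 0) = 0"
      by (simp only: root_sum_prod_linear sum.neutral_const)
    with at0(3) show ?thesis by simp
  qed
  show "Re (ev_rf (coord p) f $$ (- 1)) \<le> 0" if "p \<noteq> 0" "poly (lead_poly d) p \<noteq> 0"
    using ordinary[OF that] root_sum_monic_dvd_falling[of "q p" d] by auto
  show "Re (ev_rf (coord p) f $$ (- 1)) \<le> max 0 (real b - real d / 2)" if p: "poly (lead_poly d) p = 0"
  proof -
    have q: "degree (q p) = b" "lead_coeff (q p) = 1"
      and res: "Re (ev_rf (coord p) f $$ (- 1)) = real b * (real b - 1) / 2 - Re (root_sum (q p))"
      using singular[OF p] by auto
    from singular[OF p] have "q p dvd [:- (of_nat d / 2 - 1), 1:] * falling n"
      by blast
    then show ?thesis
    proof (cases rule: dvd_linear_mult_cases)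
      case 1
      then show ?thesis
        using root_sum_monic_dvd_falling[OF q(2) 1] q(1) res by simp
    next
      case (2 q')
      have q': "lead_coeff q' = 1"
        using q(2) unfolding 2(1) lead_coeff_mult by simp
      then have "q' \<noteq> 0"
        by auto
      then have deg: "degree q' = b'"
        using q(1) b unfolding 2(1) by (subst (asm) degree_mult_eq) auto
      have "root_sum (q p) = (of_nat d / 2 - 1) + root_sum q'"
        unfolding 2(1) using q' by (subst root_sum_mult) (simp_all only: root_sum_linear, simp)
      then have "Re (root_sum (q p)) \<ge> real d / 2 - 1 + real b' * (real b' - 1) / 2"
        using root_sum_monic_dvd_falling[OF q' 2(2)] deg by simp
      then have "Re (ev_rf (coord p) f $$ (- 1)) \<le> real b - real d / 2"
        unfolding res by (simp add: b algebra_simps add_divide_distrib diff_divide_distrib)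
      then show ?thesis by simp
    qed
  qed
qed

text \<open>
  The relation of Fuchs, with the bounds on the exponents inserted.
\<close>

lemma no_monic_right_factor:
  assumes M: "L_poly d = A * B" and order: "op_order A + b = d" "op_order B = b"
    and monic: "coeff (op_coeffs B) b = 1" and b: "0 < b" "b < d"
  shows False
proof -
  obtain b' where b': "b = Suc b'"
    using b by (cases b) auto
  have d: "d > 0"
    using b by simp
  define f where "f = coeff (op_coeffs B) b'"
  define r where "r = (d + 1) div 2"
  define q where "q = indicial fls_X_inv (- 1) (- (- 1 * int b)) B"
  note fin_facts = subleading_coeff_finite[OF M order monic b', folded f_def]
  have order': "op_order A + b = op_order (L_poly d)"
    by (simp add: order op_order_L_poly d)
  have R: "degree (R_A d r) = d" "R_A d r \<noteq> 0"
    using degree_R_A_top[OF d] d by (auto simp: r_def)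
  note ind = indicial_L_poly_at_infinity[where d = d, folded r_def]
  have nz: "indicial fls_X_inv (- 1) (- int r) (L_poly d) \<noteq> 0"
    "degree (indicial fls_X_inv (- 1) (- int r) (L_poly d)) = op_order (L_poly d)"
    using ind(2) R op_order_L_poly[OF d] by simp_all
  have below: "\<forall>k < - int r. indicial fls_X_inv (- 1) k (L_poly d) = 0"
    using ind(1) by blast
  note inf_facts = inf.monic_right_factor[OF M order' order(2) monic below nz, folded q_def]
  have q: "q dvd R_A d r" "degree q = b" "lead_coeff q = 1"
    using inf_facts(1-3) ind(2) by simp_all
  have res_inf: "ev_rf fls_X_inv f $$ 1 = of_nat b * (of_nat b - 1) / 2 - root_sum q"
    using inf_facts(4)[OF b'] by (simp add: f_def)
  have low_inf: "ev_rf fls_X_inv f $$ k = 0" if "k < 1" for k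
    using inf_facts(5)[OF b', of k] that by (simp add: f_def)
  \<comment> \<open>All poles of \<open>f\<close> lie in \<open>W\<close>; those outside of \<open>0\<close> and \<open>Z\<close> are apparent singularities.\<close>
  define Z where "Z = {z. poly (lead_poly d) z = 0}"
  define W where "W = {z. poly (snd (quot_of_fract f)) z = 0}"
  define \<rho> where "\<rho> p = Re (ev_rf (coord p) f $$ (- 1))" for p
  have fin: "finite Z" "finite W"
    by (simp_all add: Z_def W_def poly_roots_finite)
  have "0 \<notin> Z"
    by (simp add: Z_def poly_lead_poly_0)
  have "(\<Sum>p\<in>insert 0 (Z \<union> W). ev_rf (coord p) f $$ (- 1)) = ev_rf fls_X_inv f $$ 1"
  proof (rule sum_of_residues)
    fix p assume "p \<notin> insert 0 (Z \<union> W)"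
    then have "ev_rf (coord p) (Fract (fst (quot_of_fract f)) (snd (quot_of_fract f))) $$ (- 1) = 0"
      by (intro regular_outside_denominator) (auto simp: W_def)
    then show "ev_rf (coord p) f $$ (- 1) = 0"
      by (simp only: Fract_quot_of_fract)
  qed (use fin fin_facts(1) low_inf in auto)
  from arg_cong[OF this, of Re]
  have "(\<Sum>p\<in>insert 0 (Z \<union> W). \<rho> p) = real b * (real b - 1) / 2 - Re (root_sum q)"
    by (simp only: \<rho>_def Re_sum res_inf) simp
  moreover have "(\<Sum>p\<in>insert 0 (Z \<union> W). \<rho> p) = \<rho> 0 + (\<Sum>p\<in>Z. \<rho> p) + (\<Sum>p\<in>W - Z - {0}. \<rho> p)"
  proof -
    have "insert 0 (Z \<union> W) = insert 0 (Z \<union> (W - Z - {0}))"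
      by auto
    moreover have "(\<Sum>p\<in>Z \<union> (W - Z - {0}). \<rho> p) = (\<Sum>p\<in>Z. \<rho> p) + (\<Sum>p\<in>W - Z - {0}. \<rho> p)"
      by (rule sum.union_disjoint) (use fin in auto)
    ultimately show ?thesis
      using fin \<open>0 \<notin> Z\<close> by simp
  qed
  moreover have "\<rho> 0 = real b * (real b - 1) / 2"
    by (simp only: \<rho>_def fin_facts(2) Re_complex_of_real)
  moreover have "(\<Sum>p\<in>W - Z - {0}. \<rho> p) \<le> 0"
    by (rule sum_nonpos) (use fin_facts(3) in \<open>auto simp: \<rho>_def Z_def\<close>)
  moreover have "(\<Sum>p\<in>Z. \<rho> p) \<le> real r * max 0 (real b - real d / 2)"
  proof -
    have "(\<Sum>p\<in>Z. \<rho> p) \<le> real (card Z) * max 0 (real b - real d / 2)"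
      by (rule sum_bounded_above) (use fin_facts(4) in \<open>simp add: \<rho>_def Z_def\<close>)
    also have "\<dots> \<le> real r * max 0 (real b - real d / 2)"
      using card_roots_lead_poly_le[of d] by (intro mult_right_mono) (simp_all add: Z_def r_def)
    finally show ?thesis .
  qed
  ultimately have "- Re (root_sum q) \<le> real r * max 0 (real b - real d / 2)"
    by linarith
  moreover have "Re (root_sum q) < 0" "Re (root_sum q) < real r * (real d / 2 - real b)"
    using root_sum_factor_R_A_top[OF d q(3)] q(1,2) b by (simp_all add: r_def)
  ultimately show False
    by (cases "real b \<le> real d / 2") (simp_all add: max_def algebra_simps split: if_splits)
qed

lemma L_A_irreducible:
  assumes "d > 0" "op_order A \<ge> 1" "op_order B \<ge> 1"
  shows "L_A d \<noteq> A * B"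
proof
  assume L: "L_A d = A * B"
  define c where "c = lead_coeff (op_coeffs B)"
  have nz: "A \<noteq> 0" "B \<noteq> 0"
    using assms(2,3) by (auto simp: op_order_def zero_diffop.rep_eq)
  then have c: "c \<noteq> 0"
    unfolding c_def by (metis leading_coeff_0_iff op_coeffs_inject zero_diffop.rep_eq)
  define B' where "B' = op_of_rf (inverse c) * B"
  define A' where "A' = op_z * A * op_of_rf c"
  have "op_of_rf c * B' = op_of_rf (c * inverse c) * B"
    by (simp only: B'_def op_of_rf_mult mult.assoc)
  then have "op_of_rf c * B' = B"
    using c by simp
  then have M: "L_poly d = A' * B'"
    by (simp add: A'_def mult.assoc L flip: op_z_L_A_eq)
  have B': "op_order B' = op_order B" "coeff (op_coeffs B') (op_order B) = 1"
    using c by (simp_all add: B'_def op_order_rf_mult op_coeffs_rf_mult op_order_def c_def)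
  have "L_poly d \<noteq> 0"
    using op_order_L_poly[OF assms(1)] assms(1) by (auto simp: op_order_def zero_diffop.rep_eq)
  then have "A' \<noteq> 0" "B' \<noteq> 0"
    using M by auto
  then have order: "op_order A' + op_order B = d"
    using op_order_mult[of A' B'] op_order_L_poly[OF assms(1)] by (simp flip: M B'(1))
  have "op_order A + op_order B = d"
    using op_order_mult[OF nz] op_order_L_A[OF assms(1)] L by simp
  then show False
    using no_monic_right_factor[OF M order B'] assms by simp
qed

section \<open>Annihilation of the generating function\<close>

text \<open>
  The modified Bessel function \<open>I\<^sub>0\<close>, in the variable \<open>t\<close> for which \<open>bessel = I\<^sub>0 (2 \<surd>t)\<close>.
\<close>

definition bessel :: "complex fls" where
  "bessel = fps_to_fls (Abs_fps (\<lambda>n. 1 / (fact n)\<^sup>2))"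

definition euler :: "complex fls \<Rightarrow> complex fls" where
  "euler f = fls_X * fls_deriv f"

lemma euler_nth: "euler f $$ n = of_int n * f $$ n"
  by (simp add: euler_def fls_X_times_conv_shift)

lemma op_apply_theta_mult: "op_apply (op_theta * P) f = euler (op_apply P f)"
  by (simp add: op_theta_def mult.assoc op_apply_z op_apply_D_mult euler_def)

lemma euler_mult: "euler (f * g) = f * euler g + euler f * g"
  by (simp add: euler_def algebra_simps)

lemma euler_const_mult: "euler (fls_const c * f) = fls_const c * euler f"
  by (simp add: euler_def algebra_simps)

lemma euler_power_Suc: "euler (f ^ Suc n) = of_nat (Suc n) * f ^ n * euler f"
proof (induction n)
  case (Suc n)
  have "euler (f ^ Suc (Suc n)) = f * euler (f ^ Suc n) + euler f * f ^ Suc n"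
    by (simp only: power_Suc[of f "Suc n"] euler_mult)
  then show ?case
    unfolding Suc by (simp add: algebra_simps)
qed simp

lemma bessel_equation: "euler (euler bessel) = fls_X * bessel"
proof (rule fls_eqI)
  fix n :: int
  show "euler (euler bessel) $$ n = (fls_X * bessel) $$ n"
  proof (cases "n \<le> 0")
    case True
    then show ?thesis
      by (auto simp: euler_nth fls_X_times_conv_shift bessel_def)
  next
    case False
    then obtain k where n: "n = int (Suc k)"
      by (metis Suc_pred nat_0_le not_le zero_less_nat_eq less_imp_le)
    have "of_nat (Suc k) * (of_nat (Suc k) * (1 / (fact (Suc k))\<^sup>2)) = 1 / ((fact k)\<^sup>2 :: complex)"
      unfolding fact_Suc power_mult_distrib of_nat_mult of_nat_fact
      by (simp add: power2_eq_square del: of_nat_Suc)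
    moreover have "euler (euler bessel) $$ n = of_nat (Suc k) * (of_nat (Suc k) * (1 / (fact (Suc k))\<^sup>2))"
      by (simp add: n euler_nth bessel_def del: of_nat_Suc fact_Suc)
    moreover have "(fls_X * bessel) $$ n = 1 / (fact k)\<^sup>2"
      by (simp add: n fls_X_times_conv_shift bessel_def)
    ultimately show ?thesis
      by (simp only:)
  qed
qed

text \<open>
  Applying \<open>\<theta>\<close> to the right-hand side for \<open>k\<close> gives the one for \<open>k + 1\<close> and, since \<open>\<theta>\<^sup>2 y = t y\<close>, a
  multiple of the one for \<open>k - 1\<close>, which the recursion of \<^const>\<open>P_op\<close> subtracts. In the range
  considered, \<open>d - k\<close> truncates only for \<open>k = d + 1\<close>, where the product is \<open>0\<close>.
\<close>

lemma op_apply_P_op_bessel: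
  "k \<le> d + 1 \<Longrightarrow> op_apply (P_op d k) (bessel ^ d)
    = fls_const (\<Prod>j<k. of_nat d - of_nat j) * (bessel ^ (d - k) * euler bessel ^ k)"
proof (induction k rule: induct_nat_012)
  case 1
  show ?case
  proof (cases d)
    case 0
    then show ?thesis
      using op_apply_theta_mult[of 1 "bessel ^ d"] by (simp add: euler_def)
  next
    case (Suc n)
    then show ?thesis
      using op_apply_theta_mult[of 1 "bessel ^ d"]
      by (simp del: power_Suc add: euler_power_Suc fls_of_nat mult.assoc)
  qed
next
  case (ge2 k)
  define c :: complex where "c = (\<Prod>j<k. of_nat d - of_nat j)"
  define u v where "u = bessel" and "v = euler bessel"
  obtain m where m: "d = Suc k + m"
    using ge2.prems by (metis Suc_eq_plus1 Suc_le_mono le_Suc_ex)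
  have c1: "(\<Prod>j<Suc k. of_nat d - of_nat j) = c * of_nat (Suc m)"
    by (simp add: c_def m)
  have c2: "(\<Prod>j<Suc (Suc k). of_nat d - of_nat j) = c * of_nat (Suc m) * of_nat m"
    by (simp add: c_def m)
  have IH1: "op_apply (P_op d k) (bessel ^ d) = fls_const c * (u ^ Suc m * v ^ k)"
    using ge2 by (simp add: c_def u_def v_def m del: power_Suc)
  have IH2: "op_apply (P_op d (Suc k)) (bessel ^ d) = fls_const (c * of_nat (Suc m)) * (u ^ m * v ^ Suc k)"
  proof -
    have "Suc k \<le> d + 1" "d - Suc k = m"
      using m by simp_all
    then show ?thesis
      unfolding u_def v_def using ge2.IH(2)[unfolded c1] by simp
  qed
  have um: "euler (u ^ m) = of_nat m * u ^ (m - 1) * v"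
    by (cases m) (simp add: euler_def, simp only: euler_power_Suc u_def v_def diff_Suc_1)
  have vk: "euler (v ^ Suc k) = of_nat (Suc k) * v ^ k * (fls_X * u)"
    by (simp only: euler_power_Suc) (simp only: v_def u_def bessel_equation)
  have "of_nat (Suc k) * (of_nat d - of_nat k) * op_z * P_op d k
      = op_const (of_nat (Suc k) * of_nat (Suc m)) * (op_z * P_op d k)"
  proof -
    have "of_nat d - of_nat k = (of_nat (Suc m) :: diffop)"
      by (simp add: m)
    then show ?thesis
      by (simp only: op_const_mult of_nat_op_const mult.assoc)
  qed
  then have "op_apply (P_op d (Suc (Suc k))) (bessel ^ d)
      = euler (fls_const (c * of_nat (Suc m)) * (u ^ m * v ^ Suc k))
        - fls_const (of_nat (Suc k) * of_nat (Suc m)) * (fls_X * (fls_const c * (u ^ Suc m * v ^ k)))"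
    using op_apply_add[of "P_op d (Suc (Suc k))" "op_const (of_nat (Suc k) * of_nat (Suc m)) * (op_z * P_op d k)" "bessel ^ d"]
      op_apply_theta_mult[of "P_op d (Suc k)" "bessel ^ d"]
    by (simp only: P_op.simps diff_add_cancel op_apply_const op_apply_z IH1 IH2) (simp only: eq_diff_eq)
  also have "\<dots> = fls_const (c * of_nat (Suc m)) * (of_nat m * (u ^ (m - 1) * v ^ Suc (Suc k)))
      + (fls_const (c * of_nat (Suc m)) * of_nat (Suc k) * (fls_X * (u ^ m * u * v ^ k))
        - fls_const (of_nat (Suc k) * of_nat (Suc m)) * (fls_X * (fls_const c * (u ^ Suc m * v ^ k))))"
    unfolding euler_const_mult unfolding euler_mult um vk by (simp add: algebra_simps del: of_nat_Suc)
  also have "fls_const (c * of_nat (Suc m)) * of_nat (Suc k) * (fls_X * (u ^ m * u * v ^ k))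
      - fls_const (of_nat (Suc k) * of_nat (Suc m)) * (fls_X * (fls_const c * (u ^ Suc m * v ^ k))) = 0"
    by (simp only: fls_const_mult_const[symmetric] fls_of_nat power_Suc mult_ac) simp
  finally show ?case
    unfolding c2 by (simp add: m u_def v_def fls_of_nat mult.assoc flip: fls_const_mult_const del: of_nat_Suc)
qed simp

lemma op_apply_op_poly_theta_nth:
  "op_apply (op_poly q op_theta) f $$ n = poly q (of_int n) * f $$ n"
proof -
  have "op_apply (op_theta ^ i) f $$ n = of_int n ^ i * f $$ n" for i
    by (induction i) (simp_all add: op_apply_theta_mult euler_nth)
  then show ?thesis
    by (simp add: op_poly_def op_apply_sum op_apply_const fls_nth_sum poly_altdef sum_distrib_right mult.assoc)
qed

lemma op_apply_theta_form_nth: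
  "op_apply (\<Sum>k\<le>r. op_z ^ k * op_poly (R k) op_theta) f $$ n
    = (\<Sum>k\<le>r. poly (R k) (of_int (n - int k)) * f $$ (n - int k))"
  by (simp add: op_apply_sum op_apply_z_power fls_nth_sum fls_X_power_times_conv_shift
      op_apply_op_poly_theta_nth)

lemma bessel_power_recurrence:
  "(\<Sum>k\<le>(d + 1) div 2. poly (R_B d k) (of_int (n - int k)) * (bessel ^ d) $$ (n - int k)) = 0"
proof -
  have "op_apply (P_op d (d + 1)) (bessel ^ d) = 0"
    by (subst op_apply_P_op_bessel) (auto intro!: prod_zero)
  then have "op_apply (\<Sum>k\<le>(d + 1) div 2. op_z ^ k * op_poly (R_B d k) op_theta) (bessel ^ d) $$ n = 0"
    by (simp only: R_B(1)[symmetric] fls_zero_nth)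
  then show ?thesis
    by (simp only: op_apply_theta_form_nth)
qed

lemma A_num_eq: "A_num d n = fact (2 * n) * (bessel ^ d) $$ int n"
proof -
  have "(bessel ^ d) $$ int n = ((Abs_fps (\<lambda>n. 1 / (fact n)\<^sup>2)) ^ d :: complex fps) $ n"
    by (simp add: bessel_def flip: fps_to_fls_power)
  also have "\<dots> = (\<Sum>v\<in>natpermute n d. \<Prod>j<d. 1 / (fact (v ! j))\<^sup>2)"
    by (cases d) (simp_all add: fps_power_nth natpermute_0 lessThan_Suc_atMost atLeast0AtMost del: power_Suc)
  also have "\<dots> = (\<Sum>v\<in>natpermute n d. 1 / prod_list (map (\<lambda>m. (fact m)\<^sup>2) v))"
  proof (rule sum.cong)
    fix v assume "v \<in> natpermute n d"
    then have "length v = d"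
      by (simp add: natpermute_def)
    then show "(\<Prod>j<d. 1 / (fact (v ! j))\<^sup>2) = 1 / prod_list (map (\<lambda>m. (fact m)\<^sup>2 :: complex) v)"
      by (simp add: prod.list_conv_set_nth atLeast0LessThan prod_dividef)
  qed simp
  finally show ?thesis
    by (simp add: A_num_def natpermute_def sum_distrib_left)
qed

lemma fact_double_add:
  "2 ^ k * (\<Prod>j = 1..k. 2 * of_nat j - 1 + 2 * of_nat N) * (\<Prod>j = 1..k. of_nat j + of_nat N) * fact (2 * N)
    = (fact (2 * (N + k)) :: complex)"
proof (induction k)
  case (Suc k)
  have "fact (2 * (N + Suc k)) = (of_nat (2 * (N + k) + 2) * (of_nat (2 * (N + k) + 1) * fact (2 * (N + k))) :: complex)"
    by (simp add: algebra_simps)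
  also have "\<dots> = 2 ^ Suc k * (\<Prod>j = 1..Suc k. 2 * of_nat j - 1 + 2 * of_nat N)
      * (\<Prod>j = 1..Suc k. of_nat j + of_nat N) * fact (2 * N)"
    by (subst Suc[symmetric]) (simp add: prod.nat_ivl_Suc' algebra_simps)
  finally show ?case by simp
qed simp

lemma theta_coeff_0: "theta_coeff d n 0 = [:0, 1:] ^ n"
  by (induction d n "0 :: nat" rule: theta_coeff.induct) simp_all

text \<open>
  The factors in the definition of \<^const>\<open>R_A\<close> are those of \<open>(2 n)! / (2 N)!\<close> with \<open>n = N + k\<close>, except
  that one factor \<open>n\<close> has been cancelled.
\<close>

lemma R_A_R_B:
  assumes "k \<le> (d + 1) div 2"
  shows "of_nat (N + k) * poly (R_A d k) (of_nat N) * fact (2 * N)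
    = fact (2 * (N + k)) * poly (R_B d k) (of_nat N)"
proof (cases k)
  case 0
  have "R_B d 0 = [:0, 1:] ^ (d + 1)"
    using R_B_eq[of 0 d] theta_coeff_0[of d "d + 1"] by simp
  with 0 show ?thesis
    by (simp add: R_A_def)
next
  case (Suc l)
  have "of_nat (N + k) * poly (R_A d k) (of_nat N) * fact (2 * N)
      = poly (R_B d k) (of_nat N) * (2 ^ k * (\<Prod>j = 1..k. 2 * of_nat j - 1 + 2 * of_nat N)
        * ((\<Prod>j = 1..l. of_nat j + of_nat N) * (of_nat k + of_nat N)) * fact (2 * N))"
    by (simp add: R_A_def Suc poly_prod algebra_simps)
  also have "(\<Prod>j = 1..l. of_nat j + of_nat N) * (of_nat k + of_nat N) = (\<Prod>j = 1..k. of_nat j + of_nat N :: complex)"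
    by (simp add: Suc prod.nat_ivl_Suc')
  finally show ?thesis
    unfolding fact_double_add by (simp only: mult.commute)
qed

lemma L_poly_annihilates_A_gen:
  assumes "d > 0"
  shows "op_apply (L_poly d) (fps_to_fls (A_gen d)) = 0"
proof (rule fls_eqI)
  fix n :: int
  let ?a = "fps_to_fls (A_gen d)" and ?b = "bessel ^ d" and ?r = "(d + 1) div 2"
  have neg: "?a $$ m = 0" "?b $$ m = 0" if "m < 0" for m
    using that by (simp_all add: bessel_def flip: fps_to_fls_power)
  have "op_apply (L_poly d) ?a $$ n = (\<Sum>k\<le>?r. poly (R_A d k) (of_int (n - int k)) * ?a $$ (n - int k))"
    unfolding L_poly_def by (rule op_apply_theta_form_nth)
  also have "\<dots> = 0"
  proof (cases "n \<le> 0")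
    case True
    show ?thesis
    proof (rule sum.neutral, safe)
      fix k
      show "poly (R_A d k) (of_int (n - int k)) * ?a $$ (n - int k) = 0"
        using neg(1)[of "n - int k"] True assms by (cases "n - int k = 0") (auto simp: R_A_def)
    qed
  next
    case False
    then obtain m where n: "n = int m" "m > 0"
      by (metis nat_0_le not_le zero_less_nat_eq less_imp_le)
    have "of_nat m * (poly (R_A d k) (of_int (n - int k)) * ?a $$ (n - int k))
        = fact (2 * m) * (poly (R_B d k) (of_int (n - int k)) * ?b $$ (n - int k))" if "k \<le> ?r" for k
    proof (cases "k \<le> m")
      case True
      then obtain N where m: "m = N + k"
        by (metis le_iff_add add.commute)
      have idx: "n - int k = int N"
        by (simp add: n m)
      have a: "?a $$ int N = fact (2 * N) * ?b $$ int N"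
        by (simp add: A_gen_def A_num_eq)
      have "of_nat m * (poly (R_A d k) (of_nat N) * ?a $$ int N)
          = of_nat (N + k) * poly (R_A d k) (of_nat N) * fact (2 * N) * ?b $$ int N"
        by (simp only: a m mult_ac)
      also have "\<dots> = fact (2 * m) * (poly (R_B d k) (of_nat N) * ?b $$ int N)"
        unfolding R_A_R_B[OF that] m by (simp only: mult.assoc)
      finally show ?thesis
        by (simp only: idx of_int_of_nat_eq)
    next
      case False
      then show ?thesis
        by (simp add: n neg)
    qed
    then have "of_nat m * (\<Sum>k\<le>?r. poly (R_A d k) (of_int (n - int k)) * ?a $$ (n - int k))
        = fact (2 * m) * (\<Sum>k\<le>?r. poly (R_B d k) (of_int (n - int k)) * ?b $$ (n - int k))"
      unfolding sum_distrib_left by (intro sum.cong) auto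
    then show ?thesis
      unfolding bessel_power_recurrence using n(2) by (simp only: mult_zero_right mult_eq_0_iff of_nat_eq_0_iff) simp
  qed
  finally show "op_apply (L_poly d) ?a $$ n = 0 $$ n"
    by simp
qed

theorem corollary2:
  fixes d :: nat
  assumes "d \<ge> 2"
  shows "op_order (L_A d) = d \<and>
    op_apply (L_A d) (fps_to_fls (A_gen d)) = 0 \<and>
    \<not> (\<exists>A B :: diffop. op_order A \<ge> 1 \<and> op_order B \<ge> 1 \<and> L_A d = A * B)"
proof (intro conjI)
  have d: "d > 0"
    using assms by simp
  show "op_order (L_A d) = d"
    using d by (rule op_order_L_A)
  have "fls_X * op_apply (L_A d) (fps_to_fls (A_gen d)) = 0"
    using L_poly_annihilates_A_gen[OF d] by (simp add: op_apply_z flip: op_z_L_A_eq)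
  then show "op_apply (L_A d) (fps_to_fls (A_gen d)) = 0"
    by simp
  show "\<not> (\<exists>A B :: diffop. op_order A \<ge> 1 \<and> op_order B \<ge> 1 \<and> L_A d = A * B)"
    using L_A_irreducible[OF d] by blast
qed

end
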